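(* Let $\mathcal{F}$ be the weighted unanchored Sobolev space over $\mathbb{R}^s$ determined by the density $\phi$, the weight parameters $\bm{\gamma}=(\gamma_u)_{u\subseteq\{1:s\}}$ and the weight functions $\bm{\psi}=(\psi_j)_{j=1}^s$. Let $r>\frac12$ be such that for each $j\in\{1:s\}$ there are $C_j>0$ and $r_j\ge r$ with $\widehat{\theta}_j(h)\le C_j|h|^{-2r_j}$ for all $h\in\mathbb{Z}\setminus\{0\}$. Then for every $\epsilon\in(0,r-\frac12]$ there is a constant $\widetilde{c}=\widetilde{c}(r,\bm{\gamma},\epsilon,\phi,\bm{\psi})>0$, independent of $N$ and $k$, such that for every positive integer $N$ and every odd positive integer $k\ge 4\lceil r\log_2 N\rceil-1$, $$\sup_{f\in\mathcal{F},\ \Vert f\Vert_{\mathcal{F}}\le 1}\mathbb{E}\left[\left|M_k(f)-I_{\bm{\phi}}(f)\right|\right]\le \widetilde{c}\,N^{-r+\epsilon}.$$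
   Context: Let $s\ge 1$ and $\{1:s\}=\{1,\dots,s\}$. $\phi$ is a probability density on $\mathbb{R}$ with distribution function $\Phi$, assumed to have an inverse $\Phi^{-1}:(0,1)\to\mathbb{R}$. Put $\bm{\phi}(\bm{y})=\prod_{j=1}^s\phi(y_j)$, let $\bm{\Phi}^{-1}$ denote $\Phi^{-1}$ applied componentwise, and $I_{\bm{\phi}}(f)=\int_{\mathbb{R}^s}f(\bm{y})\bm{\phi}(\bm{y})\,d\bm{y}$. Function space: given weight parameters $\gamma_u>0$ for $u\subseteq\{1:s\}$ with $\gamma_\emptyset=1$, and weight functions $\psi_j:\mathbb{R}\to\mathbb{R}_+$ (positive), $j=1,\dots,s$, the weighted unanchored Sobolev space $\mathcal{F}$ is the space of locally integrable functions on $\mathbb{R}^s$ for which the norm $$\Vert f\Vert_{\mathcal{F}}^2=\sum_{u\subseteq\{1:s\}}\gamma_u^{-1}\int_{\mathbb{R}^{|u|}}\left(\int_{\mathbb{R}^{s-|u|}}\frac{\partial^{|u|}f}{\partial\bm{y}_u}(\bm{y})\prod_{j\in -u}\phi(y_j)\,d\bm{y}_{-u}\right)^2\prod_{j\in u}\psi_j^2(y_j)\,d\bm{y}_u$$ is finite; here $-u=\{1:s\}\setminus u$, $\bm{y}_u=(y_j)_{j\in u}$, and $\partial^{|u|}/\partial\bm{y}_u$ is the (weak) mixed first partial derivative in the variables $y_j$, $j\in u$. Standing assumption: for every $j$ and every finite $c$, $\int_{-\infty}^{c}\frac{\Phi(y)}{\psi_j^2(y)}dy<\infty$ and $\int_c^\infty\frac{1-\Phi(y)}{\psi_j^2(y)}dy<\infty$.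 Under this assumption it is known that $\mathcal{F}$ is a reproducing kernel Hilbert space embedded in $L^2(\mathbb{R}^s,\bm{\phi}(\bm{y})d\bm{y})$, so point evaluations of $f\in\mathcal{F}$ make sense. For $h\in\mathbb{Z}\setminus\{0\}$: $\widehat{\theta}_j(h)=\frac{1}{\pi^2h^2}\int_{\mathbb{R}}\frac{\sin^2(\pi h\Phi(t))}{\psi_j^2(t)}\,dt$. Median estimator: for a positive integer $N$ let $G_N=\{a\in\{1,\dots,N\}:\gcd(a,N)=1\}$. For odd $k$, let $\bm{Z}_1,\dots,\bm{Z}_k$ be uniform on $G_N^s$ and $\bm{\Delta}_1,\dots,\bm{\Delta}_k$ uniform on $[0,1]^s$, all $2k$ random vectors independent, and $$M_k(f)=\underset{1\le l\le k}{\operatorname{median}}\ \frac1N\sum_{n=1}^{N}f\circ\bm{\Phi}^{-1}\left(\left\{\frac{n\bm{Z}_l}{N}+\bm{\Delta}_l\right\}\right),$$ where $\{\cdot\}$ is the componentwise fractional part. *)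

theory Defs
  imports "HOL-Probability.Probability"
begin

text \<open>
  Throughout, the index set \<open>{1,\<dots>,s}\<close> is a finite type \<open>'n\<close> (so \<open>s = CARD('n) \<ge> 1\<close>).
\<close>

subsection \<open>Weak mixed derivatives\<close>

definition partial :: "'n \<Rightarrow> (real ^ 'n \<Rightarrow> real) \<Rightarrow> real ^ 'n \<Rightarrow> real" where
  "partial j f = (\<lambda>x. deriv (\<lambda>t. f (x + t *\<^sub>R axis j 1)) 0)"

definition partials :: "'n list \<Rightarrow> (real ^ 'n \<Rightarrow> real) \<Rightarrow> real ^ 'n \<Rightarrow> real" where
  "partials js f = foldr partial js f"

text \<open>
  A function is smooth iff its iterated partial derivatives of all orders are (Frechet)
  differentiable everywhere; continuity of all of them then comes for free.
\<close>

definition test_function :: "(real ^ 'n :: finite \<Rightarrow> real) \<Rightarrow> bool" where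
  "test_function \<eta> \<longleftrightarrow>
     (\<forall>js. partials js \<eta> differentiable_on UNIV) \<and> compact (closure {x. \<eta> x \<noteq> 0})"

text \<open>
  Elements of \<open>L\<^sup>1\<^sub>l\<^sub>o\<^sub>c\<close> are represented by Borel measurable functions (every almost-everywhere
  class contains one), which is what integrability with respect to \<^const>\<open>lborel\<close> demands.
\<close>

definition locally_integrable :: "(real ^ 'n :: finite \<Rightarrow> real) \<Rightarrow> bool" where
  "locally_integrable f \<longleftrightarrow> (\<forall>K. compact K \<longrightarrow> set_integrable lborel K f)"

text \<open>
  \<open>g\<close> is the weak mixed first derivative of \<open>f\<close> in the variables \<open>y\<^sub>j\<close>, \<open>j \<in> u\<close>. The list \<open>js\<close>
  enumerates \<open>u\<close>; the order does not matter, as the test functions are smooth.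
\<close>

definition is_weak_deriv ::
  "'n set \<Rightarrow> (real ^ 'n :: finite \<Rightarrow> real) \<Rightarrow> (real ^ 'n \<Rightarrow> real) \<Rightarrow> bool" where
  "is_weak_deriv u f g \<longleftrightarrow> locally_integrable g \<and>
     (\<forall>\<eta> js. test_function \<eta> \<and> distinct js \<and> set js = u \<longrightarrow>
        (\<integral>x. f x * partials js \<eta> x \<partial>lborel) = (-1) ^ card u * (\<integral>x. g x * \<eta> x \<partial>lborel))"

text \<open>A weak derivative is unique up to null sets, so the choice below is immaterial.\<close>

definition weak_deriv :: "'n set \<Rightarrow> (real ^ 'n :: finite \<Rightarrow> real) \<Rightarrow> real ^ 'n \<Rightarrow> real" where
  "weak_deriv u f = (SOME g. is_weak_deriv u f g)"


subsection \<open>The weighted unanchored Sobolev space\<close>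

definition glue :: "'n set \<Rightarrow> ('n \<Rightarrow> real) \<Rightarrow> ('n \<Rightarrow> real) \<Rightarrow> real ^ 'n" where
  "glue u y z = (\<chi> j. if j \<in> u then y j else z j)"

text \<open>
  For \<open>y = y\<^sub>u\<close> in the product of the real lines indexed by \<open>u\<close>, the following is the integrand,
  as a function of \<open>z = y\<^bsub>-u\<^esub>\<close>, of the inner integral in the definition of the norm.
\<close>

definition inner_integrand ::
  "(real \<Rightarrow> real) \<Rightarrow> (real ^ 'n \<Rightarrow> real) \<Rightarrow> 'n :: finite set \<Rightarrow> ('n \<Rightarrow> real) \<Rightarrow> ('n \<Rightarrow> real) \<Rightarrow> real"
  where
  "inner_integrand \<phi> f u y z = weak_deriv u f (glue u y z) * (\<Prod>j\<in>-u. \<phi> (z j))"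

definition sobolev_norm_sq ::
  "(real \<Rightarrow> real) \<Rightarrow> ('n set \<Rightarrow> real) \<Rightarrow> ('n \<Rightarrow> real \<Rightarrow> real) \<Rightarrow> (real ^ 'n :: finite \<Rightarrow> real) \<Rightarrow> ennreal"
  where
  "sobolev_norm_sq \<phi> \<gamma> \<psi> f =
     (\<Sum>u\<in>Pow UNIV. ennreal (inverse (\<gamma> u)) *
        (\<integral>\<^sup>+y. ennreal ((\<integral>z. inner_integrand \<phi> f u y z \<partial>(\<Pi>\<^sub>M j\<in>-u. lborel))\<^sup>2 *
                     (\<Prod>j\<in>u. (\<psi> j (y j))\<^sup>2)) \<partial>(\<Pi>\<^sub>M j\<in>u. lborel)))"

text \<open>
  Since the Bochner integral of a non-integrable function is 0 by convention, the existence of the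
  weak derivatives and of the inner integrals (for almost every \<open>y\<^sub>u\<close>), which is implicit in
  ``the norm is finite'', has to be required separately.
\<close>

definition sobolev_space ::
  "(real \<Rightarrow> real) \<Rightarrow> ('n set \<Rightarrow> real) \<Rightarrow> ('n \<Rightarrow> real \<Rightarrow> real) \<Rightarrow> (real ^ 'n :: finite \<Rightarrow> real) set"
  where
  "sobolev_space \<phi> \<gamma> \<psi> =
     {f. locally_integrable f \<and>
         (\<forall>u. (\<exists>g. is_weak_deriv u f g) \<and>
              (AE y in (\<Pi>\<^sub>M j\<in>u. lborel).
                 integrable (\<Pi>\<^sub>M j\<in>-u. lborel) (inner_integrand \<phi> f u y))) \<and>
         sobolev_norm_sq \<phi> \<gamma> \<psi> f < \<infinity>}"

definition sobolev_norm ::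
  "(real \<Rightarrow> real) \<Rightarrow> ('n set \<Rightarrow> real) \<Rightarrow> ('n \<Rightarrow> real \<Rightarrow> real) \<Rightarrow> (real ^ 'n :: finite \<Rightarrow> real) \<Rightarrow> real"
  where
  "sobolev_norm \<phi> \<gamma> \<psi> f = sqrt (enn2real (sobolev_norm_sq \<phi> \<gamma> \<psi> f))"

text \<open>
  Members of the space are only determined up to null sets. Point evaluation in the
  reproducing kernel Hilbert space is evaluation of the (unique) continuous representative.
\<close>

definition cont_rep :: "(real ^ 'n :: finite \<Rightarrow> real) \<Rightarrow> real ^ 'n \<Rightarrow> real" where
  "cont_rep f = (THE g. continuous_on UNIV g \<and> (AE x in lborel. g x = f x))"


subsection \<open>Distribution function, integral and the decay quantity\<close>

definition dist_fun :: "(real \<Rightarrow> real) \<Rightarrow> real \<Rightarrow> real" where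
  "dist_fun \<phi> = cdf (density lborel (\<lambda>x. ennreal (\<phi> x)))"

definition weighted_integral :: "(real \<Rightarrow> real) \<Rightarrow> (real ^ 'n :: finite \<Rightarrow> real) \<Rightarrow> real" where
  "weighted_integral \<phi> f = (\<integral>y. f y * (\<Prod>j\<in>UNIV. \<phi> (y $ j)) \<partial>lborel)"

definition theta_hat :: "(real \<Rightarrow> real) \<Rightarrow> (real \<Rightarrow> real) \<Rightarrow> int \<Rightarrow> real" where
  "theta_hat \<phi> \<psi>j h =
     1 / (pi\<^sup>2 * (real_of_int h)\<^sup>2) *
       (\<integral>t. (sin (pi * real_of_int h * dist_fun \<phi> t))\<^sup>2 / (\<psi>j t)\<^sup>2 \<partial>lborel)"


subsection \<open>The median of randomly shifted lattice rules\<close>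

definition unit_residues :: "nat \<Rightarrow> nat set" where
  "unit_residues N = {a \<in> {1..N}. coprime a N}"

text \<open>
  \<open>the_inv\<close> is only meaningful on \<open>(0,1)\<close>; the points with a coordinate 0 have probability 0.
\<close>

definition lattice_rule ::
  "(real \<Rightarrow> real) \<Rightarrow> nat \<Rightarrow> (real ^ 'n :: finite \<Rightarrow> real) \<Rightarrow> nat ^ 'n \<Rightarrow> real ^ 'n \<Rightarrow> real" where
  "lattice_rule \<phi> N f Z \<Delta> =
     1 / real N * (\<Sum>n=1..N.
       f (\<chi> j. the_inv (dist_fun \<phi>) (frac (real n * real (Z $ j) / real N + \<Delta> $ j))))"

text \<open>The median of an odd number of values.\<close>

definition median :: "real list \<Rightarrow> real" where
  "median xs = sort xs ! (length xs div 2)"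

text \<open>A sample point is the sequence of pairs \<open>(Z\<^sub>l, \<Delta>\<^sub>l)\<close>, indexed by \<open>l < k\<close>.\<close>

definition median_rule ::
  "(real \<Rightarrow> real) \<Rightarrow> nat \<Rightarrow> nat \<Rightarrow> (real ^ 'n :: finite \<Rightarrow> real) \<Rightarrow>
   (nat \<Rightarrow> (nat ^ 'n) \<times> (real ^ 'n)) \<Rightarrow> real" where
  "median_rule \<phi> N k f \<omega> =
     median (map (\<lambda>l. lattice_rule \<phi> N (cont_rep f) (fst (\<omega> l)) (snd (\<omega> l))) [0..<k])"

text \<open>The joint law of the \<open>2k\<close> independent uniform vectors.\<close>

definition sample_measure ::
  "nat \<Rightarrow> nat \<Rightarrow> (nat \<Rightarrow> (nat ^ 'n :: finite) \<times> (real ^ 'n)) measure" where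
  "sample_measure N k =
     (\<Pi>\<^sub>M l\<in>{..<k}.
        measure_pmf (pmf_of_set {Z. \<forall>j. Z $ j \<in> unit_residues N}) \<Otimes>\<^sub>M
        uniform_measure lborel {x. \<forall>j. 0 \<le> x $ j \<and> x $ j \<le> 1})"

end

theory Submission
  imports Defs "HOL-Number_Theory.Totient"
begin

text \<open>
  Write \<open>k(y, t) = 1[t \<le> y] - (1 - \<Phi> t)\<close>, so that \<open>\<partial>k/\<partial>y\<close> is the point mass at \<open>t\<close> and \<open>k(\<sqdot>, t)\<close> has
  mean zero under \<open>\<phi>\<close>. Every \<open>f\<close> in the space decomposes as
  \<open>f(x) = \<Sum>w. \<integral> m\<^sub>w(t) \<Prod>j\<in>w. k(x\<^sub>j, t\<^sub>j) dt\<close>, where \<open>m\<^sub>w\<close> is the \<open>\<phi>\<close>-marginal of the weak derivative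
  \<open>\<partial>\<^sup>w f\<close>. This is proved for all weak derivatives at once by downward induction on the set of
  differentiated variables: the difference of both sides has vanishing derivatives in the remaining
  variables, hence does not depend on them by the lemma of du Bois-Reymond, and its marginal is zero.

  Under \<open>y = \<Phi>\<^sup>-\<^sup>1(x)\<close> the kernel becomes the jump \<open>1[\<Phi> t \<le> x] - (1 - \<Phi> t)\<close>, whose autocorrelation has
  Fourier coefficients \<open>sin\<^sup>2(\<pi> h \<Phi> t) / (\<pi> h)\<^sup>2\<close>. The Cauchy-Schwarz inequality against the weights
  \<open>\<psi>\<^sub>j\<close> bounds the mean square over the shift of the error with generator \<open>Z\<close> by a sum of
  \<open>\<Prod>j\<in>w. \<theta>\<^sub>j(h\<^sub>j)\<close> over the frequencies \<open>h\<close> in the dual lattice of \<open>Z\<close>. Averaging the analogous sum with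
  exponent \<open>\<alpha> > 1\<close> over \<open>Z\<close> gives \<open>O(N\<^sup>\<delta>\<^sup>-\<^sup>1)\<close>, by divisor bounds; since \<open>\<Sum> a\<^sup>p \<le> (\<Sum> a)\<^sup>p\<close>, Markov's
  inequality then shows that a single random rule errs by more than \<open>a = O(N\<^sup>-\<^sup>r\<^sup>+\<^sup>\<epsilon>)\<close> with probability
  at most \<open>1/16\<close>. If the median errs by more than \<open>a\<close>, so do more than \<open>k/2\<close> of the estimators, which
  by independence makes the remaining contribution to the expectation \<open>O(2\<^sup>k 16\<^sup>-\<^sup>k\<^sup>/\<^sup>2) = O(N\<^sup>-\<^sup>r)\<close>.
\<close>

section \<open>Smooth functions of one variable\<close>

text \<open>When s \<ge> 2, the average over Z of the dual-lattice sum cannot decay faster than 1/N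
  at any exponent: with probability at least 1/N two given components of Z coincide, and then (1,
  -1) is a dual vector. Hence the detour over two exponents. At \<alpha> just above 1 Markov's
  inequality loses almost nothing, since the typical sum is about N^(\<delta>-1); raising it to the
  power p = 2r/\<alpha> turns this into N^(-2(r-\<epsilon>)) for all generators outside a small
  exceptional set. A mean would still feel that set, a median does not. The analytic obstacle is
  that members of the space are known only through weak derivatives and that m_w need not be
  integrable. All identities are therefore tested against tensor products of bumps, where each
  integration by parts concerns one factor, and absolute convergence comes from Cauchy-Schwarz: m_w
  times the weights is square integrable by the norm, and a local bound of the kernel over the
  weights is so by the standing assumption. That bound is uniform for x in compact sets, which also
  yields continuity of the representation.\<close>

primrec smooth_upto :: "nat \<Rightarrow> (real \<Rightarrow> real) \<Rightarrow> bool" where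
  "smooth_upto 0 f \<longleftrightarrow> (\<forall>x. f differentiable (at x))"
| "smooth_upto (Suc n) f \<longleftrightarrow> (\<forall>x. f differentiable (at x)) \<and> smooth_upto n (deriv f)"

definition smooth :: "(real \<Rightarrow> real) \<Rightarrow> bool" where
  "smooth f \<longleftrightarrow> (\<forall>n. smooth_upto n f)"

definition bump :: "(real \<Rightarrow> real) \<Rightarrow> bool" where
  "bump f \<longleftrightarrow> smooth f \<and> (\<exists>b. \<forall>x. b < \<bar>x\<bar> \<longrightarrow> f x = 0)"

lemma smooth_upto_differentiable: "smooth_upto n f \<Longrightarrow> f differentiable (at x)"
  by (cases n) auto

lemma smooth_upto_Suc_D: "smooth_upto (Suc n) f \<Longrightarrow> smooth_upto n f"
  by (induction n arbitrary: f) auto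

lemma deriv_eqI: "(\<And>x. (f has_real_derivative g x) (at x)) \<Longrightarrow> deriv f = g"
  by (auto intro: DERIV_imp_deriv)

lemma differentiable_DERIV:
  "(f :: real \<Rightarrow> real) differentiable (at x) \<Longrightarrow> (f has_real_derivative deriv f x) (at x)"
  using DERIV_deriv_iff_real_differentiable by blast

lemma smooth_upto_add:
  "smooth_upto n f \<Longrightarrow> smooth_upto n g \<Longrightarrow> smooth_upto n (\<lambda>x. f x + g x)"
proof (induction n arbitrary: f g)
  case (Suc n)
  have "deriv (\<lambda>x. f x + g x) = (\<lambda>x. deriv f x + deriv g x)"
    by (rule deriv_eqI, rule derivative_intros)
       (use Suc.prems in \<open>auto intro!: differentiable_DERIV\<close>)
  with Suc show ?case by (auto intro!: derivative_intros)
qed auto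

lemma smooth_upto_mult:
  "smooth_upto n f \<Longrightarrow> smooth_upto n g \<Longrightarrow> smooth_upto n (\<lambda>x. f x * g x)"
proof (induction n arbitrary: f g)
  case (Suc n)
  have "deriv (\<lambda>x. f x * g x) = (\<lambda>x. f x * deriv g x + deriv f x * g x)"
    by (rule deriv_eqI, rule DERIV_mult'[THEN DERIV_cong])
       (use Suc.prems in \<open>auto intro!: differentiable_DERIV\<close>)
  moreover have "smooth_upto n (\<lambda>x. f x * deriv g x + deriv f x * g x)"
    using Suc.prems Suc.prems[THEN smooth_upto_Suc_D] by (intro smooth_upto_add Suc.IH) simp_all
  ultimately show ?case using Suc.prems by (auto intro!: derivative_intros)
qed auto

lemma smooth_upto_const: "smooth_upto n (\<lambda>x. c)"
proof (induction n arbitrary: c)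
  case (Suc n)
  have "deriv (\<lambda>x::real. c) = (\<lambda>x. 0)" by (rule deriv_eqI) auto
  with Suc show ?case by auto
qed auto

lemma DERIV_affine:
  assumes "(f :: real \<Rightarrow> real) differentiable (at (a * x + b))"
  shows "((\<lambda>x. f (a * x + b)) has_real_derivative a * deriv f (a * x + b)) (at x)"
proof -
  have "((\<lambda>x. a * x + b) has_real_derivative a) (at x)"
    by (auto intro!: derivative_eq_intros)
  from DERIV_chain2[where f = f and g = "\<lambda>x. a * x + b", OF differentiable_DERIV[OF assms] this]
  show ?thesis by (simp add: mult.commute)
qed

lemma smooth_upto_affine: "smooth_upto n f \<Longrightarrow> smooth_upto n (\<lambda>x. f (a * x + b))"
proof (induction n arbitrary: f)
  case 0
  then show ?case using DERIV_affine real_differentiable_def by (metis smooth_upto.simps(1))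
next
  case (Suc n)
  have D: "((\<lambda>x. f (a * x + b)) has_real_derivative a * deriv f (a * x + b)) (at x)" for x
    using Suc.prems by (intro DERIV_affine) simp
  have "smooth_upto n (\<lambda>x. a * deriv f (a * x + b))"
    by (intro smooth_upto_mult smooth_upto_const Suc.IH) (use Suc.prems in simp)
  with D show ?case
    using deriv_eqI[OF D] real_differentiable_def by auto
qed

lemma smooth_mult: "smooth f \<Longrightarrow> smooth g \<Longrightarrow> smooth (\<lambda>x. f x * g x)"
  by (simp add: smooth_def smooth_upto_mult)

lemma smooth_add: "smooth f \<Longrightarrow> smooth g \<Longrightarrow> smooth (\<lambda>x. f x + g x)"
  by (simp add: smooth_def smooth_upto_add)

lemma smooth_const: "smooth (\<lambda>x. c)"
  by (simp add: smooth_def smooth_upto_const)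

lemma smooth_affine: "smooth f \<Longrightarrow> smooth (\<lambda>x. f (a * x + b))"
  by (simp add: smooth_def smooth_upto_affine)

lemma smooth_DERIV: "smooth f \<Longrightarrow> (f has_real_derivative deriv f x) (at x)"
  by (auto simp: smooth_def intro!: differentiable_DERIV smooth_upto_differentiable[of 0])

lemma smooth_deriv: "smooth f \<Longrightarrow> smooth (deriv f)"
  unfolding smooth_def using smooth_upto.simps(2)[of _ f] by blast

lemma smooth_antiderivative:
  assumes "\<And>x. (F has_real_derivative f x) (at x)" "smooth f"
  shows "smooth F"
proof -
  have "smooth_upto n F" for n
  proof (cases n)
    case 0
    then show ?thesis using assms(1) real_differentiable_def by auto
  next
    case (Suc m)
    then show ?thesis
      using assms deriv_eqI[of F f] real_differentiable_def unfolding smooth_def by auto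
  qed
  then show ?thesis by (simp add: smooth_def)
qed

lemma smooth_continuous: "smooth f \<Longrightarrow> continuous_on A f"
  by (intro continuous_at_imp_continuous_on ballI DERIV_isCont[OF smooth_DERIV])

text \<open>Polynomial multiples of the standard flat function \<open>exp (-1/t)\<close>; this class is closed under
  differentiation.\<close>

definition flat :: "real poly \<Rightarrow> real \<Rightarrow> real" where
  "flat p t = (if t > 0 then poly p (1 / t) * exp (- (1 / t)) else 0)"

lemma poly_exp_tendsto_0: "((\<lambda>x::real. poly p x * exp (- x)) \<longlongrightarrow> 0) at_top"
proof -
  \<comment> \<open>The power \<open>x ^ k\<close> is carried along because \<open>pCons a p\<close>
    contributes a constant term and one more factor x in front of p.\<close>
  have "((\<lambda>x::real. x ^ k * poly p x * exp (- x)) \<longlongrightarrow> 0) at_top" for k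
  proof (induction p arbitrary: k)
    case (pCons a p)
    have "((\<lambda>x::real. a * (x ^ k * exp (- x)) + x ^ Suc k * poly p x * exp (- x)) \<longlongrightarrow> a * 0 + 0) at_top"
      by (intro tendsto_intros pCons.IH)
         (use tendsto_power_div_exp_0[of k] in \<open>simp add: exp_minus divide_inverse\<close>)
    then show ?case by (simp add: algebra_simps)
  qed auto
  from this[of 0] show ?thesis by simp
qed

text \<open>With s = 1/t, differentiating p(s) exp(-s) in t gives s^2 (p - p')(s) exp(-s), again of
  the same form; \<open>[:0, 0, 1:]\<close> is s^2. At 0 the right-hand difference quotient is s
  p(s) exp(-s) with s tending to infinity.\<close>

lemma flat_DERIV: "(flat p has_real_derivative flat ([:0, 0, 1:] * (p - pderiv p)) t) (at t)"
proof -
  consider "t > 0" | "t < 0" | "t = 0" by linarith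
  then show ?thesis
  proof cases
    case 1
    have inv: "((\<lambda>t. 1 / t) has_real_derivative - (1 / t\<^sup>2)) (at t)"
      using 1 by (auto intro!: derivative_eq_intros simp: power2_eq_square)
    have "((\<lambda>t. poly p (1 / t) * exp (- (1 / t))) has_real_derivative
            poly p (1 / t) * (exp (- (1 / t)) * (1 / t\<^sup>2)) +
            (poly (pderiv p) (1 / t) * - (1 / t\<^sup>2)) * exp (- (1 / t))) (at t)"
      using DERIV_chain2[OF DERIV_exp DERIV_minus[OF inv]] DERIV_chain2[OF poly_DERIV inv]
      by (intro DERIV_mult') auto
    also have "poly p (1 / t) * (exp (- (1 / t)) * (1 / t\<^sup>2)) +
            (poly (pderiv p) (1 / t) * - (1 / t\<^sup>2)) * exp (- (1 / t)) = flat ([:0, 0, 1:] * (p - pderiv p)) t"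
      using 1 by (simp add: flat_def field_simps power2_eq_square)
    finally have "((\<lambda>t. poly p (1 / t) * exp (- (1 / t))) has_real_derivative
            flat ([:0, 0, 1:] * (p - pderiv p)) t) (at t)" .
    then show ?thesis
      by (rule has_field_derivative_transform_within_open[of _ _ _ "{0<..}"])
         (use 1 in \<open>auto simp: flat_def\<close>)
  next
    case 2
    have "((\<lambda>t. 0) has_real_derivative flat ([:0, 0, 1:] * (p - pderiv p)) t) (at t)"
      using 2 by (auto simp: flat_def)
    then show ?thesis
      by (rule has_field_derivative_transform_within_open[of _ _ _ "{..<0}"])
         (use 2 in \<open>auto simp: flat_def\<close>)
  next
    case 3
    have "((\<lambda>x. poly ([:0,1:] * p) (inverse x) * exp (- inverse x)) \<longlongrightarrow> 0) (at_right 0)"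
      by (rule filterlim_compose[OF poly_exp_tendsto_0 filterlim_inverse_at_top_right])
    then have "((\<lambda>h. (flat p (0 + h) - flat p 0) / h) \<longlongrightarrow> 0) (at_right 0)"
      by (rule Lim_transform_eventually)
         (rule eventually_mono[OF eventually_at_right_less], simp add: flat_def inverse_eq_divide)
    moreover have "((\<lambda>h. (flat p (0 + h) - flat p 0) / h) \<longlongrightarrow> 0) (at_left 0)"
      by (rule Lim_transform_eventually[OF tendsto_const])
         (auto simp: flat_def eventually_at_filter)
    ultimately show ?thesis
      unfolding 3 by (auto simp: DERIV_def flat_def intro: filterlim_split_at)
  qed
qed

lemma smooth_flat: "smooth (flat p)"
proof -
  have "smooth_upto n (flat p)" for n
  proof (induction n arbitrary: p)
    case 0
    then show ?case using flat_DERIV real_differentiable_def by auto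
  next
    case (Suc n)
    have "deriv (flat p) = flat ([:0, 0, 1:] * (p - pderiv p))"
      by (intro deriv_eqI flat_DERIV)
    then show ?case using Suc flat_DERIV real_differentiable_def by (auto simp del: mult_pCons_left)
  qed
  then show ?thesis by (simp add: smooth_def)
qed

text \<open>The factor n inside \<open>flat 1\<close> replaces a plateau: exp(-1/(n y)) tends to 1
  for every y > 0, so these bumps tend pointwise to the indicator of the open interval while staying
  below that of the closed one.\<close>

definition box_bump :: "real \<Rightarrow> real \<Rightarrow> nat \<Rightarrow> real \<Rightarrow> real" where
  "box_bump a b n x = flat 1 (real n * (x - a)) * flat 1 (real n * (b - x))"

lemma flat_1_bounds: "0 \<le> flat 1 t" "flat 1 t \<le> 1"
  by (auto simp: flat_def)

lemma box_bump_bounds: "0 \<le> box_bump a b n x" "box_bump a b n x \<le> indicator {a..b} x"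
proof -
  show "0 \<le> box_bump a b n x" by (simp add: box_bump_def flat_1_bounds)
  show "box_bump a b n x \<le> indicator {a..b} x"
  proof (cases "x \<in> {a..b}")
    case True
    then show ?thesis by (auto simp: box_bump_def intro!: mult_le_one flat_1_bounds)
  next
    case False
    then have "real n * (x - a) \<le> 0 \<or> real n * (b - x) \<le> 0"
      by (auto simp: mult_le_0_iff)
    then show ?thesis using False by (auto simp: box_bump_def flat_def)
  qed
qed

lemma bump_box_bump: "bump (box_bump a b n)"
proof -
  have "smooth (\<lambda>x. flat 1 (real n * x + (- real n * a)) * flat 1 (- real n * x + real n * b))"
    by (intro smooth_mult smooth_affine smooth_flat)
  then have "smooth (box_bump a b n)"
    unfolding box_bump_def[abs_def] by (simp add: algebra_simps)
  moreover have "box_bump a b n x = 0" if "max \<bar>a\<bar> \<bar>b\<bar> < \<bar>x\<bar>" for x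
    using box_bump_bounds[of a b n x] that by (cases "x \<in> {a..b}") auto
  ultimately show ?thesis unfolding bump_def by blast
qed

lemma box_bump_tendsto: "(\<lambda>n. box_bump a b n x) \<longlonglongrightarrow> indicator {a<..<b} x"
proof -
  have *: "(\<lambda>n. flat 1 (real n * y)) \<longlonglongrightarrow> (if y > 0 then 1 else 0)" for y
  proof (cases "y > 0")
    case True
    have "(\<lambda>n. exp (- (1 / (real n * y)))) \<longlonglongrightarrow> exp (- 0)"
    proof (intro tendsto_intros)
      have "(\<lambda>n. (1 / y) * (1 / real n)) \<longlonglongrightarrow> (1 / y) * 0"
        by (intro tendsto_mult tendsto_const lim_1_over_n)
      then show "(\<lambda>n. 1 / (real n * y)) \<longlonglongrightarrow> 0" by (simp add: field_simps)
    qed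
    then have "(\<lambda>n. exp (- (1 / (real n * y)))) \<longlonglongrightarrow> 1" by simp
    then show ?thesis
      using True by (simp, elim Lim_transform_eventually)
         (auto simp: flat_def intro!: eventually_mono[OF eventually_gt_at_top[of 0]])
  next
    case False
    then have "flat 1 (real n * y) = 0" for n
      by (auto simp: flat_def mult_pos_pos zero_less_mult_iff)
    with False show ?thesis by simp
  qed
  have "(\<lambda>n. box_bump a b n x) \<longlonglongrightarrow> (if x - a > 0 then 1 else 0) * (if b - x > 0 then 1 else 0)"
    unfolding box_bump_def by (intro tendsto_mult *)
  moreover have "(if x - a > 0 then 1 else 0) * (if b - x > 0 then 1 else 0) = indicat_real {a<..<b} x"
    by (auto simp: indicator_def)
  ultimately show ?thesis by simp
qed

lemma bump_deriv: assumes "bump f" shows "bump (deriv f)"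
proof -
  from assms obtain b where b: "\<And>x. b < \<bar>x\<bar> \<Longrightarrow> f x = 0" and s: "smooth f"
    unfolding bump_def by blast
  have "deriv f x = 0" if "b < \<bar>x\<bar>" for x
  proof -
    have "((\<lambda>x. 0) has_real_derivative 0) (at x)" by simp
    then have "(f has_real_derivative 0) (at x)"
      by (rule has_field_derivative_transform_within_open[of _ _ _ "{x. b < \<bar>x\<bar>}"])
         (use that b in \<open>auto intro!: open_Collect_less continuous_intros\<close>)
    then show ?thesis by (rule DERIV_imp_deriv)
  qed
  then show ?thesis using smooth_deriv[OF s] unfolding bump_def by blast
qed

lemma bump_mult_const: "bump f \<Longrightarrow> bump (\<lambda>x. c * f x)"
  unfolding bump_def by (auto intro: smooth_mult smooth_const)

lemma bump_add: assumes "bump f" "bump g" shows "bump (\<lambda>x. f x + g x)"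
proof -
  from assms obtain a b where "\<forall>x. a < \<bar>x\<bar> \<longrightarrow> f x = 0" "\<forall>x. b < \<bar>x\<bar> \<longrightarrow> g x = 0"
    unfolding bump_def by blast
  then have "\<exists>c. \<forall>x. c < \<bar>x\<bar> \<longrightarrow> f x + g x = 0" by (intro exI[of _ "max a b"]) auto
  then show ?thesis using assms unfolding bump_def by (auto intro: smooth_add)
qed

lemma bump_borel: "bump f \<Longrightarrow> f \<in> borel_measurable borel"
  by (auto simp: bump_def intro!: borel_measurable_continuous_onI smooth_continuous)

text \<open>One number bounds both the height and the radius of the support, the form that
  \<open>cutoff\<close> shares.\<close>

lemma bump_bounded:
  assumes "bump f"
  obtains B where "B \<ge> 0" "\<And>x. \<bar>f x\<bar> \<le> B * indicator {-B..B} x"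
proof -
  from assms obtain b where b: "\<And>x. b < \<bar>x\<bar> \<Longrightarrow> f x = 0" and s: "smooth f"
    unfolding bump_def by blast
  have "compact (f ` {-b..b})" using smooth_continuous[OF s] compact_continuous_image by blast
  then obtain C where C: "\<And>x. x \<in> {-b..b} \<Longrightarrow> \<bar>f x\<bar> \<le> C"
    by (force dest!: compact_imp_bounded simp: bounded_iff)
  define B where "B = max 0 (max b C)"
  have "\<bar>f x\<bar> \<le> B * indicator {-B..B} x" for x
  proof (cases "\<bar>x\<bar> \<le> b")
    case True
    then show ?thesis using C[of x] by (auto simp: B_def indicator_def abs_le_iff intro: le_max_iff_disj[THEN iffD2])
  next
    case False
    then show ?thesis using b[of x] by (auto simp: B_def indicator_def)
  qed
  moreover have "B \<ge> 0" by (simp add: B_def)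
  ultimately show ?thesis using that by blast
qed

lemma bump_integrable: assumes "bump f" shows "integrable lborel f"
proof -
  obtain B where "B \<ge> 0" and B: "\<And>x. \<bar>f x\<bar> \<le> B * indicator {-B..B} x"
    using bump_bounded[OF assms] by metis
  have "integrable lborel (\<lambda>x. B * indicator {-B..B} x)"
    by (intro integrable_mult_right integrable_real_indicator) (auto simp: emeasure_lborel_Icc_eq)
  then show ?thesis
  proof (rule Bochner_Integration.integrable_bound)
    show "f \<in> borel_measurable lborel" using bump_borel[OF assms] by simp
    show "AE x in lborel. norm (f x) \<le> norm (B * indicator {-B..B} x)"
      using order.trans[OF B abs_ge_self] by simp
  qed
qed

text \<open>Outside the support of f an antiderivative is constant on either side, and the vanishing
  integral makes the two constants agree; subtracting their common value leaves a bump. Thus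
  orthogonality to mean-zero factors is the same as a vanishing weak derivative.\<close>

lemma bump_zero_mean_antiderivative:
  assumes "bump f" "(\<integral>x. f x \<partial>lborel) = 0"
  obtains F where "bump F" "deriv F = f"
proof -
  from assms obtain b0 where b0: "\<And>x. b0 < \<bar>x\<bar> \<Longrightarrow> f x = 0" and s: "smooth f"
    unfolding bump_def by blast
  define b where "b = max 1 b0"
  have b: "f x = 0" if "b < \<bar>x\<bar>" for x using that b0 by (auto simp: b_def)
  have "b > 0" by (simp add: b_def)
  obtain F where F: "\<And>x. (F has_real_derivative f x) (at x)"
  proof -
    have "\<exists>F. \<forall>x. -\<infinity> < ereal x \<longrightarrow> ereal x < \<infinity> \<longrightarrow> (F has_vector_derivative f x) (at x)"
      by (rule einterval_antiderivative)
         (use smooth_continuous[OF s, of UNIV] in \<open>auto simp: continuous_on_eq_continuous_at\<close>)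
    then show ?thesis
      using that by (auto simp: has_real_derivative_iff_has_vector_derivative)
  qed
  have F_eq: "F x = F y" if "x \<le> y" "{x..y} \<inter> {-b<..<b} = {} " "y \<le> -b \<or> x \<ge> b" for x y
  proof (cases "x = y")
    case False
    then have "x < y" using that by simp
    then show ?thesis
    proof (rule DERIV_isconst_end[symmetric])
      show "continuous_on {x..y} F" by (intro continuous_at_imp_continuous_on ballI DERIV_isCont[OF F])
      fix z assume "x < z" "z < y"
      then have "f z = 0" using that b[of z] by auto
      then show "DERIV F z :> 0" using F[of z] by simp
    qed
  qed auto
  have 1: "F x = F (-b)" if "x \<le> -b" for x by (rule F_eq) (use that in auto)
  have 2: "F x = F b" if "x \<ge> b" for x by (rule F_eq[symmetric]) (use that in auto)
  have "(\<integral>x. f x * indicator {-b..b} x \<partial>lborel) = F b - F (-b)"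
    by (rule integral_FTC_Icc_real) (use \<open>b > 0\<close> F DERIV_isCont[OF smooth_DERIV[OF s]] in auto)
  moreover have "(\<lambda>x. f x * indicator {-b..b} x) = f"
  proof
    fix x show "f x * indicator {-b..b} x = f x"
      using b[of x] by (cases "x \<in> {-b..b}") auto
  qed
  ultimately have 3: "F b = F (-b)" using assms(2) by simp
  define G where "G x = F x - F b" for x
  have DG: "(G has_real_derivative f x) (at x)" for x
    unfolding G_def by (auto intro!: derivative_eq_intros F)
  then have "smooth G" using smooth_antiderivative s by blast
  moreover have "G x = 0" if "b < \<bar>x\<bar>" for x
    using that 1[of x] 2[of x] 3 by (auto simp: G_def abs_if split: if_splits)
  ultimately have "bump G" unfolding bump_def by blast
  with deriv_eqI[OF DG] show ?thesis using that by blast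
qed

lemma ex_unit_bump: obtains f where "bump f" "(\<integral>x. f x \<partial>lborel) = 1"
proof -
  define g where "g = box_bump 0 1 1"
  have g: "bump g" using bump_box_bump by (simp add: g_def)
  have "(\<integral>x. g x \<partial>lborel) \<noteq> 0"
  proof
    assume "(\<integral>x. g x \<partial>lborel) = 0"
    then have "AE x in lborel. g x = 0"
      using integral_nonneg_eq_0_iff_AE[OF bump_integrable[OF g]] box_bump_bounds by (auto simp: g_def)
    then have "AE x in lborel. x \<notin> {0<..<1::real}"
      by eventually_elim (auto simp: g_def box_bump_def flat_def)
    then have "emeasure lborel {0<..<1::real} = 0"
      by (subst (asm) AE_iff_measurable[OF _ refl]) (auto simp: greaterThanLessThan_def greaterThan_def lessThan_def Int_def)
    then show False by simp
  qed
  then have "(\<integral>x. (1 / (\<integral>x. g x \<partial>lborel)) * g x \<partial>lborel) = 1"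
    by (subst integral_mult_right_zero) simp
  with bump_mult_const[OF g] show ?thesis by (rule that)
qed

section \<open>Tensor products as test functions\<close>

definition tensor :: "('n::finite \<Rightarrow> real \<Rightarrow> real) \<Rightarrow> real ^ 'n \<Rightarrow> real" where
  "tensor \<eta> x = (\<Prod>j\<in>UNIV. \<eta> j (x $ j))"

lemma partial_tensor:
  assumes "smooth (\<eta> i)"
  shows "partial i (tensor \<eta>) = tensor (\<eta>(i := deriv (\<eta> i)))"
proof
  fix x :: "real ^ 'a"
  have "tensor \<eta> (x + t *\<^sub>R axis i 1) = \<eta> i (x $ i + t) * (\<Prod>j\<in>UNIV-{i}. \<eta> j (x $ j))" for t
    unfolding tensor_def by (subst prod.remove[of _ i]) (auto simp: axis_def intro!: prod.cong)
  then have "partial i (tensor \<eta>) x = deriv (\<lambda>t. \<eta> i (x $ i + t) * (\<Prod>j\<in>UNIV-{i}. \<eta> j (x $ j))) 0"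
    by (simp add: partial_def)
  also have "\<dots> = deriv (\<eta> i) (x $ i) * (\<Prod>j\<in>UNIV-{i}. \<eta> j (x $ j))"
  proof (rule DERIV_imp_deriv)
    have "((\<lambda>t. \<eta> i (x $ i + t)) has_real_derivative deriv (\<eta> i) (x $ i)) (at 0)"
      using smooth_DERIV[OF assms, of "x $ i"] DERIV_shift[where f = "\<eta> i" and x = 0 and z = "x $ i"]
      by (simp add: add.commute)
    then show "((\<lambda>t. \<eta> i (x $ i + t) * (\<Prod>j\<in>UNIV-{i}. \<eta> j (x $ j))) has_real_derivative
        deriv (\<eta> i) (x $ i) * (\<Prod>j\<in>UNIV-{i}. \<eta> j (x $ j))) (at 0)"
      by (rule DERIV_cmult_right)
  qed
  also have "\<dots> = tensor (\<eta>(i := deriv (\<eta> i))) x"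
    unfolding tensor_def by (subst (2) prod.remove[of _ i]) (auto intro!: prod.cong)
  finally show "partial i (tensor \<eta>) x = tensor (\<eta>(i := deriv (\<eta> i))) x" .
qed

lemma smooth_funpow_deriv: "smooth f \<Longrightarrow> smooth ((deriv ^^ n) f)"
  by (induction n) (auto intro: smooth_deriv)

lemma partials_tensor:
  assumes "\<And>j. smooth (\<eta> j)"
  shows "partials js (tensor \<eta>) = tensor (\<lambda>j. (deriv ^^ count_list js j) (\<eta> j))"
proof (induction js)
  case Nil
  then show ?case by (simp add: partials_def)
next
  case (Cons i js)
  have "partials (i # js) (tensor \<eta>) = partial i (partials js (tensor \<eta>))"
    by (simp add: partials_def)
  also have "\<dots> = partial i (tensor (\<lambda>j. (deriv ^^ count_list js j) (\<eta> j)))"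
    by (simp add: Cons)
  also have "\<dots> = tensor ((\<lambda>j. (deriv ^^ count_list js j) (\<eta> j)) (i := deriv ((deriv ^^ count_list js i) (\<eta> i))))"
    by (rule partial_tensor) (intro smooth_funpow_deriv assms)
  also have "(\<lambda>j. (deriv ^^ count_list js j) (\<eta> j)) (i := deriv ((deriv ^^ count_list js i) (\<eta> i)))
     = (\<lambda>j. (deriv ^^ count_list (i # js) j) (\<eta> j))"
    by auto
  finally show ?case .
qed

lemma tensor_differentiable:
  assumes "\<And>j. smooth (\<eta> j)"
  shows "tensor \<eta> differentiable_on S"
proof -
  have "(\<lambda>x. \<Prod>j\<in>J. \<eta> j (x $ j)) differentiable (at x within S)" if "finite J" for J and x :: "real ^ 'a"
    using that
  proof (induction J)
    case (insert j J)
    have "(\<lambda>x. \<eta> j (x $ j)) differentiable (at x within S)"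
    proof (rule differentiable_compose[of "\<eta> j"])
      show "\<eta> j differentiable at (x $ j)"
        using smooth_DERIV[OF assms] real_differentiable_def by blast
      show "(\<lambda>x. x $ j) differentiable at x within S"
        by (intro bounded_linear_imp_differentiable bounded_linear_vec_nth)
    qed
    with insert show ?case by (simp add: differentiable_mult)
  qed auto
  then show ?thesis unfolding differentiable_on_def tensor_def[abs_def] by simp
qed

lemma test_function_tensor:
  assumes "\<And>j. bump (\<eta> j)"
  shows "test_function (tensor \<eta>)"
  unfolding test_function_def
proof (intro conjI allI)
  have s: "smooth (\<eta> j)" for j using assms by (simp add: bump_def)
  fix js
  show "partials js (tensor \<eta>) differentiable_on UNIV"
    by (simp add: partials_tensor[OF s] tensor_differentiable smooth_funpow_deriv s)
next
  have "\<forall>j. \<exists>b. \<forall>x. b < \<bar>x\<bar> \<longrightarrow> \<eta> j x = 0" using assms unfolding bump_def by blast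
  then obtain b where b: "\<And>j x. b j < \<bar>x\<bar> \<Longrightarrow> \<eta> j x = 0" by metis
  have "{x. tensor \<eta> x \<noteq> 0} \<subseteq> cbox (\<chi> j. - b j) (\<chi> j. b j)"
  proof
    fix x :: "real ^ 'a" assume "x \<in> {x. tensor \<eta> x \<noteq> 0}"
    then have "\<eta> j (x $ j) \<noteq> 0" for j by (simp add: tensor_def)
    then have "\<bar>x $ j\<bar> \<le> b j" for j using b[of j "x $ j"] by force
    then have "- b j \<le> x $ j \<and> x $ j \<le> b j" for j by (simp add: abs_le_iff minus_le_iff)
    then show "x \<in> cbox (\<chi> j. - b j) (\<chi> j. b j)" by (simp add: mem_box_cart)
  qed
  then show "compact (closure {x. tensor \<eta> x \<noteq> 0})"
    using bounded_subset[OF bounded_cbox] by (simp add: compact_closure)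
qed

lemma count_list_distinct:
  "distinct js \<Longrightarrow> count_list js j = (if j \<in> set js then 1 else 0)"
  by (induction js) auto

text \<open>Tensor products are the only test functions used later: each derivative acts on a single
  factor, so integrations by parts reduce to one variable. Any enumeration of u serves, since every
  index occurs once.\<close>

lemma is_weak_deriv_tensor:
  assumes "is_weak_deriv u f g" "\<And>j. bump (\<eta> j)"
  shows "(\<integral>x. f x * tensor (\<lambda>j. if j \<in> u then deriv (\<eta> j) else \<eta> j) x \<partial>lborel) =
         (-1) ^ card u * (\<integral>x. g x * tensor \<eta> x \<partial>lborel)"
proof -
  obtain js where js: "distinct js" "set js = u"
    using finite_distinct_list[of u] by auto
  have "partials js (tensor \<eta>) = tensor (\<lambda>j. (deriv ^^ count_list js j) (\<eta> j))"
    using assms(2) by (intro partials_tensor) (auto simp: bump_def)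
  also have "(\<lambda>j. (deriv ^^ count_list js j) (\<eta> j)) = (\<lambda>j. if j \<in> u then deriv (\<eta> j) else \<eta> j)"
  proof
    fix j show "(deriv ^^ count_list js j) (\<eta> j) = (if j \<in> u then deriv (\<eta> j) else \<eta> j)"
    proof (cases "j \<in> u")
      case True
      then have "count_list js j = 1" using js count_list_distinct[of js j] by simp
      with True show ?thesis by simp
    next
      case False
      then show ?thesis using js by (simp add: count_notin)
    qed
  qed
  finally have "partials js (tensor \<eta>) = tensor (\<lambda>j. if j \<in> u then deriv (\<eta> j) else \<eta> j)" .
  then show ?thesis
    using assms(1)[unfolded is_weak_deriv_def, THEN conjunct2, rule_format, of "tensor \<eta>" js]
      test_function_tensor[of \<eta>, OF assms(2)] js by simp
qed

section \<open>Lebesgue measure on coordinate spaces\<close>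

abbreviation lebesgue_prod :: "'n set \<Rightarrow> ('n \<Rightarrow> real) measure" where
  "lebesgue_prod u \<equiv> Pi\<^sub>M u (\<lambda>_. lborel)"

interpretation lebesgue_prod: product_sigma_finite "\<lambda>_::'n. lborel :: real measure"
  by standard

lemma pair_sigma_finite_lebesgue_prod:
  "finite u \<Longrightarrow> finite v \<Longrightarrow> pair_sigma_finite (lebesgue_prod u) (lebesgue_prod v)"
  by (intro pair_sigma_finite.intro lebesgue_prod.sigma_finite)

lemma measurable_vec_lambda [measurable]:
  "vec_lambda \<in> borel_measurable (lebesgue_prod (UNIV :: 'n::finite set))"
  by (subst borel_measurable_euclidean_space) (auto simp: Basis_vec_def inner_axis)

text \<open>Both measures agree on boxes. The transfer is made because groups of coordinates can be
  split off in \<open>lebesgue_prod\<close>, where Fubini's theorem and products of one-dimensional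
  integrals are available.\<close>

lemma lborel_eq_distr_vec_lambda:
  "(lborel :: (real ^ 'n::finite) measure) = distr (lebesgue_prod UNIV) borel vec_lambda"
proof (rule lborel_eqI)
  fix l u :: "real ^ 'n"
  assume "\<And>b. b \<in> Basis \<Longrightarrow> l \<bullet> b \<le> u \<bullet> b"
  from this[of "axis _ 1"] have le: "l $ j \<le> u $ j" for j
    by (auto simp: Basis_vec_def inner_axis)
  have "emeasure (distr (lebesgue_prod UNIV) borel vec_lambda) (box l u) =
      emeasure (lebesgue_prod UNIV) (Pi\<^sub>E UNIV (\<lambda>j. {l $ j <..< u $ j}))"
    by (subst emeasure_distr) (auto intro!: arg_cong[where f = "emeasure _"] simp: space_PiM mem_box_cart PiE_iff extensional_def)
  also have "\<dots> = (\<Prod>j\<in>UNIV. ennreal (u $ j - l $ j))"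
    by (subst lebesgue_prod.emeasure_PiM) (auto simp: le)
  also have "\<dots> = ennreal (\<Prod>j\<in>UNIV. u $ j - l $ j)"
    by (rule prod_ennreal) (simp add: le)
  also have "(\<Prod>j\<in>UNIV. u $ j - l $ j) = (\<Prod>b\<in>Basis. (u - l) \<bullet> b)"
  proof -
    have B: "(Basis :: (real ^ 'n) set) = (\<lambda>j. axis j 1) ` UNIV" by (auto simp: Basis_vec_def)
    have I: "inj (\<lambda>j. axis j 1 :: real ^ 'n)" by (auto simp: inj_on_def axis_eq_axis)
    show ?thesis unfolding B by (subst prod.reindex[OF I]) (simp add: inner_axis)
  qed
  finally show "emeasure (distr (lebesgue_prod UNIV) borel vec_lambda) (box l u) =
      ennreal (\<Prod>b\<in>Basis. (u - l) \<bullet> b)" .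
qed simp

lemma glue_merge: "glue u y z = vec_lambda (merge u (- u) (y, z))"
  by (auto simp: glue_def merge_def vec_eq_iff)

lemma measurable_merge_Compl:
  "merge u (- u) \<in> lebesgue_prod u \<Otimes>\<^sub>M lebesgue_prod (- u) \<rightarrow>\<^sub>M lebesgue_prod UNIV"
  using measurable_merge[of u "- u" "\<lambda>_. lborel"] by (simp add: Compl_partition)

lemma measurable_glue [measurable]:
  "(\<lambda>x. glue u (fst x) (snd x)) \<in> borel_measurable (lebesgue_prod u \<Otimes>\<^sub>M lebesgue_prod (- u :: 'n::finite set))"
  unfolding glue_merge prod.collapse
  by (rule measurable_compose[OF measurable_merge_Compl measurable_vec_lambda])

lemma lborel_eq_distr_glue:
  "(lborel :: (real ^ 'n::finite) measure) =
     distr (lebesgue_prod u \<Otimes>\<^sub>M lebesgue_prod (- u)) borel (\<lambda>x. glue u (fst x) (snd x))"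
proof -
  have "distr (lebesgue_prod u \<Otimes>\<^sub>M lebesgue_prod (- u)) (lebesgue_prod (u \<union> - u)) (merge u (- u)) =
      lebesgue_prod (u \<union> - u)"
    by (rule lebesgue_prod.distr_merge) auto
  then have "(lborel :: (real ^ 'n) measure) = distr (distr (lebesgue_prod u \<Otimes>\<^sub>M lebesgue_prod (- u))
      (lebesgue_prod (u \<union> - u)) (merge u (- u))) borel vec_lambda"
    using lborel_eq_distr_vec_lambda[where 'n = 'n] by simp
  also have "\<dots> = distr (lebesgue_prod u \<Otimes>\<^sub>M lebesgue_prod (- u)) borel (vec_lambda \<circ> merge u (- u))"
    by (simp add: Compl_partition distr_distr measurable_vec_lambda measurable_merge_Compl)
  finally show ?thesis by (simp add: comp_def glue_merge)
qed

lemma AE_glue: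
  assumes "AE x in (lborel :: (real ^ 'n::finite) measure). P x"
  shows "AE y in lebesgue_prod u. AE z in lebesgue_prod (- u). P (glue u y z)"
proof -
  interpret pair_sigma_finite "lebesgue_prod u" "lebesgue_prod (- u)"
    by (rule pair_sigma_finite_lebesgue_prod) auto
  from assms have "AE x in lebesgue_prod u \<Otimes>\<^sub>M lebesgue_prod (- u). P (glue u (fst x) (snd x))"
    by (subst (asm) lborel_eq_distr_glue[of u]) (rule AE_distrD[OF measurable_glue])
  from AE_pair[OF this] show ?thesis by simp
qed

lemma integrable_glue_iff:
  fixes f :: "real ^ 'n::finite \<Rightarrow> real"
  assumes "f \<in> borel_measurable borel"
  shows "integrable lborel f \<longleftrightarrow>
    integrable (lebesgue_prod u \<Otimes>\<^sub>M lebesgue_prod (- u)) (\<lambda>x. f (glue u (fst x) (snd x)))"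
  by (subst lborel_eq_distr_glue[of u]) (intro integrable_distr_eq measurable_glue assms)

lemma integral_glue:
  fixes f :: "real ^ 'n::finite \<Rightarrow> real"
  assumes "integrable lborel f"
  shows "(\<integral>x. f x \<partial>lborel) = (\<integral>y. (\<integral>z. f (glue u y z) \<partial>lebesgue_prod (- u)) \<partial>lebesgue_prod u)"
proof -
  interpret pair_sigma_finite "lebesgue_prod u" "lebesgue_prod (- u)"
    by (rule pair_sigma_finite_lebesgue_prod) auto
  have [measurable]: "f \<in> borel_measurable borel" using assms by (auto dest: borel_measurable_integrable)
  have "(\<integral>x. f x \<partial>lborel) = (\<integral>x. f (glue u (fst x) (snd x)) \<partial>(lebesgue_prod u \<Otimes>\<^sub>M lebesgue_prod (- u)))"
    by (subst lborel_eq_distr_glue[of u]) (intro integral_distr measurable_glue, simp)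
  also have "\<dots> = (\<integral>y. (\<integral>z. f (glue u y z) \<partial>lebesgue_prod (- u)) \<partial>lebesgue_prod u)"
    using integral_fst'[of "\<lambda>x. f (glue u (fst x) (snd x))"] integrable_glue_iff[of f u] assms by simp
  finally show ?thesis .
qed

subsection \<open>Local integrability\<close>

text \<open>The common home of bumps and of interval indicators, so that one estimate covers both
  the test functions and the cubes by which local integrability is checked.\<close>

definition cutoff :: "(real \<Rightarrow> real) \<Rightarrow> bool" where
  "cutoff e \<longleftrightarrow> e \<in> borel_measurable borel \<and> (\<exists>B\<ge>0. \<forall>x. \<bar>e x\<bar> \<le> B * indicator {-B..B} x)"

lemma cutoffD: "cutoff e \<Longrightarrow> e \<in> borel_measurable borel"
  by (simp add: cutoff_def)

lemma cutoff_bump: "bump e \<Longrightarrow> cutoff e"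
  unfolding cutoff_def by (metis bump_borel bump_bounded)

lemma cutoff_indicator: "cutoff (indicator {a..b})"
proof -
  have "indicator {a..b} x \<le> max 1 (max \<bar>a\<bar> \<bar>b\<bar>) * indicat_real {- max 1 (max \<bar>a\<bar> \<bar>b\<bar>)..max 1 (max \<bar>a\<bar> \<bar>b\<bar>)} x" for x
    by (auto simp: indicator_def)
  then show ?thesis unfolding cutoff_def by (intro conjI exI[of _ "max 1 (max \<bar>a\<bar> \<bar>b\<bar>)"]) auto
qed

lemma cutoff_integrable:
  assumes "cutoff e" shows "integrable lborel e"
proof -
  obtain B where "B \<ge> 0" and B: "\<And>x. \<bar>e x\<bar> \<le> B * indicator {-B..B} x"
    using assms unfolding cutoff_def by blast
  have "integrable lborel (\<lambda>x. B * indicator {-B..B} x)"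
    by (intro integrable_mult_right integrable_real_indicator) (auto simp: emeasure_lborel_Icc_eq)
  then show ?thesis
  proof (rule Bochner_Integration.integrable_bound)
    show "e \<in> borel_measurable lborel" using cutoffD[OF assms] by simp
    show "AE x in lborel. norm (e x) \<le> norm (B * indicator {-B..B} x)"
      using order.trans[OF B abs_ge_self] by simp
  qed
qed

abbreviation cube :: "real \<Rightarrow> real ^ 'n::finite \<Rightarrow> real" where
  "cube b \<equiv> tensor (\<lambda>_. indicator {-b..b})"

lemma cube_eq: "cube b x = indicator (cbox (- (\<chi> j. b)) (\<chi> j. b)) x"
  by (auto simp: tensor_def indicator_def mem_box_cart intro!: prod.neutral)

lemma measurable_tensor:
  assumes "\<And>j. e j \<in> borel_measurable borel"
  shows "tensor e \<in> borel_measurable borel"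
  unfolding tensor_def[abs_def] using assms by measurable

lemma tensor_le_cube:
  fixes e :: "'n::finite \<Rightarrow> real \<Rightarrow> real"
  assumes "\<And>j. cutoff (e j)"
  obtains B :: nat where "\<And>x. \<bar>tensor e x\<bar> \<le> B * cube B x"
proof -
  have "\<forall>j. \<exists>B\<ge>0. \<forall>x. \<bar>e j x\<bar> \<le> B * indicator {-B..B} x" using assms by (auto simp: cutoff_def)
  then obtain b where b: "\<And>j. b j \<ge> 0" "\<And>j x. \<bar>e j x\<bar> \<le> b j * indicator {- b j..b j} x" by metis
  define B :: nat where "B = nat \<lceil>max (\<Prod>j\<in>UNIV. b j) (\<Sum>j\<in>UNIV. b j)\<rceil>"
  have bB: "b j \<le> B" for j
    using member_le_sum[of j UNIV b] b(1) unfolding B_def by simp linarith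
  have pB: "(\<Prod>j\<in>UNIV. b j) \<le> B"
    by (simp add: B_def) linarith
  have "\<bar>tensor e x\<bar> \<le> B * cube B x" for x :: "real ^ 'n"
  proof -
    have "\<bar>tensor e x\<bar> \<le> (\<Prod>j\<in>UNIV. b j * indicator {- b j..b j} (x $ j))"
      unfolding tensor_def abs_prod by (intro prod_mono) (simp add: b)
    also have "\<dots> \<le> (\<Prod>j\<in>UNIV. b j * indicator {- real B..B} (x $ j))"
    proof (intro prod_mono conjI mult_left_mono b)
      fix j show "indicator {- b j..b j} (x $ j) \<le> indicat_real {- real B..B} (x $ j)"
        using bB[of j] by (auto simp: indicator_def)
    qed (simp add: b)
    also have "\<dots> = (\<Prod>j\<in>UNIV. b j) * cube B x" by (simp add: tensor_def prod.distrib)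
    also have "\<dots> \<le> B * cube B x" using pB by (intro mult_right_mono) (auto simp: cube_eq)
    finally show ?thesis .
  qed
  then show ?thesis using that by blast
qed

lemma cube_eq_1:
  assumes "norm x \<le> b"
  shows "cube b x = 1"
proof -
  have "- b \<le> x $ j \<and> x $ j \<le> b" for j
    using component_le_norm_cart[of x j] assms by (auto simp: abs_le_iff)
  then show ?thesis by (auto simp: tensor_def)
qed

text \<open>Cubes with integer half-side exhaust the space, and every compact set lies in one of
  them. Measurability of f follows because f is the pointwise limit of its restrictions to the
  cubes.\<close>

lemma locally_integrable_iff:
  fixes f :: "real ^ 'n::finite \<Rightarrow> real"
  shows "locally_integrable f \<longleftrightarrow>
    f \<in> borel_measurable borel \<and> (\<forall>b::nat. integrable lborel (\<lambda>x. f x * cube b x))"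
proof (intro iffI conjI allI)
  assume f: "locally_integrable f"
  then show int: "integrable lborel (\<lambda>x. f x * cube b x)" for b :: nat
    unfolding locally_integrable_def cube_eq set_integrable_def
    by (simp add: mult.commute compact_cbox)
  have "f \<in> borel_measurable lborel"
  proof (rule borel_measurable_LIMSEQ_real)
    show "(\<lambda>x. f x * cube (real n) x) \<in> borel_measurable lborel" for n
      using int by (rule borel_measurable_integrable)
    fix x :: "real ^ 'n"
    have "eventually (\<lambda>n. f x * cube (real n) x = f x) sequentially"
    proof (rule eventually_sequentiallyI)
      fix n assume n: "nat \<lceil>norm x\<rceil> \<le> n"
      then have "norm x \<le> n" by linarith
      then show "f x * cube (real n) x = f x" by (simp add: cube_eq_1)
    qed
    then show "(\<lambda>n. f x * cube (real n) x) \<longlonglongrightarrow> f x" by (rule tendsto_eventually)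
  qed
  then show "f \<in> borel_measurable borel" by simp
next
  assume f: "f \<in> borel_measurable borel \<and> (\<forall>b::nat. integrable lborel (\<lambda>x. f x * cube b x))"
  show "locally_integrable f"
    unfolding locally_integrable_def set_integrable_def
  proof (intro allI impI)
    fix K :: "(real ^ 'n) set" assume K: "compact K"
    then obtain a where a: "\<And>x. x \<in> K \<Longrightarrow> norm x \<le> a"
      using compact_imp_bounded bounded_iff by metis
    define b where "b = nat \<lceil>a\<rceil>"
    have le: "indicator K x \<le> cube b x" for x :: "real ^ 'n"
    proof (cases "x \<in> K")
      case True
      then have "norm x \<le> b"
        using a[OF True] unfolding b_def by linarith
      then show ?thesis by (simp add: cube_eq_1)
    qed (simp add: cube_eq)
    show "integrable lborel (\<lambda>x. indicator K x *\<^sub>R f x)"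
    proof (rule Bochner_Integration.integrable_bound[of _ "\<lambda>x. f x * cube b x"])
      show "(\<lambda>x. indicator K x *\<^sub>R f x) \<in> borel_measurable lborel"
        using f K by (auto intro!: borel_measurable_indicator borel_compact borel_measurable_times)
      show "AE x in lborel. norm (indicator K x *\<^sub>R f x) \<le> norm (f x * cube b x)"
        using le by (auto simp: abs_mult mult.commute cube_eq intro!: mult_left_mono)
    qed (use f in blast)
  qed
qed

lemma locally_integrable_tensor:
  fixes f :: "real ^ 'n::finite \<Rightarrow> real"
  assumes "locally_integrable f" "\<And>j. cutoff (e j)"
  shows "integrable lborel (\<lambda>x. f x * tensor e x)"
proof -
  obtain B :: nat where B: "\<And>x :: real ^ 'n. \<bar>tensor e x\<bar> \<le> B * cube B x"
    using tensor_le_cube[of e] assms(2) by blast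
  have f: "f \<in> borel_measurable borel" "integrable lborel (\<lambda>x. f x * cube (real B) x)"
    using assms(1) by (auto simp: locally_integrable_iff)
  show ?thesis
  proof (rule Bochner_Integration.integrable_bound[of _ "\<lambda>x. B * (f x * cube B x)"])
    show "integrable lborel (\<lambda>x. B * (f x * cube B x))" using f by simp
    show "(\<lambda>x. f x * tensor e x) \<in> borel_measurable lborel"
      using f(1) measurable_tensor[of e, OF cutoffD[OF assms(2)]] by simp
    show "AE x in lborel. norm (f x * tensor e x) \<le> norm (B * (f x * cube B x))"
      using mult_left_mono[OF B, of "\<bar>f _\<bar>"] by (auto simp: abs_mult cube_eq mult.left_commute mult.assoc)
  qed
qed

lemma locally_integrable_diff:
  assumes "locally_integrable f" "locally_integrable g"
  shows "locally_integrable (\<lambda>x. f x - g x)"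
  using assms by (auto simp: locally_integrable_iff left_diff_distrib)

lemma locally_integrable_sum:
  assumes "\<And>i. i \<in> I \<Longrightarrow> locally_integrable (f i)"
  shows "locally_integrable (\<lambda>x. \<Sum>i\<in>I. f i x)"
  using assms by (auto simp: locally_integrable_iff sum_distrib_right intro!: borel_measurable_sum)

subsection \<open>The lemma of du Bois-Reymond\<close>

text \<open>Dominated convergence along box bumps: the absolute value of h on the closed box is a
  majorant, integrable by local integrability.\<close>

lemma integral_box_eq_0:
  fixes h :: "real ^ 'n::finite \<Rightarrow> real"
  assumes h: "locally_integrable h"
    and zero: "\<And>\<eta>. (\<And>j. bump (\<eta> j)) \<Longrightarrow> (\<integral>x. h x * tensor \<eta> x \<partial>lborel) = 0"
  shows "integrable lborel (\<lambda>x. h x * indicator (box a b) x)"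
    and "(\<integral>x. h x * indicator (box a b) x \<partial>lborel) = 0"
proof -
  have [measurable]: "h \<in> borel_measurable borel" using h by (simp add: locally_integrable_iff)
  define \<eta> where "\<eta> n j = box_bump (a $ j) (b $ j) n" for n j
  define w where "w x = \<bar>h x\<bar> * tensor (\<lambda>j. indicator {a $ j..b $ j}) x" for x
  have bump: "bump (\<eta> n j)" for n j by (simp add: \<eta>_def bump_box_bump)
  have w: "integrable lborel w"
    using integrable_abs[OF locally_integrable_tensor[OF h, of "\<lambda>j. indicator {a $ j..b $ j}"]]
    by (auto simp: w_def[abs_def] abs_mult tensor_def abs_prod cutoff_indicator)
  have meas: "(\<lambda>x. h x * tensor (\<eta> n) x) \<in> borel_measurable borel" for n
    using measurable_tensor[of "\<eta> n"] bump bump_borel by auto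
  have lim: "(\<lambda>n. h x * tensor (\<eta> n) x) \<longlonglongrightarrow> h x * indicator (box a b) x" for x
  proof -
    have "(\<lambda>n. tensor (\<eta> n) x) \<longlonglongrightarrow> (\<Prod>j\<in>UNIV. indicator {a $ j<..<b $ j} (x $ j))"
      unfolding tensor_def \<eta>_def by (intro tendsto_prod box_bump_tendsto)
    also have "(\<Prod>j\<in>UNIV. indicator {a $ j<..<b $ j} (x $ j)) = indicat_real (box a b) x"
      by (auto simp: indicator_def mem_box_cart intro!: prod.neutral)
    finally show ?thesis by (intro tendsto_intros)
  qed
  have bound: "norm (h x * tensor (\<eta> n) x) \<le> w x" for n x
    unfolding w_def \<eta>_def tensor_def using box_bump_bounds
    by (auto simp: abs_mult abs_prod intro!: mult_left_mono prod_mono)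
  note dom = lim bound w meas
  show "integrable lborel (\<lambda>x. h x * indicator (box a b) x)"
    by (rule integrable_dominated_convergence[of _ _ "\<lambda>n x. h x * tensor (\<eta> n) x" w]) (use dom in \<open>auto simp del: real_norm_def\<close>)
  have "(\<lambda>n. \<integral>x. h x * tensor (\<eta> n) x \<partial>lborel) \<longlonglongrightarrow> (\<integral>x. h x * indicator (box a b) x \<partial>lborel)"
    by (rule integral_dominated_convergence[of _ _ _ w]) (use dom in \<open>auto simp del: real_norm_def\<close>)
  moreover have "(\<integral>x. h x * tensor (\<eta> n) x \<partial>lborel) = 0" for n
    using bump by (rule zero)
  ultimately show "(\<integral>x. h x * indicator (box a b) x \<partial>lborel) = 0"
    by (simp add: LIMSEQ_const_iff)
qed

text \<open>The positive and the negative part of h define measures that agree and are finite on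
  open boxes. These form an intersection-stable generator, so the measures coincide, and then so do
  their densities.\<close>

lemma weakly_zero_imp_AE_zero:
  fixes h :: "real ^ 'n::finite \<Rightarrow> real"
  assumes h: "locally_integrable h"
    and zero: "\<And>\<eta>. (\<And>j. bump (\<eta> j)) \<Longrightarrow> (\<integral>x. h x * tensor \<eta> x \<partial>lborel) = 0"
  shows "AE x in lborel. h x = 0"
proof -
  have [measurable]: "h \<in> borel_measurable borel" using h by (simp add: locally_integrable_iff)
  note int = integral_box_eq_0[OF h zero]
  \<comment> \<open>\<open>ennreal\<close> truncates at 0, so \<open>M 1\<close> and
    \<open>M (-1)\<close> have the positive and the negative part of h as densities.\<close>
  define M where "M s = density lborel (\<lambda>x. ennreal (s * h x))" for s :: real
  have M_box: "emeasure (M s) (box a b) = ennreal (\<integral>x. max 0 (s * h x) * indicator (box a b) x \<partial>lborel)" for s a b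
  proof -
    have "emeasure (M s) (box a b) = (\<integral>\<^sup>+x. ennreal (max 0 (s * h x) * indicator (box a b) x) \<partial>lborel)"
      unfolding M_def by (subst emeasure_density) (auto intro!: nn_integral_cong simp: indicator_def max_def ennreal_neg)
    also have "\<dots> = ennreal (\<integral>x. max 0 (s * h x) * indicator (box a b) x \<partial>lborel)"
    proof (rule nn_integral_eq_integral)
      have "integrable lborel (\<lambda>x. max 0 (s * (h x * indicator (box a b) x)))"
        using int(1) by (intro integrable_max) auto
      then show "integrable lborel (\<lambda>x. max 0 (s * h x) * indicator (box a b) x)"
        by (rule Bochner_Integration.integrable_cong[THEN iffD1, rotated -1]) (auto simp: indicator_def)
    qed auto
    finally show ?thesis .
  qed
  have M_eq_box: "emeasure (M 1) (box a b) = emeasure (M (-1)) (box a b)" for a b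
  proof -
    have i: "integrable lborel (\<lambda>x. max 0 (s * h x) * indicator (box a b) x)" for s
    proof -
      have "integrable lborel (\<lambda>x. max 0 (s * (h x * indicator (box a b) x)))"
        using int(1) by (intro integrable_max) auto
      then show ?thesis
        by (rule Bochner_Integration.integrable_cong[THEN iffD1, rotated -1]) (auto simp: indicator_def)
    qed
    have "(\<integral>x. max 0 (1 * h x) * indicator (box a b) x \<partial>lborel) - (\<integral>x. max 0 (-1 * h x) * indicator (box a b) x \<partial>lborel)
      = (\<integral>x. max 0 (1 * h x) * indicator (box a b) x - max 0 (-1 * h x) * indicator (box a b) x \<partial>lborel)"
      by (rule Bochner_Integration.integral_diff[symmetric]) (rule i)+
    also have "\<dots> = (\<integral>x. h x * indicator (box a b) x \<partial>lborel)"
      by (rule Bochner_Integration.integral_cong) (auto simp: indicator_def max_def)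
    finally show ?thesis using int(2)[of a b] by (simp add: M_box)
  qed
  have "M 1 = M (-1)"
  proof (rule measure_eqI_generator_eq)
    let ?E = "range (\<lambda>(a, b). box a b :: (real ^ 'n) set)"
    show "Int_stable ?E" by (auto simp: Int_stable_def box_Int_box)
    show "?E \<subseteq> Pow UNIV" "sets (M 1) = sigma_sets UNIV ?E" "sets (M (-1)) = sigma_sets UNIV ?E"
      by (simp_all add: borel_eq_box M_def)
    let ?A = "\<lambda>n::nat. box (- (real n *\<^sub>R One)) (real n *\<^sub>R One) :: (real ^ 'n) set"
    show "range ?A \<subseteq> ?E" "(\<Union>i. ?A i) = UNIV" unfolding UN_box_eq_UNIV by auto
    show "emeasure (M 1) (?A i) \<noteq> \<infinity>" for i by (simp add: M_box)
    show "emeasure (M 1) X = emeasure (M (-1)) X" if "X \<in> ?E" for X using that M_eq_box by auto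
  qed
  then have "AE x in lborel. ennreal (1 * h x) = ennreal (-1 * h x)"
    unfolding M_def by (intro sigma_finite_measure.density_unique[OF sigma_finite_lborel]) auto
  then show ?thesis
  proof eventually_elim
    case (elim x)
    then show ?case
      by (cases "h x \<ge> 0") (auto simp: ennreal_neg ennreal_eq_0_iff)
  qed
qed

lemma tensor_glue:
  "tensor e (glue u y z) = (\<Prod>j\<in>u. e j (y j)) * (\<Prod>j\<in>-u. e j (z j))"
proof -
  have "tensor e (glue u y z) = (\<Prod>j\<in>u \<union> -u. e j (glue u y z $ j))"
    by (simp add: tensor_def Compl_partition)
  also have "\<dots> = (\<Prod>j\<in>u. e j (glue u y z $ j)) * (\<Prod>j\<in>-u. e j (glue u y z $ j))"
    by (rule prod.union_disjoint) auto
  also have "\<dots> = (\<Prod>j\<in>u. e j (y j)) * (\<Prod>j\<in>-u. e j (z j))"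
    by (intro arg_cong2[where f = "(*)"] prod.cong) (auto simp: glue_def)
  finally show ?thesis .
qed

text \<open>Subtracting from a factor \<eta>_i its mean times \<rho> leaves a mean-zero bump, which
  h does not see. Hence \<eta>_i may be replaced by its mean times \<rho>, one coordinate after the
  other.\<close>

lemma integral_tensor_replace:
  fixes h :: "real ^ 'n::finite \<Rightarrow> real"
  assumes h: "locally_integrable h"
    and zero: "\<And>\<eta> j. (\<And>j. bump (\<eta> j)) \<Longrightarrow> j \<notin> u \<Longrightarrow> (\<integral>x. \<eta> j x \<partial>lborel) = 0 \<Longrightarrow>
                 (\<integral>x. h x * tensor \<eta> x \<partial>lborel) = 0"
    and \<eta>: "\<And>j. bump (\<eta> j)" and \<rho>: "bump \<rho>" "(\<integral>x. \<rho> x \<partial>lborel) = 1"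
    and v: "v \<subseteq> - u"
  shows "(\<integral>x. h x * tensor \<eta> x \<partial>lborel) =
    (\<Prod>j\<in>v. \<integral>x. \<eta> j x \<partial>lborel) * (\<integral>x. h x * tensor (\<lambda>j. if j \<in> v then \<rho> else \<eta> j) x \<partial>lborel)"
  using finite[of v] v
proof (induction v rule: finite_induct)
  case empty
  then show ?case by simp
next
  case (insert i v)
  define c where "c = (\<integral>x. \<eta> i x \<partial>lborel)"
  define \<zeta> where "\<zeta> j = (if j \<in> v then \<rho> else \<eta> j)" for j
  define \<zeta>' where "\<zeta>' j = (if j \<in> insert i v then \<rho> else \<eta> j)" for j
  have \<zeta>: "bump (\<zeta> j)" "bump (\<zeta>' j)" for j by (auto simp: \<zeta>_def \<zeta>'_def \<eta> \<rho>)
  define \<delta> where "\<delta> = \<zeta>(i := (\<lambda>x. \<eta> i x + (- c) * \<rho> x))"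
  have "bump (\<lambda>x. \<eta> i x + (- c) * \<rho> x)" by (intro bump_add bump_mult_const \<eta> \<rho>)
  then have \<delta>: "bump (\<delta> j)" for j using \<zeta> by (simp only: \<delta>_def fun_upd_apply split: if_split) blast
  have "(\<integral>x. \<delta> i x \<partial>lborel) = 0"
    using bump_integrable[OF \<eta>] bump_integrable[OF \<rho>(1)] \<rho>(2)
    by (simp add: \<delta>_def c_def)
  then have "(\<integral>x. h x * tensor \<delta> x \<partial>lborel) = 0"
    using zero[of \<delta> i] \<delta> insert.prems by auto
  moreover have "tensor \<delta> x = tensor \<zeta> x - c * tensor \<zeta>' x" for x
  proof -
    have "tensor \<delta> x = (\<eta> i (x $ i) - c * \<rho> (x $ i)) * (\<Prod>j\<in>UNIV-{i}. \<zeta> j (x $ j))"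
      unfolding tensor_def by (subst prod.remove[of _ i]) (auto simp: \<delta>_def intro!: prod.cong)
    moreover have "tensor \<zeta> x = \<eta> i (x $ i) * (\<Prod>j\<in>UNIV-{i}. \<zeta> j (x $ j))"
      unfolding tensor_def using insert.hyps
      by (subst prod.remove[of _ i]) (auto simp: \<zeta>_def intro!: prod.cong)
    moreover have "tensor \<zeta>' x = \<rho> (x $ i) * (\<Prod>j\<in>UNIV-{i}. \<zeta> j (x $ j))"
      unfolding tensor_def
      by (subst prod.remove[of _ i]) (auto simp: \<zeta>_def \<zeta>'_def intro!: prod.cong)
    ultimately show ?thesis by (simp add: algebra_simps)
  qed
  moreover have "(\<integral>x. h x * (tensor \<zeta> x - c * tensor \<zeta>' x) \<partial>lborel) =
      (\<integral>x. h x * tensor \<zeta> x \<partial>lborel) - c * (\<integral>x. h x * tensor \<zeta>' x \<partial>lborel)"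
    using locally_integrable_tensor[OF h cutoff_bump[OF \<zeta>(1)]]
      locally_integrable_tensor[OF h cutoff_bump[OF \<zeta>(2)]]
    by (simp add: right_diff_distrib mult.left_commute)
  ultimately have "(\<integral>x. h x * tensor \<zeta> x \<partial>lborel) = c * (\<integral>x. h x * tensor \<zeta>' x \<partial>lborel)" by simp
  with insert show ?case by (simp add: c_def \<zeta>_def[abs_def] \<zeta>'_def[abs_def] mult_ac)
qed

text \<open>The hypothesis says that the weak partial derivatives of h in the directions outside u
  vanish, since a bump of mean zero is the derivative of a bump. Then h equals its own average H
  against a fixed unit bump in those directions, because all tensor products annihilate the
  difference.\<close>

lemma weakly_constant:
  fixes h :: "real ^ 'n::finite \<Rightarrow> real"
  assumes h: "locally_integrable h"
    and zero: "\<And>\<eta> j. (\<And>j. bump (\<eta> j)) \<Longrightarrow> j \<notin> u \<Longrightarrow> (\<integral>x. \<eta> j x \<partial>lborel) = 0 \<Longrightarrow>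
                 (\<integral>x. h x * tensor \<eta> x \<partial>lborel) = 0"
  obtains H where "AE y in lebesgue_prod u. AE z in lebesgue_prod (- u). h (glue u y z) = H y"
proof -
  interpret P: pair_sigma_finite "lebesgue_prod u" "lebesgue_prod (- u)"
    by (rule pair_sigma_finite_lebesgue_prod) auto
  have [measurable]: "h \<in> borel_measurable borel" using h by (simp add: locally_integrable_iff)
  obtain \<rho> where \<rho>: "bump \<rho>" "(\<integral>x. \<rho> x \<partial>lborel) = 1" using ex_unit_bump .
  define H where "H y = (\<integral>z. h (glue u y z) * (\<Prod>j\<in>-u. \<rho> (z j)) \<partial>lebesgue_prod (- u))" for y
  \<comment> \<open>\<open>H\<close> is measurable on the extensional functions on u, hence the
    \<open>restrict\<close> when it is lifted back to the whole space.\<close>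
  define H' where "H' x = H (restrict (($) x) u)" for x
  have H'_glue: "H' (glue u y z) = H y" for y z
    unfolding H'_def H_def by (intro Bochner_Integration.integral_cong refl)
      (auto simp: glue_def cong: if_cong)
  have meas_H: "H \<in> borel_measurable (lebesgue_prod u)"
  proof -
    have "(\<lambda>x. h (glue u (fst x) (snd x)) * (\<Prod>j\<in>-u. \<rho> (snd x j)))
       \<in> borel_measurable (lebesgue_prod u \<Otimes>\<^sub>M lebesgue_prod (- u))"
      using bump_borel[OF \<rho>(1)] by measurable
    then show ?thesis
      unfolding H_def[abs_def] by (intro P.M2.borel_measurable_lebesgue_integral) (simp add: split_beta')
  qed
  have meas_H': "H' \<in> borel_measurable borel"
    unfolding H'_def[abs_def] by (rule measurable_compose[OF _ meas_H]) (auto intro!: measurable_restrict)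
  have H_int: "integrable (lebesgue_prod u) (\<lambda>y. H y * (\<Prod>j\<in>u. e j (y j)))"
    and H_val: "(\<integral>y. H y * (\<Prod>j\<in>u. e j (y j)) \<partial>lebesgue_prod u) =
      (\<integral>x. h x * tensor (\<lambda>j. if j \<in> u then e j else \<rho>) x \<partial>lborel)"
    if e: "\<And>j. cutoff (e j)" for e
  proof -
    let ?e = "\<lambda>j. if j \<in> u then e j else \<rho>"
    have i: "integrable lborel (\<lambda>x. h x * tensor ?e x)"
      by (intro locally_integrable_tensor[OF h]) (auto simp: e cutoff_bump \<rho>)
    have eq: "(\<integral>z. h (glue u y z) * tensor ?e (glue u y z) \<partial>lebesgue_prod (- u)) = H y * (\<Prod>j\<in>u. e j (y j))" for y
    proof -
      have "(\<integral>z. h (glue u y z) * tensor ?e (glue u y z) \<partial>lebesgue_prod (- u)) =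
        (\<integral>z. (h (glue u y z) * (\<Prod>j\<in>-u. \<rho> (z j))) * (\<Prod>j\<in>u. e j (y j)) \<partial>lebesgue_prod (- u))"
        by (intro Bochner_Integration.integral_cong refl) (simp add: tensor_glue mult_ac)
      then show ?thesis by (simp add: H_def)
    qed
    have i': "integrable (lebesgue_prod u \<Otimes>\<^sub>M lebesgue_prod (- u))
        (\<lambda>x. h (glue u (fst x) (snd x)) * tensor ?e (glue u (fst x) (snd x)))"
      using i integrable_glue_iff[of "\<lambda>x. h x * tensor ?e x" u] by (auto dest: borel_measurable_integrable)
    from P.integrable_fst'[OF i'] show "integrable (lebesgue_prod u) (\<lambda>y. H y * (\<Prod>j\<in>u. e j (y j)))"
      by (simp add: eq)
    show "(\<integral>y. H y * (\<Prod>j\<in>u. e j (y j)) \<partial>lebesgue_prod u) = (\<integral>x. h x * tensor ?e x \<partial>lborel)"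
      using integral_glue[OF i, of u] by (simp add: eq)
  qed
  have H'_int: "integrable lborel (\<lambda>x. H' x * tensor e x)"
    and H'_val: "(\<integral>x. H' x * tensor e x \<partial>lborel) =
      (\<Prod>j\<in>-u. \<integral>x. e j x \<partial>lborel) * (\<integral>x. h x * tensor (\<lambda>j. if j \<in> u then e j else \<rho>) x \<partial>lborel)"
    if e: "\<And>j. cutoff (e j)" for e
  proof -
    have me: "tensor e \<in> borel_measurable borel" using e by (intro measurable_tensor cutoffD)
    have ie: "integrable (lebesgue_prod (- u)) (\<lambda>z. \<Prod>j\<in>-u. e j (z j))"
      by (intro lebesgue_prod.product_integrable_prod) (auto intro: cutoff_integrable e)
    have "integrable (lebesgue_prod u \<Otimes>\<^sub>M lebesgue_prod (- u))
        (\<lambda>x. (H (fst x) * (\<Prod>j\<in>u. e j (fst x j))) * (\<Prod>j\<in>-u. e j (snd x j)))"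
    proof (rule P.Fubini_integrable)
      show "(\<lambda>x. (H (fst x) * (\<Prod>j\<in>u. e j (fst x j))) * (\<Prod>j\<in>-u. e j (snd x j)))
         \<in> borel_measurable (lebesgue_prod u \<Otimes>\<^sub>M lebesgue_prod (- u))"
        by (rule borel_measurable_times[OF
              measurable_compose[OF measurable_fst borel_measurable_integrable[OF H_int[OF e]]]
              measurable_compose[OF measurable_snd borel_measurable_integrable[OF ie]]])
      show "integrable (lebesgue_prod u) (\<lambda>x. \<integral>y. norm ((H (fst (x, y)) * (\<Prod>j\<in>u. e j (fst (x, y) j))) *
          (\<Prod>j\<in>-u. e j (snd (x, y) j))) \<partial>lebesgue_prod (- u))"
        using integrable_abs[OF H_int[OF e]] by (simp add: abs_mult)
      show "AE x in lebesgue_prod u. integrable (lebesgue_prod (- u))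
          (\<lambda>y. (H (fst (x, y)) * (\<Prod>j\<in>u. e j (fst (x, y) j))) * (\<Prod>j\<in>-u. e j (snd (x, y) j)))"
        using ie by simp
    qed
    then show i: "integrable lborel (\<lambda>x. H' x * tensor e x)"
      using me meas_H'
      by (subst integrable_glue_iff[of _ u]) (auto simp: tensor_glue H'_glue mult_ac)
    have "(\<integral>x. H' x * tensor e x \<partial>lborel) =
      (\<integral>y. (H y * (\<Prod>j\<in>u. e j (y j))) * (\<integral>z. (\<Prod>j\<in>-u. e j (z j)) \<partial>lebesgue_prod (- u)) \<partial>lebesgue_prod u)"
      by (subst integral_glue[OF i, of u]) (simp add: tensor_glue H'_glue mult.assoc[symmetric])
    also have "(\<integral>z. (\<Prod>j\<in>-u. e j (z j)) \<partial>lebesgue_prod (- u)) = (\<Prod>j\<in>-u. \<integral>x. e j x \<partial>lborel)"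
      by (intro lebesgue_prod.product_integral_prod) (auto intro: cutoff_integrable e)
    finally show "(\<integral>x. H' x * tensor e x \<partial>lborel) =
      (\<Prod>j\<in>-u. \<integral>x. e j x \<partial>lborel) * (\<integral>x. h x * tensor (\<lambda>j. if j \<in> u then e j else \<rho>) x \<partial>lborel)"
      by (simp add: H_val[OF e])
  qed
  have "AE x in lborel. h x - H' x = 0"
  proof (rule weakly_zero_imp_AE_zero)
    have "locally_integrable H'"
      unfolding locally_integrable_iff using meas_H' H'_int cutoff_indicator by auto
    then show li: "locally_integrable (\<lambda>x. h x - H' x)" by (intro locally_integrable_diff h)
    fix \<eta> :: "'n \<Rightarrow> real \<Rightarrow> real" assume \<eta>: "\<And>j. bump (\<eta> j)"
    have "(\<integral>x. h x * tensor \<eta> x \<partial>lborel) = (\<Prod>j\<in>-u. \<integral>x. \<eta> j x \<partial>lborel) *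
        (\<integral>x. h x * tensor (\<lambda>j. if j \<in> -u then \<rho> else \<eta> j) x \<partial>lborel)"
      by (rule integral_tensor_replace[OF h zero]) (auto simp: \<eta> \<rho>)
    also have "(\<lambda>j. if j \<in> -u then \<rho> else \<eta> j) = (\<lambda>j. if j \<in> u then \<eta> j else \<rho>)" by auto
    finally have "(\<integral>x. h x * tensor \<eta> x \<partial>lborel) = (\<integral>x. H' x * tensor \<eta> x \<partial>lborel)"
      using H'_val[OF cutoff_bump[OF \<eta>]] by simp
    then show "(\<integral>x. (h x - H' x) * tensor \<eta> x \<partial>lborel) = 0"
      using H'_int[OF cutoff_bump[OF \<eta>]] locally_integrable_tensor[OF h cutoff_bump[OF \<eta>]]
      by (simp add: left_diff_distrib)
  qed
  from AE_glue[OF this, of u] show ?thesis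
    by (intro that[of H]) (simp add: H'_glue)
qed

section \<open>The distribution function and the kernel\<close>

lemma bump_integral_deriv:
  assumes "bump f"
  shows "(\<integral>x. indicator {t..} x * deriv f x \<partial>lborel) = - f t" "(\<integral>x. deriv f x \<partial>lborel) = 0"
proof -
  obtain b where b: "\<And>x. b < \<bar>x\<bar> \<Longrightarrow> f x = 0" and s: "smooth f"
    using assms unfolding bump_def by blast
  obtain b' where b': "\<And>x. b' < \<bar>x\<bar> \<Longrightarrow> deriv f x = 0"
    using bump_deriv[OF assms] unfolding bump_def by blast
  obtain c where c0: "0 < c" "t \<le> c" "b < c" "b' \<le> c"
    by (metis gt_ex max_less_iff_conj less_imp_le)
  have c: "deriv f x = 0" if "c < \<bar>x\<bar>" for x using b'[of x] that c0 by linarith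
  have fc: "f c = 0" "f (- c) = 0" using b[of c] b[of "-c"] c0 by simp_all
  have ftc: "(\<integral>x. deriv f x * indicator {a..c} x \<partial>lborel) = f c - f a" if "a \<le> c" for a
    by (rule integral_FTC_Icc_real[OF that])
       (use smooth_DERIV[OF s] DERIV_isCont[OF smooth_DERIV[OF smooth_deriv[OF s]]] in auto)
  have eq: "indicator {t..} x * deriv f x = deriv f x * indicator {t..c} x" for x
    using c[of x] by (cases "x > c") (auto simp: indicator_def)
  show "(\<integral>x. indicator {t..} x * deriv f x \<partial>lborel) = - f t"
    unfolding eq using ftc[of t] fc c0(2) by simp
  have "deriv f x * indicator {-c..c} x = deriv f x" for x
    using c[of x] by (cases "\<bar>x\<bar> > c") (auto simp: indicator_def abs_le_iff)
  then have "(\<integral>x. deriv f x \<partial>lborel) = (\<integral>x. deriv f x * indicator {-c..c} x \<partial>lborel)"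
    by (simp only:)
  also have "\<dots> = 0" using ftc[of "-c"] fc c0 by simp
  finally show "(\<integral>x. deriv f x \<partial>lborel) = 0" .
qed

locale prob_density =
  fixes \<phi> :: "real \<Rightarrow> real"
  assumes phi_measurable [measurable]: "\<phi> \<in> borel_measurable borel"
    and phi_nonneg: "\<And>x. \<phi> x \<ge> 0"
    and phi_density: "prob_space (density lborel (\<lambda>x. ennreal (\<phi> x)))"
    and Phi_invertible: "bij_betw (dist_fun \<phi>) UNIV {0<..<1}"
begin

abbreviation \<Phi> :: "real \<Rightarrow> real" where "\<Phi> \<equiv> dist_fun \<phi>"

sublocale D: prob_space "density lborel (\<lambda>x. ennreal (\<phi> x))" by (rule phi_density)

sublocale D: real_distribution "density lborel (\<lambda>x. ennreal (\<phi> x))"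
  by standard auto

lemma Phi_bounds: "0 < \<Phi> t" "\<Phi> t < 1"
  using Phi_invertible by (auto simp: bij_betw_def)

lemma strict_mono_Phi: "strict_mono \<Phi>"
proof (rule strict_monoI)
  fix x y :: real assume "x < y"
  then have "\<Phi> x \<le> \<Phi> y" unfolding dist_fun_def by (intro D.cdf_nondecreasing) simp
  moreover have "\<Phi> x \<noteq> \<Phi> y"
    using Phi_invertible \<open>x < y\<close> by (auto simp: bij_betw_def inj_on_def)
  ultimately show "\<Phi> x < \<Phi> y" by simp
qed

lemma Phi_le_iff: "\<Phi> s \<le> \<Phi> t \<longleftrightarrow> s \<le> t"
  using strict_mono_Phi by (rule strict_mono_less_eq)

lemma Phi_measurable [measurable]: "\<Phi> \<in> borel_measurable borel"
  using strict_mono_Phi by (intro borel_measurable_mono strict_mono_mono)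

lemma phi_integrable: "integrable lborel \<phi>" and phi_integral: "(\<integral>x. \<phi> x \<partial>lborel) = 1"
proof -
  have "(\<integral>\<^sup>+x. ennreal (\<phi> x) \<partial>lborel) = 1"
    using D.emeasure_space_1 by (simp add: emeasure_density)
  then show "integrable lborel \<phi>" "(\<integral>x. \<phi> x \<partial>lborel) = 1"
    using phi_nonneg by (auto intro!: integrableI_nonneg simp: integral_eq_nn_integral)
qed

lemma phi_integral_upper: "(\<integral>x. indicator {t..} x * \<phi> x \<partial>lborel) = 1 - \<Phi> t"
  and phi_integrable_upper: "integrable lborel (\<lambda>x. indicator {t..} x * \<phi> x)"
proof -
  have i: "integrable lborel (\<lambda>x. indicator A x * \<phi> x)" if "A \<in> sets borel" for A
    using integrable_real_mult_indicator[of A lborel \<phi>] that phi_integrable by (simp add: mult.commute)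
  have "ennreal (\<Phi> t) = (\<integral>\<^sup>+x. ennreal (indicator {..t} x * \<phi> x) \<partial>lborel)"
    unfolding dist_fun_def cdf_def D.emeasure_eq_measure[symmetric]
    by (auto simp: emeasure_density intro!: nn_integral_cong split: split_indicator)
  also have "\<dots> = ennreal (\<integral>x. indicator {..t} x * \<phi> x \<partial>lborel)"
    by (intro nn_integral_eq_integral i) (auto simp: phi_nonneg)
  finally have "\<Phi> t = (\<integral>x. indicator {..t} x * \<phi> x \<partial>lborel)"
    using less_imp_le[OF Phi_bounds(1)[of t]]
    by (subst (asm) ennreal_inj) (auto intro!: integral_nonneg_AE simp: phi_nonneg)
  also have "\<dots> = (\<integral>x. \<phi> x - indicator {t..} x * \<phi> x \<partial>lborel)"
  proof (rule integral_cong_AE)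
    show "AE x in lborel. indicator {..t} x * \<phi> x = \<phi> x - indicator {t..} x * \<phi> x"
      using AE_lborel_singleton[of t] by eventually_elim (auto simp: indicator_def)
  qed auto
  also have "\<dots> = 1 - (\<integral>x. indicator {t..} x * \<phi> x \<partial>lborel)"
    by (subst Bochner_Integration.integral_diff) (auto intro: i phi_integrable simp: phi_integral)
  finally show "(\<integral>x. indicator {t..} x * \<phi> x \<partial>lborel) = 1 - \<Phi> t" by simp
  show "integrable lborel (\<lambda>x. indicator {t..} x * \<phi> x)" by (intro i) simp
qed

definition kern :: "real \<Rightarrow> real \<Rightarrow> real" where
  "kern y t = indicator {t..} y - (1 - \<Phi> t)"

lemma kern_measurable [measurable]:
  assumes [measurable]: "f \<in> borel_measurable M" "g \<in> borel_measurable M"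
  shows "(\<lambda>x. kern (f x) (g x)) \<in> borel_measurable M"
  unfolding kern_def atLeast_def indicator_def by measurable

text \<open>The envelope dominates \<open>kern y\<close> for all \<open>\<bar>y\<bar> \<le> b\<close>, and the standing assumption on \<open>\<psi>\<close> makes
  \<open>envelope b / \<psi> j\<close> square integrable.\<close>

definition envelope :: "real \<Rightarrow> real \<Rightarrow> real" where
  "envelope b t = indicator {..b} t * \<Phi> t + indicator {-b..} t * (1 - \<Phi> t)"

lemma envelope_measurable [measurable]: "envelope b \<in> borel_measurable borel"
  unfolding envelope_def[abs_def] by measurable

lemma envelope_bounds: "0 \<le> envelope b t" "envelope b t \<le> 1"
  using Phi_bounds[of t] by (auto simp: envelope_def indicator_def)

lemma envelope_pos: "0 \<le> b \<Longrightarrow> 0 < envelope b t"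
  using Phi_bounds[of t] by (auto simp: envelope_def indicator_def)

lemma indicator_le_envelope: "indicator {-b..b} t \<le> envelope b t"
  using Phi_bounds[of t] by (auto simp: envelope_def indicator_def)

lemma abs_kern_le_envelope: "\<bar>y\<bar> \<le> b \<Longrightarrow> \<bar>kern y t\<bar> \<le> envelope b t"
  using Phi_bounds[of t] by (auto simp: kern_def envelope_def indicator_def)

text \<open>The indicator contributes -f(t) by the fundamental theorem of calculus; the constant 1 -
  \<Phi>(t) drops out because the derivative of a bump has integral 0.\<close>

lemma kern_deriv_bump:
  assumes "bump f"
  shows "(\<integral>y. kern y t * deriv f y \<partial>lborel) = - f t"
proof -
  have i: "integrable lborel (deriv f)" using bump_integrable[OF bump_deriv[OF assms]] .
  have "integrable lborel (\<lambda>x. indicator {t..} x * deriv f x)"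
    using integrable_real_mult_indicator[OF _ i, of "{t..}"] by (simp add: mult.commute)
  with i show ?thesis
    using bump_integral_deriv[OF assms] by (simp add: kern_def left_diff_distrib)
qed

lemma kern_phi_integral: "(\<integral>y. kern y t * \<phi> y \<partial>lborel) = 0"
  and kern_phi_abs_integral: "0 \<le> b \<Longrightarrow> (\<integral>\<^sup>+y. ennreal \<bar>kern y t * \<phi> y\<bar> \<partial>lborel) \<le> ennreal (2 * envelope b t)"
proof -
  have i: "integrable lborel (\<lambda>y. (1 - \<Phi> t) * \<phi> y)" "integrable lborel (\<lambda>y. (1 - 2 * \<Phi> t) * \<phi> y)"
    using phi_integrable by auto
  note u = phi_integrable_upper[of t]
  have "(\<integral>y. kern y t * \<phi> y \<partial>lborel) = (\<integral>y. indicator {t..} y * \<phi> y - (1 - \<Phi> t) * \<phi> y \<partial>lborel)"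
    by (simp add: kern_def left_diff_distrib)
  also have "\<dots> = 0"
    by (subst Bochner_Integration.integral_diff[OF u i(1)]) (simp add: phi_integral_upper phi_integral)
  finally show "(\<integral>y. kern y t * \<phi> y \<partial>lborel) = 0" .
  assume b: "0 \<le> b"
  \<comment> \<open>The absolute value of the kernel is 1 - \<Phi>(t) below t and \<Phi>(t) from t
    on, hence affine in the indicator.\<close>
  have *: "\<bar>kern y t * \<phi> y\<bar> = (1 - \<Phi> t) * \<phi> y + (2 * \<Phi> t - 1) * (indicator {t..} y * \<phi> y)" for y
  proof -
    have "\<bar>kern y t\<bar> = (1 - \<Phi> t) + (2 * \<Phi> t - 1) * indicator {t..} y"
      using Phi_bounds[of t] by (cases "y \<in> {t..}") (auto simp: kern_def)
    then have "\<bar>kern y t * \<phi> y\<bar> = ((1 - \<Phi> t) + (2 * \<Phi> t - 1) * indicator {t..} y) * \<phi> y"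
      using phi_nonneg[of y] by (simp only: abs_mult abs_of_nonneg)
    then show ?thesis by (simp add: algebra_simps)
  qed
  have "(\<integral>\<^sup>+y. ennreal \<bar>kern y t * \<phi> y\<bar> \<partial>lborel) = ennreal (\<integral>y. \<bar>kern y t * \<phi> y\<bar> \<partial>lborel)"
  proof (rule nn_integral_eq_integral)
    show "integrable lborel (\<lambda>y. \<bar>kern y t * \<phi> y\<bar>)"
      unfolding * using u i by (intro Bochner_Integration.integrable_add integrable_mult_right)
        (simp_all add: phi_integrable)
  qed simp
  also have "(\<integral>y. \<bar>kern y t * \<phi> y\<bar> \<partial>lborel) = 2 * \<Phi> t * (1 - \<Phi> t)"
  proof -
    have "(\<integral>y. \<bar>kern y t * \<phi> y\<bar> \<partial>lborel) =
        (\<integral>y. (1 - \<Phi> t) * \<phi> y \<partial>lborel) + (\<integral>y. (2 * \<Phi> t - 1) * (indicator {t..} y * \<phi> y) \<partial>lborel)"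
      unfolding * by (rule Bochner_Integration.integral_add[OF i(1) integrable_mult_right[OF u]])
    also have "\<dots> = (1 - \<Phi> t) + (2 * \<Phi> t - 1) * (1 - \<Phi> t)"
      by (simp only: integral_mult_right_zero phi_integral_upper phi_integral mult_1_right)
    finally show ?thesis by (simp add: algebra_simps)
  qed
  also have "\<dots> \<le> 2 * envelope b t"
  proof -
    have "\<Phi> t * (1 - \<Phi> t) \<le> \<Phi> t" "\<Phi> t * (1 - \<Phi> t) \<le> 1 - \<Phi> t"
      using Phi_bounds[of t] mult_left_le[of "1 - \<Phi> t" "\<Phi> t"] mult_left_le[of "\<Phi> t" "1 - \<Phi> t"]
      by (simp_all add: mult.commute)
    \<comment> \<open>For b \<ge> 0 the half-lines \<open>{..b}\<close> and \<open>{-b..}\<close>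
      cover the real line, so at least one summand of the envelope is present.\<close>
    moreover have "min (\<Phi> t) (1 - \<Phi> t) \<le> envelope b t"
      using Phi_bounds[of t] b by (auto simp: envelope_def indicator_def)
    ultimately show ?thesis by (auto simp: min_def split: if_splits)
  qed
  finally show "(\<integral>\<^sup>+y. ennreal \<bar>kern y t * \<phi> y\<bar> \<partial>lborel) \<le> ennreal (2 * envelope b t)"
    by (simp add: ennreal_leI)
qed

lemma kern_cutoff_abs_integral:
  assumes e: "e \<in> borel_measurable borel" "\<And>x. \<bar>e x\<bar> \<le> B * indicator {-B..B} x" and B: "B \<ge> 0"
  shows "(\<integral>\<^sup>+y. ennreal \<bar>kern y t * e y\<bar> \<partial>lborel) \<le> ennreal (2 * B * B * envelope B t)"
proof -
  have "(\<integral>\<^sup>+y. ennreal \<bar>kern y t * e y\<bar> \<partial>lborel) \<le>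
      (\<integral>\<^sup>+y. ennreal (envelope B t * B) * indicator {-B..B} y \<partial>lborel)"
  proof (rule nn_integral_mono)
    fix y
    show "ennreal \<bar>kern y t * e y\<bar> \<le> ennreal (envelope B t * B) * indicator {-B..B} y"
    proof (cases "y \<in> {-B..B}")
      case True
      then have "\<bar>kern y t\<bar> * \<bar>e y\<bar> \<le> envelope B t * B"
        using e(2)[of y] B by (intro mult_mono abs_kern_le_envelope envelope_bounds) auto
      with True show ?thesis by (simp add: abs_mult ennreal_leI)
    next
      case False
      then show ?thesis using e(2)[of y] by simp
    qed
  qed
  also have "\<dots> = ennreal (2 * B * B * envelope B t)"
    using B envelope_bounds(1)[of B t]
    by (subst nn_integral_cmult_indicator) (auto simp: ennreal_mult[symmetric] emeasure_lborel_Icc_eq mult_ac)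
  finally show ?thesis .
qed

end

section \<open>Fubini's theorem for splitting the coordinates of w into u and w - u\<close>

lemma integral_norm_bound_nn_integral:
  "ennreal (norm (\<integral>x. f x \<partial>M)) \<le> (\<integral>\<^sup>+x. ennreal (norm (f x)) \<partial>M)"
  by (cases "integrable M f") (auto simp: integral_norm_bound_ennreal not_integrable_integral_eq)

lemma merge_Diff_measurable:
  "u \<subseteq> w \<Longrightarrow> merge u (w - u) \<in> lebesgue_prod u \<Otimes>\<^sub>M lebesgue_prod (w - u) \<rightarrow>\<^sub>M lebesgue_prod w"
  using measurable_merge[of u "w - u" "\<lambda>_. lborel"] by (simp add: Un_absorb1)

lemma rearrange_measurable:
  fixes u w :: "'n::finite set"
  assumes "u \<subseteq> w" and [measurable]: "F \<in> borel_measurable (lebesgue_prod w \<Otimes>\<^sub>M lebesgue_prod (- u))"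
  shows "(\<lambda>x. F (merge u (w - u) (fst (fst x), snd x), snd (fst x))) \<in>
     borel_measurable ((lebesgue_prod u \<Otimes>\<^sub>M lebesgue_prod (- u)) \<Otimes>\<^sub>M lebesgue_prod (w - u))"
    and "y \<in> space (lebesgue_prod u) \<Longrightarrow> (\<lambda>x. F (merge u (w - u) (y, snd x), fst x)) \<in>
     borel_measurable (lebesgue_prod (- u) \<Otimes>\<^sub>M lebesgue_prod (w - u))"
    and "y \<in> space (lebesgue_prod u) \<Longrightarrow> (\<lambda>x. F (merge u (w - u) (y, fst x), snd x)) \<in>
     borel_measurable (lebesgue_prod (w - u) \<Otimes>\<^sub>M lebesgue_prod (- u))"
proof -
  note [measurable] = merge_Diff_measurable[OF assms(1)]
  show "(\<lambda>x. F (merge u (w - u) (fst (fst x), snd x), snd (fst x))) \<in>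
     borel_measurable ((lebesgue_prod u \<Otimes>\<^sub>M lebesgue_prod (- u)) \<Otimes>\<^sub>M lebesgue_prod (w - u))"
    by measurable
  assume [measurable]: "y \<in> space (lebesgue_prod u)"
  show "(\<lambda>x. F (merge u (w - u) (y, snd x), fst x)) \<in>
     borel_measurable (lebesgue_prod (- u) \<Otimes>\<^sub>M lebesgue_prod (w - u))"
    by measurable
  show "(\<lambda>x. F (merge u (w - u) (y, fst x), snd x)) \<in>
     borel_measurable (lebesgue_prod (w - u) \<Otimes>\<^sub>M lebesgue_prod (- u))"
    by measurable
qed

lemma nn_integral_rearrange:
  fixes u w :: "'n::finite set" and G :: "_ \<Rightarrow> ennreal"
  assumes uw: "u \<subseteq> w" and G [measurable]: "G \<in> borel_measurable (lebesgue_prod w \<Otimes>\<^sub>M lebesgue_prod (- u))"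
  shows "(\<integral>\<^sup>+y. (\<integral>\<^sup>+z. (\<integral>\<^sup>+t. G (merge u (w - u) (y, t), z) \<partial>lebesgue_prod (w - u))
            \<partial>lebesgue_prod (- u)) \<partial>lebesgue_prod u) =
         (\<integral>\<^sup>+s. (\<integral>\<^sup>+z. G (s, z) \<partial>lebesgue_prod (- u)) \<partial>lebesgue_prod w)"
proof -
  interpret P: pair_sigma_finite "lebesgue_prod (w - u)" "lebesgue_prod (- u)"
    by (rule pair_sigma_finite_lebesgue_prod) auto
  have w: "w = u \<union> (w - u)" using uw by auto
  have "(\<integral>\<^sup>+s. (\<integral>\<^sup>+z. G (s, z) \<partial>lebesgue_prod (- u)) \<partial>lebesgue_prod (u \<union> (w - u))) =
     (\<integral>\<^sup>+y. (\<integral>\<^sup>+t. (\<integral>\<^sup>+z. G (merge u (w - u) (y, t), z) \<partial>lebesgue_prod (- u))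
       \<partial>lebesgue_prod (w - u)) \<partial>lebesgue_prod u)"
    by (rule lebesgue_prod.product_nn_integral_fold) (use w in \<open>auto simp: Un_absorb1 uw\<close>)
  also have "\<dots> = (\<integral>\<^sup>+y. (\<integral>\<^sup>+z. (\<integral>\<^sup>+t. G (merge u (w - u) (y, t), z) \<partial>lebesgue_prod (w - u))
            \<partial>lebesgue_prod (- u)) \<partial>lebesgue_prod u)"
    by (intro nn_integral_cong P.Fubini'[symmetric])
       (use rearrange_measurable(3)[OF uw G] in \<open>simp add: split_beta'\<close>)
  finally show ?thesis using w by simp
qed

text \<open>Here s in the coordinates of w will be the kernel variable and z the part of x outside
  u. The derivative \<open>T w u\<close> identifies the u-part of s with the u-part y of x and
  integrates out only the rest t. Both orders of integrating t and z are needed, once for almost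
  every fixed y and once overall.\<close>

lemma integral_rearrange:
  fixes u w :: "'n::finite set" and F :: "_ \<Rightarrow> real"
  assumes uw: "u \<subseteq> w" and F: "integrable (lebesgue_prod w \<Otimes>\<^sub>M lebesgue_prod (- u)) F"
  shows "integrable (lebesgue_prod u \<Otimes>\<^sub>M lebesgue_prod (- u))
           (\<lambda>x. \<integral>t. F (merge u (w - u) (fst x, t), snd x) \<partial>lebesgue_prod (w - u))" (is ?int)
    and "AE y in lebesgue_prod u.
           integrable (lebesgue_prod (- u)) (\<lambda>z. \<integral>t. F (merge u (w - u) (y, t), z) \<partial>lebesgue_prod (w - u)) \<and>
           (\<integral>z. (\<integral>t. F (merge u (w - u) (y, t), z) \<partial>lebesgue_prod (w - u)) \<partial>lebesgue_prod (- u)) =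
           (\<integral>t. (\<integral>z. F (merge u (w - u) (y, t), z) \<partial>lebesgue_prod (- u)) \<partial>lebesgue_prod (w - u))" (is ?swap)
    and "(\<integral>y. (\<integral>z. (\<integral>t. F (merge u (w - u) (y, t), z) \<partial>lebesgue_prod (w - u))
            \<partial>lebesgue_prod (- u)) \<partial>lebesgue_prod u) =
         (\<integral>s. (\<integral>z. F (s, z) \<partial>lebesgue_prod (- u)) \<partial>lebesgue_prod w)" (is ?val)
proof -
  interpret P: pair_sigma_finite "lebesgue_prod (- u)" "lebesgue_prod (w - u)"
    by (rule pair_sigma_finite_lebesgue_prod) auto
  interpret Q: pair_sigma_finite "lebesgue_prod u" "lebesgue_prod (- u)"
    by (rule pair_sigma_finite_lebesgue_prod) auto
  interpret R: pair_sigma_finite "lebesgue_prod w" "lebesgue_prod (- u)"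
    by (rule pair_sigma_finite_lebesgue_prod) auto
  have [measurable]: "F \<in> borel_measurable (lebesgue_prod w \<Otimes>\<^sub>M lebesgue_prod (- u))"
    using F by (rule borel_measurable_integrable)
  have w: "u \<union> (w - u) = w" using uw by auto
  note meas = rearrange_measurable[OF uw, of F]
  have meas3: "(\<lambda>x. \<integral>\<^sup>+t. ennreal (norm (F (merge u (w - u) (fst x, t), snd x))) \<partial>lebesgue_prod (w - u)) \<in>
      borel_measurable (lebesgue_prod u \<Otimes>\<^sub>M lebesgue_prod (- u))"
    using meas(1) by (intro P.M2.borel_measurable_nn_integral) (simp add: split_beta')
  have "(\<integral>\<^sup>+x. ennreal (norm (F x)) \<partial>(lebesgue_prod w \<Otimes>\<^sub>M lebesgue_prod (- u))) < \<infinity>"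
    using F by (simp add: integrable_iff_bounded)
  then have fin: "(\<integral>\<^sup>+y. (\<integral>\<^sup>+z. (\<integral>\<^sup>+t. ennreal (norm (F (merge u (w - u) (y, t), z))) \<partial>lebesgue_prod (w - u))
            \<partial>lebesgue_prod (- u)) \<partial>lebesgue_prod u) < \<infinity>"
    by (subst nn_integral_rearrange[OF uw, of "\<lambda>x. ennreal (norm (F x))"])
       (simp_all add: P.M1.nn_integral_fst[where f = "\<lambda>x. ennreal (norm (F x))", simplified])
  show ?int
  proof (rule integrableI_bounded)
    show "(\<lambda>x. \<integral>t. F (merge u (w - u) (fst x, t), snd x) \<partial>lebesgue_prod (w - u))
        \<in> borel_measurable (lebesgue_prod u \<Otimes>\<^sub>M lebesgue_prod (- u))"
      using meas(1) by (intro P.M2.borel_measurable_lebesgue_integral) (simp add: split_beta')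
    have "(\<integral>\<^sup>+x. ennreal (norm (\<integral>t. F (merge u (w - u) (fst x, t), snd x) \<partial>lebesgue_prod (w - u)))
        \<partial>(lebesgue_prod u \<Otimes>\<^sub>M lebesgue_prod (- u))) \<le>
      (\<integral>\<^sup>+x. (\<integral>\<^sup>+t. ennreal (norm (F (merge u (w - u) (fst x, t), snd x))) \<partial>lebesgue_prod (w - u))
        \<partial>(lebesgue_prod u \<Otimes>\<^sub>M lebesgue_prod (- u)))"
      by (intro nn_integral_mono integral_norm_bound_nn_integral)
    also have "\<dots> < \<infinity>"
      using fin by (subst P.M1.nn_integral_fst[symmetric]) (use meas3 in simp_all)
    finally show "(\<integral>\<^sup>+x. ennreal (norm (\<integral>t. F (merge u (w - u) (fst x, t), snd x) \<partial>lebesgue_prod (w - u)))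
        \<partial>(lebesgue_prod u \<Otimes>\<^sub>M lebesgue_prod (- u))) < \<infinity>" .
  qed
  have "AE y in lebesgue_prod u. (\<integral>\<^sup>+z. (\<integral>\<^sup>+t. ennreal (norm (F (merge u (w - u) (y, t), z))) \<partial>lebesgue_prod (w - u))
            \<partial>lebesgue_prod (- u)) \<noteq> \<infinity>"
    using fin meas3 by (intro nn_integral_PInf_AE P.M1.borel_measurable_nn_integral) (auto simp: split_beta')
  then show swap: ?swap
    using AE_space
  proof eventually_elim
    case (elim y)
    have "integrable (lebesgue_prod (- u) \<Otimes>\<^sub>M lebesgue_prod (w - u)) (\<lambda>x. F (merge u (w - u) (y, snd x), fst x))"
    proof (rule integrableI_bounded)
      show m: "(\<lambda>x. F (merge u (w - u) (y, snd x), fst x)) \<in>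
          borel_measurable (lebesgue_prod (- u) \<Otimes>\<^sub>M lebesgue_prod (w - u))"
        using meas(2) elim(2) by simp
      show "(\<integral>\<^sup>+x. ennreal (norm (F (merge u (w - u) (y, snd x), fst x)))
          \<partial>(lebesgue_prod (- u) \<Otimes>\<^sub>M lebesgue_prod (w - u))) < \<infinity>"
        using elim(1) m by (subst P.M2.nn_integral_fst[symmetric]) (auto simp: less_top)
    qed
    then have i: "integrable (lebesgue_prod (- u) \<Otimes>\<^sub>M lebesgue_prod (w - u)) (\<lambda>(z, t). F (merge u (w - u) (y, t), z))"
      by (simp add: split_beta')
    from P.integrable_fst[OF i] P.Fubini_integral[OF i] show ?case by simp
  qed
  have i: "integrable (lebesgue_prod (u \<union> (w - u))) (\<lambda>s. \<integral>z. F (s, z) \<partial>lebesgue_prod (- u))"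
    unfolding w using F by (rule R.integrable_fst')
  have "(\<integral>s. (\<integral>z. F (s, z) \<partial>lebesgue_prod (- u)) \<partial>lebesgue_prod (u \<union> (w - u))) =
     (\<integral>y. (\<integral>t. (\<integral>z. F (merge u (w - u) (y, t), z) \<partial>lebesgue_prod (- u)) \<partial>lebesgue_prod (w - u)) \<partial>lebesgue_prod u)"
    by (rule lebesgue_prod.product_integral_fold[OF _ _ _ i]) auto
  also have "\<dots> = (\<integral>y. (\<integral>z. (\<integral>t. F (merge u (w - u) (y, t), z) \<partial>lebesgue_prod (w - u))
            \<partial>lebesgue_prod (- u)) \<partial>lebesgue_prod u)"
  proof (rule integral_cong_AE)
    have m: "(\<lambda>x. \<integral>z. F (merge u (w - u) x, z) \<partial>lebesgue_prod (- u)) \<in>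
       borel_measurable (lebesgue_prod u \<Otimes>\<^sub>M lebesgue_prod (w - u))"
      by (rule measurable_compose[OF merge_Diff_measurable[OF uw]])
         (use borel_measurable_integrable[OF i] in \<open>simp add: w\<close>)
    show "(\<lambda>y. \<integral>t. (\<integral>z. F (merge u (w - u) (y, t), z) \<partial>lebesgue_prod (- u)) \<partial>lebesgue_prod (w - u)) \<in>
        borel_measurable (lebesgue_prod u)"
      by (rule P.M2.borel_measurable_lebesgue_integral) (use m in \<open>simp add: split_beta'\<close>)
    show "(\<lambda>y. \<integral>z. (\<integral>t. F (merge u (w - u) (y, t), z) \<partial>lebesgue_prod (w - u)) \<partial>lebesgue_prod (- u)) \<in>
        borel_measurable (lebesgue_prod u)"
      by (rule P.M1.borel_measurable_lebesgue_integral)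
         (use borel_measurable_integrable[OF \<open>?int\<close>] in \<open>simp add: split_beta'\<close>)
    show "AE y in lebesgue_prod u. (\<integral>t. (\<integral>z. F (merge u (w - u) (y, t), z) \<partial>lebesgue_prod (- u)) \<partial>lebesgue_prod (w - u)) =
        (\<integral>z. (\<integral>t. F (merge u (w - u) (y, t), z) \<partial>lebesgue_prod (w - u)) \<partial>lebesgue_prod (- u))"
      using swap by eventually_elim simp
  qed
  finally show ?val unfolding w by simp
qed

section \<open>The representation formula\<close>

lemma prod_less_top: "(\<And>i. (f i :: ennreal) < \<infinity>) \<Longrightarrow> (\<Prod>i\<in>I. f i) < \<infinity>"
  by (induction I rule: infinite_finite_induct) (auto simp: ennreal_mult_less_top)

lemma vec_nth_measurable [measurable]: "(\<lambda>x :: real ^ 'n::finite. x $ i) \<in> borel_measurable borel"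
  by (intro borel_measurable_continuous_onI linear_continuous_on bounded_linear_vec_nth)

locale sobolev_weights = prob_density \<phi> for \<phi> +
  fixes \<psi> :: "'n::finite \<Rightarrow> real \<Rightarrow> real"
  assumes psi_measurable [measurable]: "\<And>j. \<psi> j \<in> borel_measurable borel"
    and psi_pos: "\<And>j y. \<psi> j y > 0"
    and psi_lower: "\<And>j c. set_integrable lborel {..c} (\<lambda>y. \<Phi> y / (\<psi> j y)\<^sup>2)"
    and psi_upper: "\<And>j c. set_integrable lborel {c..} (\<lambda>y. (1 - \<Phi> y) / (\<psi> j y)\<^sup>2)"
begin

text \<open>The envelope lies between 0 and 1, so its square is at most itself; divided by
  \<psi>_j^2 it is the sum of the two integrands of the standing assumption, cut at b and at
  -b.\<close>

lemma envelope_sq_integral: "(\<integral>\<^sup>+t. ennreal ((envelope b t / \<psi> j t)\<^sup>2) \<partial>lborel) < \<infinity>"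
proof -
  have i: "integrable lborel (\<lambda>t. indicator {..b} t *\<^sub>R (\<Phi> t / (\<psi> j t)\<^sup>2) + indicator {-b..} t *\<^sub>R ((1 - \<Phi> t) / (\<psi> j t)\<^sup>2))"
    using psi_lower[of b j] psi_upper[of "-b" j] unfolding set_integrable_def
    by (intro Bochner_Integration.integrable_add)
  have "(\<integral>\<^sup>+t. ennreal ((envelope b t / \<psi> j t)\<^sup>2) \<partial>lborel) \<le> (\<integral>\<^sup>+t. ennreal (norm
     (indicator {..b} t *\<^sub>R (\<Phi> t / (\<psi> j t)\<^sup>2) + indicator {-b..} t *\<^sub>R ((1 - \<Phi> t) / (\<psi> j t)\<^sup>2))) \<partial>lborel)"
  proof (intro nn_integral_mono ennreal_leI)
    fix t
    have "(envelope b t)\<^sup>2 \<le> envelope b t"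
      using envelope_bounds[of b t] by (simp add: power2_eq_square mult_left_le)
    then have "(envelope b t / \<psi> j t)\<^sup>2 \<le> envelope b t / (\<psi> j t)\<^sup>2"
      by (simp add: power_divide divide_right_mono)
    also have "\<dots> = indicator {..b} t *\<^sub>R (\<Phi> t / (\<psi> j t)\<^sup>2) + indicator {-b..} t *\<^sub>R ((1 - \<Phi> t) / (\<psi> j t)\<^sup>2)"
      by (simp add: envelope_def add_divide_distrib)
    finally show "(envelope b t / \<psi> j t)\<^sup>2 \<le>
      norm (indicator {..b} t *\<^sub>R (\<Phi> t / (\<psi> j t)\<^sup>2) + indicator {-b..} t *\<^sub>R ((1 - \<Phi> t) / (\<psi> j t)\<^sup>2))"
      by simp
  qed
  also have "\<dots> < \<infinity>" using i by (simp add: integrable_iff_bounded)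
  finally show ?thesis .
qed

end

definition marginal :: "(real \<Rightarrow> real) \<Rightarrow> ('n set \<Rightarrow> real ^ 'n \<Rightarrow> real) \<Rightarrow> 'n::finite set \<Rightarrow> ('n \<Rightarrow> real) \<Rightarrow> real" where
  "marginal \<phi> g w y = (\<integral>z. g w (glue w y z) * (\<Prod>j\<in>-w. \<phi> (z j)) \<partial>lebesgue_prod (- w))"

lemma prod_Compl: "(\<Prod>j\<in>u. f j) * (\<Prod>j\<in>-u. f j) = (\<Prod>j\<in>(UNIV :: 'n::finite set). f j :: 'a::comm_monoid_mult)"
  using prod.union_disjoint[of u "- u" f] by (simp add: Compl_partition)

text \<open>The function f itself is absent: the induction passes from u to
  \<open>insert j u\<close>, so only the relation between neighbouring members of the family
  matters. It is stated for tensor products, where differentiating in j changes one factor.\<close>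

locale derivative_family = sobolev_weights \<phi> \<psi> for \<phi> and \<psi> :: "'n::finite \<Rightarrow> real \<Rightarrow> real" +
  fixes g :: "'n set \<Rightarrow> real ^ 'n \<Rightarrow> real"
  assumes g_loc: "\<And>w. locally_integrable (g w)"
    and g_deriv: "\<And>w j \<eta>. (\<And>i. bump (\<eta> i)) \<Longrightarrow> j \<notin> w \<Longrightarrow>
      (\<integral>x. g w x * tensor (\<eta>(j := deriv (\<eta> j))) x \<partial>lborel) = - (\<integral>x. g (insert j w) x * tensor \<eta> x \<partial>lborel)"
    and g_marginal: "\<And>w. AE y in lebesgue_prod w.
      integrable (lebesgue_prod (- w)) (\<lambda>z. g w (glue w y z) * (\<Prod>j\<in>-w. \<phi> (z j)))"
    and g_norm: "\<And>w. (\<integral>\<^sup>+y. ennreal ((marginal \<phi> g w y)\<^sup>2 * (\<Prod>j\<in>w. (\<psi> j (y j))\<^sup>2)) \<partial>lebesgue_prod w) < \<infinity>"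
begin

abbreviation m :: "'n set \<Rightarrow> ('n \<Rightarrow> real) \<Rightarrow> real" where "m \<equiv> marginal \<phi> g"

lemma g_measurable [measurable]: "g w \<in> borel_measurable borel"
  using g_loc[of w] by (simp add: locally_integrable_iff)

lemma marginal_measurable: "m w \<in> borel_measurable (lebesgue_prod w)"
proof -
  interpret P: pair_sigma_finite "lebesgue_prod w" "lebesgue_prod (- w)"
    by (rule pair_sigma_finite_lebesgue_prod) auto
  have "(\<lambda>x. g w (glue w (fst x) (snd x)) * (\<Prod>j\<in>-w. \<phi> (snd x j)))
     \<in> borel_measurable (lebesgue_prod w \<Otimes>\<^sub>M lebesgue_prod (- w))"
    by measurable
  then show ?thesis
    unfolding marginal_def[abs_def] by (intro P.M2.borel_measurable_lebesgue_integral) (simp add: split_beta')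
qed

text \<open>Cauchy-Schwarz with \<psi> distributed between the factors: m_w times the weights is
  square integrable by \<open>g_norm\<close>, the envelope divided by the weights by
  \<open>envelope_sq_integral\<close>. As the envelope dominates the kernel locally, every later
  integral of m_w against kernels converges absolutely.\<close>

lemma marginal_envelope_integrable:
  "(\<integral>\<^sup>+s. ennreal (\<bar>m w s\<bar> * (\<Prod>j\<in>w. envelope b (s j))) \<partial>lebesgue_prod w) < \<infinity>"
proof -
  note [measurable] = marginal_measurable
  have "(\<integral>\<^sup>+s. ennreal (\<bar>m w s\<bar> * (\<Prod>j\<in>w. \<psi> j (s j))) * ennreal (\<Prod>j\<in>w. envelope b (s j) / \<psi> j (s j)) \<partial>lebesgue_prod w)\<^sup>2
    \<le> (\<integral>\<^sup>+s. (ennreal (\<bar>m w s\<bar> * (\<Prod>j\<in>w. \<psi> j (s j))))\<^sup>2 \<partial>lebesgue_prod w) *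
       (\<integral>\<^sup>+s. (ennreal (\<Prod>j\<in>w. envelope b (s j) / \<psi> j (s j)))\<^sup>2 \<partial>lebesgue_prod w)"
    by (rule Cauchy_Schwarz_nn_integral) measurable
  also have "(\<integral>\<^sup>+s. (ennreal (\<bar>m w s\<bar> * (\<Prod>j\<in>w. \<psi> j (s j))))\<^sup>2 \<partial>lebesgue_prod w) =
     (\<integral>\<^sup>+s. ennreal ((m w s)\<^sup>2 * (\<Prod>j\<in>w. (\<psi> j (s j))\<^sup>2)) \<partial>lebesgue_prod w)"
    by (intro nn_integral_cong)
       (simp add: ennreal_power prod_nonneg psi_pos less_imp_le power_mult_distrib prod_power_distrib)
  also have "(\<integral>\<^sup>+s. (ennreal (\<Prod>j\<in>w. envelope b (s j) / \<psi> j (s j)))\<^sup>2 \<partial>lebesgue_prod w) =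
     (\<integral>\<^sup>+s. (\<Prod>j\<in>w. ennreal ((envelope b (s j) / \<psi> j (s j))\<^sup>2)) \<partial>lebesgue_prod w)"
    by (intro nn_integral_cong)
       (simp add: ennreal_power prod_nonneg psi_pos less_imp_le envelope_bounds prod_power_distrib prod_ennreal)
  also have "\<dots> = (\<Prod>j\<in>w. \<integral>\<^sup>+t. ennreal ((envelope b t / \<psi> j t)\<^sup>2) \<partial>lborel)"
    by (rule lebesgue_prod.product_nn_integral_prod) auto
  also have "(\<integral>\<^sup>+s. ennreal ((m w s)\<^sup>2 * (\<Prod>j\<in>w. (\<psi> j (s j))\<^sup>2)) \<partial>lebesgue_prod w) *
     (\<Prod>j\<in>w. \<integral>\<^sup>+t. ennreal ((envelope b t / \<psi> j t)\<^sup>2) \<partial>lborel) < \<infinity>"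
  proof -
    have "(\<Prod>j\<in>w. \<integral>\<^sup>+t. ennreal ((envelope b t / \<psi> j t)\<^sup>2) \<partial>lborel) < \<infinity>"
      by (intro prod_less_top envelope_sq_integral)
    with g_norm[of w] show ?thesis by (simp add: ennreal_mult_less_top)
  qed
  finally have "(\<integral>\<^sup>+s. ennreal (\<bar>m w s\<bar> * (\<Prod>j\<in>w. \<psi> j (s j))) * ennreal (\<Prod>j\<in>w. envelope b (s j) / \<psi> j (s j)) \<partial>lebesgue_prod w) < \<infinity>"
    by (auto simp: power2_eq_square ennreal_mult_less_top)
  also have "(\<integral>\<^sup>+s. ennreal (\<bar>m w s\<bar> * (\<Prod>j\<in>w. \<psi> j (s j))) * ennreal (\<Prod>j\<in>w. envelope b (s j) / \<psi> j (s j)) \<partial>lebesgue_prod w) =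
    (\<integral>\<^sup>+s. ennreal (\<bar>m w s\<bar> * (\<Prod>j\<in>w. envelope b (s j))) \<partial>lebesgue_prod w)"
  proof (intro nn_integral_cong)
    fix s
    have "(\<Prod>j\<in>w. \<psi> j (s j)) * (\<Prod>j\<in>w. envelope b (s j) / \<psi> j (s j)) = (\<Prod>j\<in>w. envelope b (s j))"
      unfolding prod.distrib[symmetric] using psi_pos by (intro prod.cong) (auto simp: less_imp_neq[symmetric])
    then have "\<bar>m w s\<bar> * (\<Prod>j\<in>w. \<psi> j (s j)) * (\<Prod>j\<in>w. envelope b (s j) / \<psi> j (s j)) = \<bar>m w s\<bar> * (\<Prod>j\<in>w. envelope b (s j))"
      by (simp only: mult.assoc)
    moreover have "0 \<le> \<bar>m w s\<bar> * (\<Prod>j\<in>w. \<psi> j (s j))" "0 \<le> (\<Prod>j\<in>w. envelope b (s j) / \<psi> j (s j))"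
      by (auto intro!: prod_nonneg mult_nonneg_nonneg simp: psi_pos less_imp_le envelope_bounds)
    ultimately show "ennreal (\<bar>m w s\<bar> * (\<Prod>j\<in>w. \<psi> j (s j))) * ennreal (\<Prod>j\<in>w. envelope b (s j) / \<psi> j (s j)) =
       ennreal (\<bar>m w s\<bar> * (\<Prod>j\<in>w. envelope b (s j)))"
      by (simp only: ennreal_mult[symmetric])
  qed
  finally show ?thesis .
qed

text \<open>The joint integrand of \<open>T w u\<close> tested against a product of factors a (in u)
  and e (outside u), before any integration. Integrating out the part of s in w - u yields
  \<open>T w u\<close>, integrating out z yields one-dimensional pairings of the kernel with
  e.\<close>

definition kint where
  "kint w u a e x = m w (fst x) * (\<Prod>j\<in>u. a j (fst x j)) *
     (\<Prod>j\<in>-u. (if j \<in> w then kern (snd x j) (fst x j) else 1) * e j (snd x j))"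

text \<open>Each coordinate costs at most K, times the envelope if it lies in w, so the integral is
  bounded by a power of K times that of m_w against the envelope. The hypotheses are kept general
  because two cases are needed: compactly supported factors for testing, and e = \<phi> for taking
  marginals.\<close>

lemma
  assumes uw: "u \<subseteq> w" and b: "b > 0" and K: "K \<ge> 0"
    and a_meas [measurable]: "\<And>j. a j \<in> borel_measurable borel" and e_meas [measurable]: "\<And>j. e j \<in> borel_measurable borel"
    and a: "\<And>j s. j \<in> u \<Longrightarrow> \<bar>a j s\<bar> \<le> K * envelope b s"
    and e1: "\<And>j s. j \<in> w - u \<Longrightarrow> (\<integral>\<^sup>+z. ennreal \<bar>kern z s * e j z\<bar> \<partial>lborel) \<le> ennreal (K * envelope b s)"
    and e2: "\<And>j. j \<notin> w \<Longrightarrow> (\<integral>\<^sup>+z. ennreal \<bar>e j z\<bar> \<partial>lborel) \<le> ennreal K"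
  shows kint_integrable: "integrable (lebesgue_prod w \<Otimes>\<^sub>M lebesgue_prod (- u)) (kint w u a e)"
    and kint_integral: "(\<integral>z. kint w u a e (s, z) \<partial>lebesgue_prod (- u)) =
       m w s * (\<Prod>j\<in>u. a j (s j)) * (\<Prod>j\<in>-u. \<integral>z. (if j \<in> w then kern z (s j) else 1) * e j z \<partial>lborel)"
proof -
  interpret P: pair_sigma_finite "lebesgue_prod w" "lebesgue_prod (- u)"
    by (rule pair_sigma_finite_lebesgue_prod) auto
  note [measurable] = marginal_measurable
  have factor_meas [measurable]: "(\<lambda>z. (if j \<in> w then kern z s else 1) * e j z) \<in> borel_measurable borel" for j s
    by (cases "j \<in> w") auto
  have kint_meas [measurable]: "kint w u a e \<in> borel_measurable (lebesgue_prod w \<Otimes>\<^sub>M lebesgue_prod (- u))"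
  proof -
    have 1: "(\<lambda>x. m w (fst x)) \<in> borel_measurable (lebesgue_prod w \<Otimes>\<^sub>M lebesgue_prod (- u))" by measurable
    have 2: "(\<lambda>x. a j (fst x j)) \<in> borel_measurable (lebesgue_prod w \<Otimes>\<^sub>M lebesgue_prod (- u))" if "j \<in> u" for j
    proof -
      have "j \<in> w" using that uw by auto
      then show ?thesis by measurable
    qed
    have 3: "(\<lambda>x. (if j \<in> w then kern (snd x j) (fst x j) else 1) * e j (snd x j))
        \<in> borel_measurable (lebesgue_prod w \<Otimes>\<^sub>M lebesgue_prod (- u))" if "j \<in> -u" for j
    proof (cases "j \<in> w")
      case True
      then have "(\<lambda>x. kern (snd x j) (fst x j) * e j (snd x j))
          \<in> borel_measurable (lebesgue_prod w \<Otimes>\<^sub>M lebesgue_prod (- u))"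
        using that by measurable
      then show ?thesis using True by simp
    next
      case False
      have "(\<lambda>x. e j (snd x j)) \<in> borel_measurable (lebesgue_prod w \<Otimes>\<^sub>M lebesgue_prod (- u))"
        using that by measurable
      then show ?thesis using False by simp
    qed
    show ?thesis unfolding kint_def[abs_def] by (intro borel_measurable_times borel_measurable_prod 1 2 3)
  qed
  have fin: "(\<integral>\<^sup>+z. ennreal \<bar>(if j \<in> w then kern z s else 1) * e j z\<bar> \<partial>lborel) \<le>
      ennreal (K * (if j \<in> w then envelope b s else 1))" if "j \<in> -u" for j s
    using e1[of j s] e2[of j] that by auto
  have "integrable lborel (\<lambda>z. (if j \<in> w then kern z (s j) else 1) * e j z)" if "j \<in> -u" for j s
    using fin[OF that, of "s j"] by (intro integrableI_bounded) (auto intro: le_less_trans)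
  then show "(\<integral>z. kint w u a e (s, z) \<partial>lebesgue_prod (- u)) =
       m w s * (\<Prod>j\<in>u. a j (s j)) * (\<Prod>j\<in>-u. \<integral>z. (if j \<in> w then kern z (s j) else 1) * e j z \<partial>lborel)" for s
    unfolding kint_def fst_conv snd_conv
    using lebesgue_prod.product_integral_prod[of "- u" "\<lambda>j z. (if j \<in> w then kern z (s j) else 1) * e j z"]
    by simp
  show "integrable (lebesgue_prod w \<Otimes>\<^sub>M lebesgue_prod (- u)) (kint w u a e)"
  proof (rule integrableI_bounded)
    let ?E = "\<lambda>s. \<Prod>j\<in>w. envelope b (s j)"
    have inner: "(\<integral>\<^sup>+z. ennreal (norm (kint w u a e (s, z))) \<partial>lebesgue_prod (- u)) \<le>
        ennreal (K ^ CARD('n)) * ennreal (\<bar>m w s\<bar> * ?E s)" for s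
    proof -
      have "(\<integral>\<^sup>+z. ennreal (norm (kint w u a e (s, z))) \<partial>lebesgue_prod (- u)) =
        (\<integral>\<^sup>+z. ennreal (\<bar>m w s\<bar> * (\<Prod>j\<in>u. \<bar>a j (s j)\<bar>)) *
           (\<Prod>j\<in>-u. ennreal \<bar>(if j \<in> w then kern (z j) (s j) else 1) * e j (z j)\<bar>) \<partial>lebesgue_prod (- u))"
        unfolding kint_def fst_conv snd_conv
        by (intro nn_integral_cong)
           (simp add: abs_mult abs_prod prod_ennreal ennreal_mult[symmetric] prod_nonneg)
      also have "\<dots> = ennreal (\<bar>m w s\<bar> * (\<Prod>j\<in>u. \<bar>a j (s j)\<bar>)) *
         (\<integral>\<^sup>+z. (\<Prod>j\<in>-u. ennreal \<bar>(if j \<in> w then kern (z j) (s j) else 1) * e j (z j)\<bar>) \<partial>lebesgue_prod (- u))"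
      proof (rule nn_integral_cmult)
        show "(\<lambda>z. \<Prod>j\<in>-u. ennreal \<bar>(if j \<in> w then kern (z j) (s j) else 1) * e j (z j)\<bar>) \<in> borel_measurable (lebesgue_prod (- u))"
        proof (rule borel_measurable_prod_ennreal)
          fix j assume "j \<in> - u"
          then show "(\<lambda>z. ennreal \<bar>(if j \<in> w then kern (z j) (s j) else 1) * e j (z j)\<bar>) \<in> borel_measurable (lebesgue_prod (- u))"
            by (rule measurable_PiM_component_rev[where f = "\<lambda>z. ennreal \<bar>(if j \<in> w then kern z (s j) else 1) * e j z\<bar>"]) auto
        qed
      qed
      also have "(\<integral>\<^sup>+z. (\<Prod>j\<in>-u. ennreal \<bar>(if j \<in> w then kern (z j) (s j) else 1) * e j (z j)\<bar>) \<partial>lebesgue_prod (- u)) =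
         (\<Prod>j\<in>-u. \<integral>\<^sup>+z. ennreal \<bar>(if j \<in> w then kern z (s j) else 1) * e j z\<bar> \<partial>lborel)"
        by (rule lebesgue_prod.product_nn_integral_prod) auto
      also have "ennreal (\<bar>m w s\<bar> * (\<Prod>j\<in>u. \<bar>a j (s j)\<bar>)) *
          (\<Prod>j\<in>-u. \<integral>\<^sup>+z. ennreal \<bar>(if j \<in> w then kern z (s j) else 1) * e j z\<bar> \<partial>lborel) \<le>
          ennreal (\<bar>m w s\<bar> * (\<Prod>j\<in>u. \<bar>a j (s j)\<bar>)) *
          (\<Prod>j\<in>-u. ennreal (K * (if j \<in> w then envelope b (s j) else 1)))"
        by (intro mult_left_mono prod_mono_ennreal fin) auto
      also have "(\<Prod>j\<in>-u. ennreal (K * (if j \<in> w then envelope b (s j) else 1))) =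
          ennreal (\<Prod>j\<in>-u. K * (if j \<in> w then envelope b (s j) else 1))"
        by (rule prod_ennreal) (auto simp: K envelope_bounds)
      also have "ennreal (\<bar>m w s\<bar> * (\<Prod>j\<in>u. \<bar>a j (s j)\<bar>)) * ennreal (\<Prod>j\<in>-u. K * (if j \<in> w then envelope b (s j) else 1)) =
         ennreal (\<bar>m w s\<bar> * (\<Prod>j\<in>u. \<bar>a j (s j)\<bar>) * (\<Prod>j\<in>-u. K * (if j \<in> w then envelope b (s j) else 1)))"
        by (rule ennreal_mult[symmetric]) (auto intro!: mult_nonneg_nonneg prod_nonneg simp: K envelope_bounds)
      also have "\<dots> \<le> ennreal (\<bar>m w s\<bar> * (\<Prod>j\<in>u. K * (if j \<in> w then envelope b (s j) else 1)) *
          (\<Prod>j\<in>-u. K * (if j \<in> w then envelope b (s j) else 1)))"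
        using a uw by (intro ennreal_leI mult_right_mono mult_left_mono prod_mono)
           (auto intro!: mult_nonneg_nonneg prod_nonneg simp: K envelope_bounds subset_iff)
      also have "\<bar>m w s\<bar> * (\<Prod>j\<in>u. K * (if j \<in> w then envelope b (s j) else 1)) *
          (\<Prod>j\<in>-u. K * (if j \<in> w then envelope b (s j) else 1)) = K ^ CARD('n) * (\<bar>m w s\<bar> * ?E s)"
      proof -
        have "(\<Prod>j\<in>UNIV. K * (if j \<in> w then envelope b (s j) else 1)) = K ^ CARD('n) * ?E s"
          by (simp add: prod.distrib prod.If_cases)
        then show ?thesis by (simp add: mult.assoc prod_Compl)
      qed
      finally show ?thesis
        using K by (subst (asm) ennreal_mult) (auto intro!: mult_nonneg_nonneg prod_nonneg simp: envelope_bounds)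
    qed
    have "(\<integral>\<^sup>+x. ennreal (norm (kint w u a e x)) \<partial>(lebesgue_prod w \<Otimes>\<^sub>M lebesgue_prod (- u))) =
       (\<integral>\<^sup>+s. (\<integral>\<^sup>+z. ennreal (norm (kint w u a e (s, z))) \<partial>lebesgue_prod (- u)) \<partial>lebesgue_prod w)"
      by (subst P.M2.nn_integral_fst[symmetric]) simp_all
    also have "\<dots> \<le> (\<integral>\<^sup>+s. ennreal (K ^ CARD('n)) * ennreal (\<bar>m w s\<bar> * ?E s) \<partial>lebesgue_prod w)"
      by (intro nn_integral_mono inner)
    also have "\<dots> = ennreal (K ^ CARD('n)) * (\<integral>\<^sup>+s. ennreal (\<bar>m w s\<bar> * ?E s) \<partial>lebesgue_prod w)"
      by (rule nn_integral_cmult) measurable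
    also have "\<dots> < \<infinity>" using marginal_envelope_integrable[of w b] by (simp add: ennreal_mult_less_top)
    finally show "(\<integral>\<^sup>+x. ennreal (norm (kint w u a e x)) \<partial>(lebesgue_prod w \<Otimes>\<^sub>M lebesgue_prod (- u))) < \<infinity>" .
  qed simp
qed

text \<open>\<open>T w u\<close> is the \<open>u\<close>-th weak derivative of the \<open>w\<close>-th term \<open>T w {}\<close> of the decomposition; the
  relation \<open>\<partial>k/\<partial>y = \<delta>\<^sub>t\<close> removes the kernel and evaluates \<open>m w\<close> in the coordinates of \<open>u\<close>.\<close>

definition T :: "'n set \<Rightarrow> 'n set \<Rightarrow> real ^ 'n \<Rightarrow> real" where
  "T w u x = (\<integral>t. m w (merge u (w - u) (($) x, t)) * (\<Prod>j\<in>w-u. kern (x $ j) (t j)) \<partial>lebesgue_prod (w - u))"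

lemma T_measurable [measurable]: assumes uw: "u \<subseteq> w" shows "T w u \<in> borel_measurable borel"
proof -
  interpret sigma_finite_measure "lebesgue_prod (w - u)" by (rule lebesgue_prod.sigma_finite) auto
  note [measurable] = marginal_measurable
  have "(\<lambda>x. merge u (w - u) (restrict (($) (fst x)) u, snd x)) \<in> borel \<Otimes>\<^sub>M lebesgue_prod (w - u) \<rightarrow>\<^sub>M lebesgue_prod w"
  proof (rule measurable_compose[OF _ merge_Diff_measurable[OF uw]])
    have "(\<lambda>x. fst x $ i) \<in> borel \<Otimes>\<^sub>M lebesgue_prod (w - u) \<rightarrow>\<^sub>M (lborel :: real measure)" for i
      by (rule measurable_compose[OF measurable_fst]) (simp add: vec_nth_measurable)
    then show "(\<lambda>x. (restrict (($) (fst x)) u, snd x)) \<in>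
        borel \<Otimes>\<^sub>M lebesgue_prod (w - u) \<rightarrow>\<^sub>M lebesgue_prod u \<Otimes>\<^sub>M lebesgue_prod (w - u)"
      by (intro measurable_Pair measurable_restrict) simp_all
  qed
  then have 1: "(\<lambda>x. merge u (w - u) (($) (fst x), snd x)) \<in> borel \<Otimes>\<^sub>M lebesgue_prod (w - u) \<rightarrow>\<^sub>M lebesgue_prod w"
    by simp
  have 2: "(\<lambda>x. kern (fst x $ j) (snd x j)) \<in> borel_measurable (borel \<Otimes>\<^sub>M lebesgue_prod (w - u))" if "j \<in> w - u" for j
    using that by measurable
  have "(\<lambda>x. m w (merge u (w - u) (($) (fst x), snd x)) * (\<Prod>j\<in>w-u. kern (fst x $ j) (snd x j)))
      \<in> borel_measurable (borel \<Otimes>\<^sub>M lebesgue_prod (w - u))"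
    by (intro borel_measurable_times borel_measurable_prod 2 measurable_compose[OF 1 marginal_measurable])
  then show ?thesis
    unfolding T_def[abs_def] by (intro borel_measurable_lebesgue_integral) (simp add: split_beta')
qed

lemma kint_T:
  assumes uw: "u \<subseteq> w"
  shows "(\<integral>t. kint w u a e (merge u (w - u) (y, t), z) \<partial>lebesgue_prod (w - u)) =
     T w u (glue u y z) * ((\<Prod>j\<in>u. a j (y j)) * (\<Prod>j\<in>-u. e j (z j)))"
proof -
  have 1: "merge u (w - u) (($) (glue u y z), t) = merge u (w - u) (y, t)" for t
    by (auto simp: merge_def glue_def fun_eq_iff)
  have "kint w u a e (merge u (w - u) (y, t), z) =
     m w (merge u (w - u) (($) (glue u y z), t)) * (\<Prod>j\<in>w-u. kern (glue u y z $ j) (t j)) *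
       ((\<Prod>j\<in>u. a j (y j)) * (\<Prod>j\<in>-u. e j (z j)))" for t
  proof -
    have "(\<Prod>j\<in>u. a j (merge u (w - u) (y, t) j)) = (\<Prod>j\<in>u. a j (y j))"
      by (intro prod.cong) (auto simp: merge_def)
    moreover have "(\<Prod>j\<in>-u. if j \<in> w then kern (z j) (merge u (w - u) (y, t) j) else 1) =
        (\<Prod>j\<in>w-u. kern (glue u y z $ j) (t j))"
      by (intro prod.mono_neutral_cong_right) (auto simp: merge_def glue_def)
    ultimately show ?thesis unfolding kint_def fst_conv snd_conv 1 prod.distrib by (simp add: mult_ac)
  qed
  then show ?thesis by (simp add: T_def)
qed

text \<open>Pairing with a tensor product reduces T to one-dimensional pairings of the kernel, the
  form in which its weak derivatives can be read off.\<close>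

lemma T_tensor:
  assumes uw: "u \<subseteq> w" and e: "\<And>j. cutoff (e j)"
  shows "integrable lborel (\<lambda>x. T w u x * tensor e x)"
    and "(\<integral>x. T w u x * tensor e x \<partial>lborel) = (\<integral>s. m w s * (\<Prod>j\<in>u. e j (s j)) *
      (\<Prod>j\<in>-u. \<integral>z. (if j \<in> w then kern z (s j) else 1) * e j z \<partial>lborel) \<partial>lebesgue_prod w)"
proof -
  note T_measurable[OF uw, measurable] measurable_tensor[of e, OF cutoffD[OF e], measurable]
  have "\<exists>B>0. \<forall>x. \<bar>e j x\<bar> \<le> B * indicator {-B..B} x" for j
  proof -
    obtain B where B: "B \<ge> 0" "\<And>x. \<bar>e j x\<bar> \<le> B * indicator {-B..B} x" using e[of j] unfolding cutoff_def by blast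
    have "\<bar>e j x\<bar> \<le> (B + 1) * indicator {- (B + 1)..B + 1} x" for x
      using B(1) B(2)[of x] by (cases "x \<in> {-B..B}") auto
    then show ?thesis using B(1) by (intro exI[of _ "B + 1"]) auto
  qed
  then obtain b0 where b0: "\<And>j. b0 j > 0" "\<And>j x. \<bar>e j x\<bar> \<le> b0 j * indicator {- b0 j..b0 j} x" by metis
  define B where "B = (\<Sum>j\<in>UNIV. b0 j)"
  have b0B: "b0 j \<le> B" for j
    unfolding B_def using b0(1) by (intro member_le_sum) (auto simp: less_imp_le)
  have B: "B > 0" using b0(1) b0B by (meson less_le_trans)
  have eB: "\<bar>e j x\<bar> \<le> B * indicator {-B..B} x" for j x
    by (cases "x \<in> {-b0 j..b0 j}") (use b0(2)[of j x] b0B[of j] B in auto)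
  \<comment> \<open>B bounds the values in the coordinates of u; \<open>2 * B * B\<close> is the
    height B times the length 2B of the support, for the integrals over the other
    coordinates.\<close>
  define K where "K = max B (2 * B * B)"
  have e_env: "\<bar>e j s\<bar> \<le> K * envelope B s" for j s
  proof -
    have "\<bar>e j s\<bar> \<le> B * indicator {-B..B} s" by (rule eB)
    also have "\<dots> \<le> K * envelope B s"
      using B by (intro mult_mono indicator_le_envelope) (auto simp: K_def)
    finally show ?thesis .
  qed
  have e1: "(\<integral>\<^sup>+z. ennreal \<bar>kern z s * e j z\<bar> \<partial>lborel) \<le> ennreal (K * envelope B s)" for j s
  proof -
    have "(\<integral>\<^sup>+z. ennreal \<bar>kern z s * e j z\<bar> \<partial>lborel) \<le> ennreal (2 * B * B * envelope B s)"
      using eB B by (intro kern_cutoff_abs_integral cutoffD e) auto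
    also have "\<dots> \<le> ennreal (K * envelope B s)"
      by (intro ennreal_leI mult_right_mono envelope_bounds) (simp add: K_def)
    finally show ?thesis .
  qed
  have e2: "(\<integral>\<^sup>+z. ennreal \<bar>e j z\<bar> \<partial>lborel) \<le> ennreal K" for j
  proof -
    have "(\<integral>\<^sup>+z. ennreal \<bar>e j z\<bar> \<partial>lborel) \<le> (\<integral>\<^sup>+z. ennreal B * indicator {-B..B} z \<partial>lborel)"
    proof (rule nn_integral_mono)
      fix z show "ennreal \<bar>e j z\<bar> \<le> ennreal B * indicator {-B..B} z"
        using eB[of j z] by (cases "z \<in> {-B..B}") (auto intro: ennreal_leI)
    qed
    also have "\<dots> = ennreal (2 * B * B)"
      using B by (subst nn_integral_cmult_indicator) (auto simp: ennreal_mult[symmetric] emeasure_lborel_Icc_eq mult_ac)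
    also have "\<dots> \<le> ennreal K" by (intro ennreal_leI) (simp add: K_def)
    finally show ?thesis .
  qed
  have K: "K \<ge> 0" using B by (simp add: K_def)
  note hyps = uw B K cutoffD[OF e] cutoffD[OF e] e_env e1 e2
  have F: "integrable (lebesgue_prod w \<Otimes>\<^sub>M lebesgue_prod (- u)) (kint w u e e)"
    by (rule kint_integrable[OF hyps])
  have eq: "(\<integral>t. kint w u e e (merge u (w - u) (y, t), z) \<partial>lebesgue_prod (w - u)) =
      T w u (glue u y z) * tensor e (glue u y z)" for y z
    by (simp add: kint_T[OF uw] tensor_glue)
  show i: "integrable lborel (\<lambda>x. T w u x * tensor e x)"
    using integral_rearrange(1)[OF uw F] by (subst integrable_glue_iff[of _ u]) (auto simp: eq)
  show "(\<integral>x. T w u x * tensor e x \<partial>lborel) = (\<integral>s. m w s * (\<Prod>j\<in>u. e j (s j)) *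
      (\<Prod>j\<in>-u. \<integral>z. (if j \<in> w then kern z (s j) else 1) * e j z \<partial>lborel) \<partial>lebesgue_prod w)"
    using integral_glue[OF i, of u] integral_rearrange(3)[OF uw F]
    unfolding eq by (simp only: kint_integral[OF hyps])
qed

lemma T_locally_integrable: "u \<subseteq> w \<Longrightarrow> locally_integrable (T w u)"
  unfolding locally_integrable_iff
  by (intro conjI allI T_measurable T_tensor(1)) (simp_all add: cutoff_indicator)

text \<open>Some j lies in w but not in u; its kernel is still integrated, and against \<phi> it has
  mean zero.\<close>

lemma T_phi:
  assumes uw: "u \<subseteq> w" "u \<noteq> w"
  shows "AE y in lebesgue_prod u. integrable (lebesgue_prod (- u)) (\<lambda>z. T w u (glue u y z) * (\<Prod>j\<in>-u. \<phi> (z j))) \<and>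
     (\<integral>z. T w u (glue u y z) * (\<Prod>j\<in>-u. \<phi> (z j)) \<partial>lebesgue_prod (- u)) = 0"
proof -
  have "(\<integral>\<^sup>+z. ennreal (\<phi> z) \<partial>lborel) = ennreal (\<integral>z. \<phi> z \<partial>lborel)"
    by (rule nn_integral_eq_integral[OF phi_integrable]) (simp add: phi_nonneg)
  then have phi1: "(\<integral>\<^sup>+z. ennreal \<bar>\<phi> z\<bar> \<partial>lborel) \<le> 2"
    by (simp add: phi_integral abs_of_nonneg[OF phi_nonneg])
  have a: "\<bar>envelope 1 s\<bar> \<le> 2 * envelope 1 s" for s using envelope_bounds[of 1 s] by simp
  \<comment> \<open>The weight \<open>envelope 1\<close> in the coordinates of u supplies
    integrability in y. Being positive, it is divided out again once y is fixed.\<close>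
  have F: "integrable (lebesgue_prod w \<Otimes>\<^sub>M lebesgue_prod (- u)) (kint w u (\<lambda>_. envelope 1) (\<lambda>_. \<phi>))"
    by (rule kint_integrable[where b = 1 and K = 2, OF uw(1)])
       (simp_all add: a phi1 kern_phi_abs_integral)
  have zero: "(\<integral>z. kint w u (\<lambda>_. envelope 1) (\<lambda>_. \<phi>) (s, z) \<partial>lebesgue_prod (- u)) = 0" for s
  proof -
    obtain j where "j \<in> w" "j \<notin> u" using uw by auto
    then have "(\<Prod>j\<in>-u. \<integral>z. (if j \<in> w then kern z (s j) else 1) * \<phi> z \<partial>lborel) = 0"
      by (intro prod_zero bexI[of _ j]) (simp_all add: kern_phi_integral)
    moreover have "(\<integral>z. kint w u (\<lambda>_. envelope 1) (\<lambda>_. \<phi>) (s, z) \<partial>lebesgue_prod (- u)) =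
        m w s * (\<Prod>j\<in>u. envelope 1 (s j)) * (\<Prod>j\<in>-u. \<integral>z. (if j \<in> w then kern z (s j) else 1) * \<phi> z \<partial>lborel)"
      by (rule kint_integral[where b = 1 and K = 2 and a = "\<lambda>_. envelope 1" and e = "\<lambda>_. \<phi>", OF uw(1)])
         (simp_all add: a phi1 kern_phi_abs_integral)
    ultimately show ?thesis by (simp only: mult_zero_right)
  qed
  show ?thesis
    using integral_rearrange(2)[OF uw(1) F]
  proof eventually_elim
    case (elim y)
    have pos: "(\<Prod>j\<in>u. envelope 1 (y j)) > 0" by (intro prod_pos) (simp add: envelope_pos)
    have eq: "(\<integral>t. kint w u (\<lambda>_. envelope 1) (\<lambda>_. \<phi>) (merge u (w - u) (y, t), z) \<partial>lebesgue_prod (w - u)) =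
       (\<Prod>j\<in>u. envelope 1 (y j)) * (T w u (glue u y z) * (\<Prod>j\<in>-u. \<phi> (z j)))" for z
      by (simp add: kint_T[OF uw(1)] mult_ac)
    have "envelope 1 t \<noteq> 0" for t using envelope_pos[of 1 t] by simp
    with elim pos show ?case unfolding eq zero by simp
  qed
qed

lemma T_self: "T u u (glue u y z) = m u y"
proof -
  have "m u (merge u {} (($) (glue u y z), t)) = m u y" for t
  proof -
    have "glue u (merge u {} (($) (glue u y z), t)) z' = glue u y z'" for z'
      by (simp add: glue_def merge_def vec_eq_iff)
    then show ?thesis by (simp add: marginal_def)
  qed
  then show ?thesis by (simp add: T_def PiM_empty lebesgue_integral_count_space_finite)
qed

lemma sum_supersets_insert:
  fixes f :: "'n set \<Rightarrow> real"
  assumes "\<And>w. u \<subseteq> w \<Longrightarrow> j \<notin> w \<Longrightarrow> f w = 0"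
  shows "(\<Sum>w | u \<subseteq> w. f w) = (\<Sum>w | insert j u \<subseteq> w. f w)"
  by (rule sum.mono_neutral_right) (use assms in auto)

text \<open>Testing the difference h of both sides against a tensor product with a mean-zero factor
  in direction j, written as a derivative, shifts both sides to \<open>insert j u\<close>, where the
  induction hypothesis applies. For u = UNIV there is no such j, so no separate base case occurs: h
  is trivially a function of its own coordinates, and the comparison of marginals finishes there
  too.\<close>

lemma weak_representation:
  "AE x in lborel. g u x = (\<Sum>w | u \<subseteq> w. T w u x)"
proof (induction "card (- u)" arbitrary: u rule: less_induct)
  case less
  define R where "R v x = (\<Sum>w | v \<subseteq> w. T w v x)" for v x
  define h where "h x = g u x - R u x" for x
  have R_loc: "locally_integrable (R v)" for v
    unfolding R_def[abs_def] by (intro locally_integrable_sum T_locally_integrable) auto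
  have h_loc: "locally_integrable h"
    unfolding h_def[abs_def] by (intro locally_integrable_diff g_loc R_loc)
  have R_tensor: "(\<integral>x. R v x * tensor e x \<partial>lborel) = (\<Sum>w | v \<subseteq> w. \<integral>s. m w s * (\<Prod>j\<in>v. e j (s j)) *
      (\<Prod>j\<in>-v. \<integral>z. (if j \<in> w then kern z (s j) else 1) * e j z \<partial>lborel) \<partial>lebesgue_prod w)"
    if e: "\<And>j. cutoff (e j)" for v e
  proof -
    have "(\<integral>x. R v x * tensor e x \<partial>lborel) = (\<Sum>w | v \<subseteq> w. \<integral>x. T w v x * tensor e x \<partial>lborel)"
      unfolding R_def sum_distrib_right by (rule Bochner_Integration.integral_sum) (use T_tensor(1) e in auto)
    also have "\<dots> = (\<Sum>w | v \<subseteq> w. \<integral>s. m w s * (\<Prod>j\<in>v. e j (s j)) *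
      (\<Prod>j\<in>-v. \<integral>z. (if j \<in> w then kern z (s j) else 1) * e j z \<partial>lborel) \<partial>lebesgue_prod w)"
      by (intro sum.cong refl T_tensor(2) e) auto
    finally show ?thesis .
  qed
  have zero: "(\<integral>x. h x * tensor \<eta> x \<partial>lborel) = 0"
    if \<eta>: "\<And>j. bump (\<eta> j)" and j: "j \<notin> u" and mean: "(\<integral>x. \<eta> j x \<partial>lborel) = 0" for \<eta> j
  proof -
    obtain F where F: "bump F" "deriv F = \<eta> j"
      using bump_zero_mean_antiderivative[OF \<eta> mean] .
    define \<zeta> where "\<zeta> = \<eta>(j := F)"
    have \<zeta>: "bump (\<zeta> i)" for i using \<eta> F by (simp add: \<zeta>_def)
    have \<eta>_\<zeta>: "\<eta> = \<zeta>(j := deriv (\<zeta> j))" using F by (auto simp: \<zeta>_def)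
    have "(\<integral>x. g u x * tensor \<eta> x \<partial>lborel) = - (\<integral>x. g (insert j u) x * tensor \<zeta> x \<partial>lborel)"
      by (subst \<eta>_\<zeta>) (rule g_deriv[OF \<zeta> j])
    also have "(\<integral>x. g (insert j u) x * tensor \<zeta> x \<partial>lborel) = (\<integral>x. R (insert j u) x * tensor \<zeta> x \<partial>lborel)"
    proof (rule integral_cong_AE)
      have "card (- insert j u) < card (- u)" by (rule psubset_card_mono) (use j in auto)
      from less.hyps[OF this]
      show "AE x in lborel. g (insert j u) x * tensor \<zeta> x = R (insert j u) x * tensor \<zeta> x"
        by eventually_elim (simp add: R_def del: insert_subset)
    qed (use R_loc[of "insert j u"] measurable_tensor[of \<zeta>, OF bump_borel[OF \<zeta>]] in \<open>auto simp: locally_integrable_iff\<close>)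
    also have "- (\<integral>x. R (insert j u) x * tensor \<zeta> x \<partial>lborel) = (\<integral>x. R u x * tensor \<eta> x \<partial>lborel)"
    proof -
      define V where "V v e w = (\<integral>s. m w s * (\<Prod>i\<in>v. e i (s i)) *
        (\<Prod>i\<in>-v. \<integral>z. (if i \<in> w then kern z (s i) else 1) * e i z \<partial>lborel) \<partial>lebesgue_prod w)" for v e w
      \<comment> \<open>Without a kernel in direction j, the factor \<eta>_j is paired with 1, and
        its mean is 0.\<close>
      have V0: "V u \<eta> w = 0" if "j \<notin> w" for w
      proof -
        have "(\<Prod>i\<in>-u. \<integral>z. (if i \<in> w then kern z (s i) else 1) * \<eta> i z \<partial>lborel) = 0" for s
          using that j mean by (intro prod_zero) (auto intro!: bexI[of _ j])
        then show ?thesis unfolding V_def by (simp only: mult_zero_right Bochner_Integration.integral_zero)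
      qed
      \<comment> \<open>With a kernel in direction j, the factor \<eta>_j = F' is paired to -F(s_j):
        coordinate j moves from the integrated variables to the evaluated ones, with the same sign
        as in the integration by parts for g.\<close>
      have V1: "V u \<eta> w = - V (insert j u) \<zeta> w" if "j \<in> w" for w
      proof -
        have "(\<Prod>i\<in>u. \<eta> i (s i)) * (\<Prod>i\<in>-u. \<integral>z. (if i \<in> w then kern z (s i) else 1) * \<eta> i z \<partial>lborel) =
           - ((\<Prod>i\<in>insert j u. \<zeta> i (s i)) * (\<Prod>i\<in>-insert j u. \<integral>z. (if i \<in> w then kern z (s i) else 1) * \<zeta> i z \<partial>lborel))" for s
        proof -
          have "(\<Prod>i\<in>-u. \<integral>z. (if i \<in> w then kern z (s i) else 1) * \<eta> i z \<partial>lborel) =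
            (\<integral>z. kern z (s j) * \<eta> j z \<partial>lborel) * (\<Prod>i\<in>-insert j u. \<integral>z. (if i \<in> w then kern z (s i) else 1) * \<eta> i z \<partial>lborel)"
            using j that by (subst prod.remove[of _ j]) (auto intro!: arg_cong2[where f = "(*)"] prod.cong)
          also have "(\<integral>z. kern z (s j) * \<eta> j z \<partial>lborel) = - F (s j)"
            using kern_deriv_bump[OF F(1), of "s j"] F(2) by simp
          also have "(\<Prod>i\<in>-insert j u. \<integral>z. (if i \<in> w then kern z (s i) else 1) * \<eta> i z \<partial>lborel) =
             (\<Prod>i\<in>-insert j u. \<integral>z. (if i \<in> w then kern z (s i) else 1) * \<zeta> i z \<partial>lborel)"
            by (intro prod.cong refl) (auto simp: \<zeta>_def)
          moreover have "(\<Prod>i\<in>insert j u. \<zeta> i (s i)) = F (s j) * (\<Prod>i\<in>u. \<eta> i (s i))"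
            using j by (subst prod.insert) (auto simp: \<zeta>_def intro!: arg_cong2[where f = "(*)"] prod.cong)
          ultimately show ?thesis by simp
        qed
        then have "m w s * (\<Prod>i\<in>u. \<eta> i (s i)) * (\<Prod>i\<in>-u. \<integral>z. (if i \<in> w then kern z (s i) else 1) * \<eta> i z \<partial>lborel) =
           - (m w s * (\<Prod>i\<in>insert j u. \<zeta> i (s i)) * (\<Prod>i\<in>-insert j u. \<integral>z. (if i \<in> w then kern z (s i) else 1) * \<zeta> i z \<partial>lborel))" for s
          by (simp add: mult.assoc)
        then show ?thesis unfolding V_def by simp
      qed
      have "(\<integral>x. R u x * tensor \<eta> x \<partial>lborel) = (\<Sum>w | u \<subseteq> w. V u \<eta> w)"
        unfolding V_def by (rule R_tensor) (rule cutoff_bump[OF \<eta>])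
      also have "\<dots> = (\<Sum>w | insert j u \<subseteq> w. V u \<eta> w)"
        by (rule sum_supersets_insert) (rule V0)
      also have "\<dots> = - (\<Sum>w | insert j u \<subseteq> w. V (insert j u) \<zeta> w)"
        unfolding sum_negf[symmetric] by (intro sum.cong) (auto simp: V1)
      also have "(\<Sum>w | insert j u \<subseteq> w. V (insert j u) \<zeta> w) = (\<integral>x. R (insert j u) x * tensor \<zeta> x \<partial>lborel)"
        unfolding V_def by (rule R_tensor[symmetric]) (rule cutoff_bump[OF \<zeta>])
      finally show ?thesis by simp
    qed
    finally show ?thesis
      using locally_integrable_tensor[OF g_loc cutoff_bump[OF \<eta>]] locally_integrable_tensor[OF R_loc cutoff_bump[OF \<eta>]]
      by (simp add: h_def left_diff_distrib)
  qed
  obtain H where H: "AE y in lebesgue_prod u. AE z in lebesgue_prod (- u). h (glue u y z) = H y"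
    using weakly_constant[OF h_loc zero] .
  have T_all: "AE y in lebesgue_prod u. \<forall>w\<in>{w. u \<subset> w}. integrable (lebesgue_prod (- u)) (\<lambda>z. T w u (glue u y z) * (\<Prod>j\<in>-u. \<phi> (z j))) \<and>
     (\<integral>z. T w u (glue u y z) * (\<Prod>j\<in>-u. \<phi> (z j)) \<partial>lebesgue_prod (- u)) = 0"
    by (rule AE_finite_allI) (use T_phi in \<open>auto simp: psubset_eq\<close>)
  have phi_prod: "integrable (lebesgue_prod (- u)) (\<lambda>z. \<Prod>j\<in>-u. \<phi> (z j))"
    "(\<integral>z. (\<Prod>j\<in>-u. \<phi> (z j)) \<partial>lebesgue_prod (- u)) = 1"
    using lebesgue_prod.product_integrable_prod[of "- u" "\<lambda>_. \<phi>"]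
      lebesgue_prod.product_integral_prod[of "- u" "\<lambda>_. \<phi>"] phi_integrable phi_integral by auto
  \<comment> \<open>Integrated against \<phi> in the remaining variables, all terms with w strictly
    above u vanish, h contributes H(y), and \<open>T u u\<close> contributes m_u(y), which is also
    the marginal of \<open>g u\<close>. Hence H(y) = 0.\<close>
  have "AE y in lebesgue_prod u. AE z in lebesgue_prod (- u). h (glue u y z) = 0"
    using H T_all g_marginal[of u]
  proof eventually_elim
    case (elim y)
    let ?p = "\<lambda>z. \<Prod>j\<in>-u. \<phi> (z j)"
    have sup: "{w. u \<subseteq> w} = insert u {w. u \<subset> w}" by auto
    have split: "g u (glue u y z) * ?p z = (h (glue u y z) * ?p z + m u y * ?p z) + (\<Sum>w | u \<subset> w. T w u (glue u y z) * ?p z)" for z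
    proof -
      have "g u (glue u y z) = h (glue u y z) + (m u y + (\<Sum>w | u \<subset> w. T w u (glue u y z)))"
        unfolding h_def R_def sup by (subst sum.insert) (auto simp: T_self)
      then show ?thesis by (simp add: distrib_right sum_distrib_right)
    qed
    from elim(1) have "AE z in lebesgue_prod (- u). g u (glue u y z) * ?p z =
       (H y + m u y) * ?p z + (\<Sum>w | u \<subset> w. T w u (glue u y z) * ?p z)"
      by eventually_elim (simp add: split distrib_right)
    then have "(\<integral>z. g u (glue u y z) * ?p z \<partial>lebesgue_prod (- u)) =
      (\<integral>z. (H y + m u y) * ?p z + (\<Sum>w | u \<subset> w. T w u (glue u y z) * ?p z) \<partial>lebesgue_prod (- u))"
    proof (intro integral_cong_AE)
      show "(\<lambda>z. (H y + m u y) * ?p z + (\<Sum>w | u \<subset> w. T w u (glue u y z) * ?p z)) \<in> borel_measurable (lebesgue_prod (- u))"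
        using phi_prod elim(2) by (intro borel_measurable_add borel_measurable_sum) (auto intro!: borel_measurable_integrable)
    qed (use elim(3) in auto)
    also have "\<dots> = (\<integral>z. (H y + m u y) * ?p z \<partial>lebesgue_prod (- u)) + (\<integral>z. (\<Sum>w | u \<subset> w. T w u (glue u y z) * ?p z) \<partial>lebesgue_prod (- u))"
      using phi_prod elim(2) by (intro Bochner_Integration.integral_add Bochner_Integration.integrable_sum integrable_mult_right) auto
    also have "(\<integral>z. (\<Sum>w | u \<subset> w. T w u (glue u y z) * ?p z) \<partial>lebesgue_prod (- u)) = 0"
      using elim(2) by (subst Bochner_Integration.integral_sum) auto
    finally have "m u y = H y + m u y" using phi_prod(2) by (simp add: marginal_def)
    then show ?case using elim(1) by simp
  qed
  moreover have h_meas: "h \<in> borel_measurable borel" using h_loc by (simp add: locally_integrable_iff)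
  ultimately have "AE x in lborel. h x = 0"
  proof -
    assume ae: "AE y in lebesgue_prod u. AE z in lebesgue_prod (- u). h (glue u y z) = 0"
    interpret P: pair_sigma_finite "lebesgue_prod u" "lebesgue_prod (- u)"
      by (rule pair_sigma_finite_lebesgue_prod) auto
    have [measurable]: "h \<in> borel_measurable borel" by (rule h_meas)
    have "AE x in lebesgue_prod u \<Otimes>\<^sub>M lebesgue_prod (- u). h (glue u (fst x) (snd x)) = 0"
      by (rule P.AE_pair_measure) (use ae in simp_all)
    then show ?thesis
      by (subst lborel_eq_distr_glue[of u], subst AE_distr_iff) simp_all
  qed
  then show ?case by eventually_elim (simp add: h_def R_def)
qed

end

subsection \<open>The continuous representative\<close>

lemma is_weak_deriv_weak_deriv: "\<exists>g. is_weak_deriv u f g \<Longrightarrow> is_weak_deriv u f (weak_deriv u f)"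
  unfolding weak_deriv_def by (rule someI_ex[of "\<lambda>g. is_weak_deriv u f g"])

lemma continuous_AE_eq:
  fixes f g :: "real ^ 'n::finite \<Rightarrow> real"
  assumes "continuous_on UNIV f" "continuous_on UNIV g" "AE x in lborel. f x = g x"
  shows "f = g"
proof
  fix x
  have "closed {x. f x = g x}" using assms(1,2) by (rule closed_Collect_eq)
  moreover have "AE x in lebesgue. x \<in> {x. f x = g x}" using assms(3) by (auto intro: AE_completion)
  ultimately have "x \<in> {x. f x = g x}" by (rule mem_closed_if_AE_lebesgue)
  then show "f x = g x" by simp
qed

lemma AE_lebesgue_prod_neq:
  assumes "finite w" "j \<in> w"
  shows "AE t in lebesgue_prod w. t j \<noteq> c"
proof -
  have "emeasure (lebesgue_prod w) (Pi\<^sub>E w (\<lambda>i. if i = j then {c} else UNIV)) = 0"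
    using assms by (subst lebesgue_prod.emeasure_PiM) (auto intro!: prod_zero bexI[of _ j])
  moreover have "{t \<in> space (lebesgue_prod w). \<not> t j \<noteq> c} = Pi\<^sub>E w (\<lambda>i. if i = j then {c} else UNIV)"
    using assms by (auto simp: space_PiM PiE_iff extensional_def split: if_splits)
  moreover have "Pi\<^sub>E w (\<lambda>i. if i = j then {c} else UNIV) \<in> sets (lebesgue_prod w)"
    using assms by (intro sets_PiM_I_finite) auto
  ultimately show ?thesis
    by (intro AE_I[of _ _ "Pi\<^sub>E w (\<lambda>i. if i = j then {c} else UNIV)"]) auto
qed

context prob_density
begin

lemma kern_tendsto:
  assumes "x \<longlonglongrightarrow> y" "t \<noteq> y"
  shows "(\<lambda>n. kern (x n) t) \<longlonglongrightarrow> kern y t"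
proof -
  have "eventually (\<lambda>n. kern (x n) t = kern y t) sequentially"
  proof (cases "t < y")
    case True
    from order_tendstoD(1)[OF assms(1) True] show ?thesis
      by eventually_elim (use True in \<open>auto simp: kern_def indicator_def\<close>)
  next
    case False
    then have "y < t" using assms(2) by simp
    from order_tendstoD(2)[OF assms(1) this] show ?thesis
      by eventually_elim (use \<open>y < t\<close> in \<open>auto simp: kern_def indicator_def\<close>)
  qed
  then show ?thesis by (rule tendsto_eventually)
qed

end

context derivative_family
begin

lemma T_empty: "T w {} x = (\<integral>t. m w t * (\<Prod>j\<in>w. kern (x $ j) (t j)) \<partial>lebesgue_prod w)"
proof -
  have "merge {} w (($) x, t) = t" if "t \<in> space (lebesgue_prod w)" for t
    using that by (auto simp: merge_def space_PiM PiE_iff extensional_def fun_eq_iff)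
  then show ?thesis unfolding T_def by (intro Bochner_Integration.integral_cong) auto
qed

text \<open>A convergent sequence is bounded, say by b, and \<open>envelope b\<close> gives a
  majorant for the whole sequence. The kernel jumps only where t_j = x_j for some j, a null set of
  t.\<close>

lemma continuous_T_empty: "continuous_on UNIV (T w {})"
proof (rule continuous_at_imp_continuous_on, rule ballI)
  fix x :: "real ^ 'n"
  note [measurable] = marginal_measurable
  have "(\<lambda>n. T w {} (X n)) \<longlonglongrightarrow> T w {} x" if X: "X \<longlonglongrightarrow> x" for X
  proof -
    from convergent_imp_bounded[OF X] obtain b where b: "\<And>n. norm (X n) \<le> b"
      unfolding bounded_iff by auto
    have bj: "\<bar>X n $ j\<bar> \<le> b" for n j
      using component_le_norm_cart[of "X n" j] b[of n] by linarith
    have E: "integrable (lebesgue_prod w) (\<lambda>t. \<bar>m w t\<bar> * (\<Prod>j\<in>w. envelope b (t j)))"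
    proof (rule integrableI_bounded)
      show "(\<integral>\<^sup>+t. ennreal (norm (\<bar>m w t\<bar> * (\<Prod>j\<in>w. envelope b (t j)))) \<partial>lebesgue_prod w) < \<infinity>"
        using marginal_envelope_integrable[of w b]
        by (simp add: abs_mult abs_prod envelope_bounds)
    qed measurable
    have ae: "AE t in lebesgue_prod w. \<forall>j\<in>w. t j \<noteq> x $ j"
      by (rule AE_finite_allI) (auto intro: AE_lebesgue_prod_neq)
    show ?thesis
      unfolding T_empty
    proof (rule integral_dominated_convergence[where w = "\<lambda>t. \<bar>m w t\<bar> * (\<Prod>j\<in>w. envelope b (t j))"])
      show "AE t in lebesgue_prod w. (\<lambda>n. m w t * (\<Prod>j\<in>w. kern (X n $ j) (t j))) \<longlonglongrightarrow> m w t * (\<Prod>j\<in>w. kern (x $ j) (t j))"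
        using ae
      proof eventually_elim
        case (elim t)
        then show ?case
          by (intro tendsto_intros tendsto_prod kern_tendsto tendsto_vec_nth X) auto
      qed
      show "AE t in lebesgue_prod w. norm (m w t * (\<Prod>j\<in>w. kern (X n $ j) (t j))) \<le> \<bar>m w t\<bar> * (\<Prod>j\<in>w. envelope b (t j))" for n
        unfolding real_norm_def abs_mult abs_prod
        by (intro AE_I2 mult_left_mono prod_mono) (auto intro!: abs_kern_le_envelope bj)
    qed (measurable, rule E)
  qed
  then show "isCont (T w {}) x" by (simp add: continuous_at_sequentially comp_def)
qed

end

context sobolev_weights
begin

text \<open>For the recursion both sides are, up to sign, the pairing of f with the tensor product
  differentiated in \<open>insert j w\<close>; the one additional derivative accounts for the minus
  sign.\<close>

lemma derivative_family_weak_deriv: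
  assumes f: "f \<in> sobolev_space \<phi> \<gamma> \<psi>" and \<gamma>: "\<And>u. \<gamma> u > 0"
  shows "derivative_family \<phi> \<psi> (\<lambda>u. weak_deriv u f)"
proof
  have wd: "is_weak_deriv u f (weak_deriv u f)" for u
    using f by (intro is_weak_deriv_weak_deriv) (auto simp: sobolev_space_def)
  show "locally_integrable (weak_deriv w f)" for w using wd by (auto simp: is_weak_deriv_def)
  fix w and j :: 'n and \<eta> :: "'n \<Rightarrow> real \<Rightarrow> real" assume \<eta>: "\<And>i. bump (\<eta> i)" and j: "j \<notin> w"
  have "(\<integral>x. f x * tensor (\<lambda>i. if i \<in> w then deriv ((\<eta>(j := deriv (\<eta> j))) i) else (\<eta>(j := deriv (\<eta> j))) i) x \<partial>lborel)
    = (-1) ^ card w * (\<integral>x. weak_deriv w f x * tensor (\<eta>(j := deriv (\<eta> j))) x \<partial>lborel)"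
    by (rule is_weak_deriv_tensor[OF wd]) (use \<eta> bump_deriv in auto)
  moreover have "(\<lambda>i. if i \<in> w then deriv ((\<eta>(j := deriv (\<eta> j))) i) else (\<eta>(j := deriv (\<eta> j))) i) =
      (\<lambda>i. if i \<in> insert j w then deriv (\<eta> i) else \<eta> i)"
    using j by auto
  moreover have "(\<integral>x. f x * tensor (\<lambda>i. if i \<in> insert j w then deriv (\<eta> i) else \<eta> i) x \<partial>lborel)
    = (-1) ^ card (insert j w) * (\<integral>x. weak_deriv (insert j w) f x * tensor \<eta> x \<partial>lborel)"
    by (rule is_weak_deriv_tensor[OF wd \<eta>])
  ultimately show "(\<integral>x. weak_deriv w f x * tensor (\<eta>(j := deriv (\<eta> j))) x \<partial>lborel) =
      - (\<integral>x. weak_deriv (insert j w) f x * tensor \<eta> x \<partial>lborel)"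
    using j by (simp add: minus_one_power_iff split: if_splits)
next
  show "AE y in lebesgue_prod w. integrable (lebesgue_prod (- w)) (\<lambda>z. weak_deriv w f (glue w y z) * (\<Prod>j\<in>-w. \<phi> (z j)))" for w
    using f by (simp add: sobolev_space_def inner_integrand_def[abs_def])
  fix w
  have "(\<Sum>u\<in>Pow UNIV. ennreal (inverse (\<gamma> u)) *
        (\<integral>\<^sup>+y. ennreal ((marginal \<phi> (\<lambda>u. weak_deriv u f) u y)\<^sup>2 * (\<Prod>j\<in>u. (\<psi> j (y j))\<^sup>2)) \<partial>lebesgue_prod u)) < \<infinity>"
    using f by (simp add: sobolev_space_def sobolev_norm_sq_def inner_integrand_def marginal_def)
  then have "ennreal (inverse (\<gamma> w)) *
        (\<integral>\<^sup>+y. ennreal ((marginal \<phi> (\<lambda>u. weak_deriv u f) w y)\<^sup>2 * (\<Prod>j\<in>w. (\<psi> j (y j))\<^sup>2)) \<partial>lebesgue_prod w) < \<infinity>"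
    by (auto simp: ennreal_sum_less_top)
  then show "(\<integral>\<^sup>+y. ennreal ((marginal \<phi> (\<lambda>u. weak_deriv u f) w y)\<^sup>2 * (\<Prod>j\<in>w. (\<psi> j (y j))\<^sup>2)) \<partial>lebesgue_prod w) < \<infinity>"
    using \<gamma>[of w] by (auto simp: ennreal_mult_less_top ennreal_eq_0_iff inverse_nonpositive_iff_nonpositive)
qed

text \<open>The term w = {} is the marginal over all coordinates, that is the weighted integral of
  f; only nonempty w remain in the error of any rule that integrates constants exactly. Each summand
  of the squared norm is at most 1, which gives \<gamma>_w as bound for its unweighted part.\<close>

theorem sobolev_representation:
  assumes f: "f \<in> sobolev_space \<phi> \<gamma> \<psi>" and \<gamma>: "\<And>u. \<gamma> u > 0" and norm: "sobolev_norm \<phi> \<gamma> \<psi> f \<le> 1"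
  obtains m where "\<And>w. m w \<in> borel_measurable (lebesgue_prod w)"
    "\<And>w. (\<integral>\<^sup>+t. ennreal ((m w t)\<^sup>2 * (\<Prod>j\<in>w. (\<psi> j (t j))\<^sup>2)) \<partial>lebesgue_prod w) \<le> ennreal (\<gamma> w)"
    "\<And>w b. (\<integral>\<^sup>+t. ennreal (\<bar>m w t\<bar> * (\<Prod>j\<in>w. envelope b (t j))) \<partial>lebesgue_prod w) < \<infinity>"
    "\<And>x. cont_rep f x = weighted_integral \<phi> f +
       (\<Sum>w\<in>UNIV-{{}}. \<integral>t. m w t * (\<Prod>j\<in>w. kern (x $ j) (t j)) \<partial>lebesgue_prod w)"
    "continuous_on UNIV (cont_rep f)"
proof -
  interpret derivative_family \<phi> \<psi> "\<lambda>u. weak_deriv u f"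
    by (rule derivative_family_weak_deriv[OF f \<gamma>])
  define F where "F x = (\<Sum>w\<in>UNIV. T w {} x)" for x
  have f_loc: "locally_integrable f" using f by (simp add: sobolev_space_def)
  have [measurable]: "f \<in> borel_measurable borel" using f_loc by (simp add: locally_integrable_iff)
  have "is_weak_deriv {} f (weak_deriv {} f)"
    using f by (intro is_weak_deriv_weak_deriv) (auto simp: sobolev_space_def)
  then have wd: "(\<integral>x. f x * tensor \<eta> x \<partial>lborel) = (\<integral>x. weak_deriv {} f x * tensor \<eta> x \<partial>lborel)"
    if "\<And>j. bump (\<eta> j)" for \<eta>
    using is_weak_deriv_tensor[of "{}" f _ \<eta>] that by simp
  \<comment> \<open>\<open>weak_deriv {} f\<close> is some choice of a weak derivative of order 0,
    so it agrees with f only almost everywhere.\<close>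
  have "AE x in lborel. f x - weak_deriv {} f x = 0"
  proof (rule weakly_zero_imp_AE_zero)
    show "locally_integrable (\<lambda>x. f x - weak_deriv {} f x)" by (intro locally_integrable_diff f_loc g_loc)
    fix \<eta> :: "'n \<Rightarrow> real \<Rightarrow> real" assume \<eta>: "\<And>j. bump (\<eta> j)"
    show "(\<integral>x. (f x - weak_deriv {} f x) * tensor \<eta> x \<partial>lborel) = 0"
      using locally_integrable_tensor[OF f_loc cutoff_bump[OF \<eta>]]
        locally_integrable_tensor[OF g_loc cutoff_bump[OF \<eta>]] wd[OF \<eta>]
      by (simp add: left_diff_distrib)
  qed
  then have f_g: "AE x in lborel. f x = weak_deriv {} f x" by simp
  have F_f: "AE x in lborel. F x = f x"
    using f_g weak_representation[of "{}"] by eventually_elim (simp add: F_def)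
  have F_cont: "continuous_on UNIV F"
    unfolding F_def[abs_def] by (intro continuous_on_sum continuous_T_empty)
  have rep: "cont_rep f = F"
    unfolding cont_rep_def
  proof (rule the_equality)
    fix h assume h: "continuous_on UNIV h \<and> (AE x in lborel. h x = f x)"
    then have "AE x in lborel. h x = f x" by simp
    with F_f have "AE x in lborel. h x = F x" by eventually_elim simp
    with h F_cont show "h = F" by (intro continuous_AE_eq) auto
  qed (use F_cont F_f in auto)
  have int: "T {} {} x = weighted_integral \<phi> f" for x
  proof -
    have "T {} {} x = m {} undefined"
      using T_self[of "{}" undefined "($) x"] by (simp add: glue_def)
    also have "\<dots> = (\<integral>z. weak_deriv {} f (vec_lambda z) * (\<Prod>j\<in>UNIV. \<phi> (vec_lambda z $ j)) \<partial>lebesgue_prod UNIV)"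
      by (simp add: marginal_def glue_def)
    also have "\<dots> = (\<integral>x. weak_deriv {} f x * (\<Prod>j\<in>UNIV. \<phi> (x $ j)) \<partial>lborel)"
      by (subst lborel_eq_distr_vec_lambda, subst integral_distr) simp_all
    also have "\<dots> = (\<integral>x. f x * (\<Prod>j\<in>UNIV. \<phi> (x $ j)) \<partial>lborel)"
    proof (rule integral_cong_AE)
      show "AE x in lborel. weak_deriv {} f x * (\<Prod>j\<in>UNIV. \<phi> (x $ j)) = f x * (\<Prod>j\<in>UNIV. \<phi> (x $ j))"
        using f_g by eventually_elim simp
    qed simp_all
    finally show ?thesis by (simp add: weighted_integral_def)
  qed
  have val: "cont_rep f x = weighted_integral \<phi> f +
       (\<Sum>w\<in>UNIV-{{}}. \<integral>t. m w t * (\<Prod>j\<in>w. kern (x $ j) (t j)) \<partial>lebesgue_prod w)" for x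
  proof -
    have "F x = T {} {} x + (\<Sum>w\<in>UNIV-{{}}. T w {} x)"
      unfolding F_def by (rule sum.remove) auto
    also have "(\<Sum>w\<in>UNIV-{{}}. T w {} x) = (\<Sum>w\<in>UNIV-{{}}. \<integral>t. m w t * (\<Prod>j\<in>w. kern (x $ j) (t j)) \<partial>lebesgue_prod w)"
      by (simp only: T_empty)
    finally show ?thesis by (simp only: rep int)
  qed
  have bound: "(\<integral>\<^sup>+t. ennreal ((m w t)\<^sup>2 * (\<Prod>j\<in>w. (\<psi> j (t j))\<^sup>2)) \<partial>lebesgue_prod w) \<le> ennreal (\<gamma> w)" for w
  proof -
    let ?X = "\<lambda>w. \<integral>\<^sup>+t. ennreal ((m w t)\<^sup>2 * (\<Prod>j\<in>w. (\<psi> j (t j))\<^sup>2)) \<partial>lebesgue_prod w"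
    have S: "sobolev_norm_sq \<phi> \<gamma> \<psi> f = (\<Sum>u\<in>Pow UNIV. ennreal (inverse (\<gamma> u)) * ?X u)"
      by (simp add: sobolev_norm_sq_def inner_integrand_def marginal_def)
    have "sobolev_norm_sq \<phi> \<gamma> \<psi> f < \<infinity>" using f by (simp add: sobolev_space_def)
    moreover have "enn2real (sobolev_norm_sq \<phi> \<gamma> \<psi> f) \<le> 1"
      using norm by (simp add: sobolev_norm_def)
    ultimately have le: "sobolev_norm_sq \<phi> \<gamma> \<psi> f \<le> 1"
      by (metis ennreal_1 ennreal_enn2real ennreal_leI infinity_ennreal_def)
    have "ennreal (inverse (\<gamma> w)) * ?X w \<le> (\<Sum>u\<in>Pow UNIV. ennreal (inverse (\<gamma> u)) * ?X u)"
      by (rule member_le_sum) auto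
    with le S have "ennreal (inverse (\<gamma> w)) * ?X w \<le> 1" by simp
    then have "ennreal (\<gamma> w) * (ennreal (inverse (\<gamma> w)) * ?X w) \<le> ennreal (\<gamma> w) * 1"
      by (rule mult_left_mono) simp
    moreover have "ennreal (\<gamma> w) * (ennreal (inverse (\<gamma> w)) * ?X w) = ?X w"
      using \<gamma>[of w] by (simp add: mult.assoc[symmetric] ennreal_mult[symmetric])
    ultimately show ?thesis by simp
  qed
  show ?thesis
    by (rule that[of m]) (use marginal_measurable bound marginal_envelope_integrable val rep F_cont in auto)
qed

end

section \<open>Fourier expansion of the sawtooth correlation\<close>

text \<open>The Fourier series \<open>\<Sum> cos(2\<pi>nx)/n\<^sup>2\<close> is the real part of the dilogarithm on the unit circle.
  Inside the disc its derivative along the circle is governed by \<open>-Ln (1 - w)\<close>, whose imaginary part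
  at \<open>w = cis (2\<pi>t)\<close> is linear in \<open>t\<close>, so a limit \<open>\<bar>w\<bar> \<rightarrow> 1\<close> yields the Bernoulli polynomial.\<close>

definition dilog :: "complex \<Rightarrow> complex" where
  "dilog w = (\<Sum>n. 1 / (of_nat n)\<^sup>2 * w ^ n)"

lemma dilog_term_le: "norm w \<le> 1 \<Longrightarrow> norm (1 / (of_nat n)\<^sup>2 * w ^ n :: complex) \<le> 1 / (real n)\<^sup>2"
  using power_le_one[of "norm w" n]
  by (simp add: norm_mult norm_divide norm_power divide_right_mono)

lemma summable_inverse_squares: "summable (\<lambda>n. 1 / (real n)\<^sup>2)"
  using inverse_power_summable[of 2, where 'a = real] by (simp add: inverse_eq_divide)

lemma dilog_summable:
  assumes "norm (w :: complex) \<le> 1" shows "summable (\<lambda>n. 1 / (of_nat n)\<^sup>2 * w ^ n)"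
  by (rule summable_comparison_test[OF _ summable_inverse_squares])
     (use dilog_term_le[OF assms] in blast)

lemma continuous_dilog: "continuous_on (cball 0 1) dilog"
proof (rule uniform_limit_theorem)
  show "uniform_limit (cball 0 1) (\<lambda>n w. \<Sum>i<n. 1 / (of_nat i)\<^sup>2 * w ^ i) dilog sequentially"
    unfolding dilog_def[abs_def]
    by (rule Weierstrass_m_test[where M = "\<lambda>n. 1 / (real n)\<^sup>2", OF _ summable_inverse_squares])
       (rule dilog_term_le, simp)
  show "\<forall>\<^sub>F n in sequentially. continuous_on (cball 0 1) (\<lambda>w. \<Sum>i<n. 1 / (of_nat i)\<^sup>2 * w ^ i :: complex)"
    by (intro always_eventually allI continuous_intros)
qed simp

text \<open>Multiplying the derivative by w gives the logarithm series without an exception at w =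
  0, and the chain rule along the circle supplies exactly this factor w.\<close>

lemma dilog_has_field_derivative:
  assumes "norm w < 1"
  shows "\<exists>D. (dilog has_field_derivative D) (at w) \<and> w * D = - Ln (1 - w)"
proof -
  let ?c = "\<lambda>n. 1 / (of_nat n)\<^sup>2 :: complex"
  have D: "(dilog has_field_derivative (\<Sum>n. diffs ?c n * w ^ n)) (at w)"
    unfolding dilog_def[abs_def]
    by (rule termdiffs_strong[of _ 1]) (use dilog_summable[of 1] assms in auto)
  have sum: "summable (\<lambda>n. diffs ?c n * w ^ n)"
    by (rule termdiff_converges[of _ 1]) (use assms dilog_summable in auto)
  have "(\<lambda>n. w * (diffs ?c n * w ^ n)) sums (w * (\<Sum>n. diffs ?c n * w ^ n))"
    by (intro sums_mult summable_sums sum)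
  moreover have "w * (diffs ?c n * w ^ n) = w ^ Suc n / of_nat (Suc n)" for n
    by (simp add: diffs_def power2_eq_square del: of_nat_Suc)
  ultimately have "(\<lambda>n. w ^ Suc n / of_nat (Suc n)) sums (w * (\<Sum>n. diffs ?c n * w ^ n))" by simp
  moreover have "(\<lambda>n. w ^ Suc n / of_nat (Suc n)) sums (- Ln (1 - w))"
  proof -
    have "(\<lambda>n. - ((- (- w)) ^ n) / of_nat n) sums Ln (1 + (- w))"
      by (rule Ln_series') (use assms in simp)
    from sums_minus[OF this] have "(\<lambda>n. w ^ n / of_nat n) sums (- Ln (1 - w))" by simp
    then show ?thesis using sums_Suc_iff[of "\<lambda>n. w ^ n / of_nat n"] by simp
  qed
  ultimately show ?thesis using D sums_unique2 by blast
qed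

text \<open>Half-angle formulas give 1 - cis(2\<pi>t) = 2 sin(\<pi>t) cis(\<pi>t - \<pi>/2), with
  positive modulus and an argument in the principal range for 0 < t < 1.\<close>

lemma Im_Ln_one_minus_cis:
  assumes "0 < t" "t < 1"
  shows "Im (Ln (1 - cis (2 * pi * t))) = pi * t - pi / 2"
proof -
  have s: "sin (pi * t) > 0" using assms by (intro sin_gt_zero) auto
  have "exp (Complex (ln (2 * sin (pi * t))) (pi * t - pi / 2)) = 1 - cis (2 * pi * t)"
  proof -
    have "cos (pi * t - pi / 2) = sin (pi * t)" "sin (pi * t - pi / 2) = - cos (pi * t)"
      by (simp_all add: cos_diff sin_diff)
    moreover have "cos (2 * pi * t) = 1 - 2 * sin (pi * t) ^ 2" "sin (2 * pi * t) = 2 * sin (pi * t) * cos (pi * t)"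
      using cos_double_sin[of "pi * t"] sin_double[of "pi * t"] by (simp_all add: mult.assoc)
    ultimately show ?thesis
      using s by (simp add: complex_eq_iff exp_eq_polar cis.code power2_eq_square)
  qed
  then have "Ln (1 - cis (2 * pi * t)) = Complex (ln (2 * sin (pi * t))) (pi * t - pi / 2)"
  proof (rule Ln_unique)
    have "0 < pi * t" "pi * t < pi" using assms by auto
    then show "- pi < Im (Complex (ln (2 * sin (pi * t))) (pi * t - pi / 2))"
      "Im (Complex (ln (2 * sin (pi * t))) (pi * t - pi / 2)) \<le> pi"
      using pi_gt_zero unfolding complex.sel by linarith+
  qed
  then show ?thesis by simp
qed

text \<open>By the chain rule the derivative of the dilogarithm along t is -2\<pi>i Ln(1 - w), whose
  real part involves only the argument of 1 - w.\<close>

lemma dilog_cis_deriv: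
  assumes "0 \<le> r" "r < 1"
  shows "((\<lambda>t. Re (dilog (of_real r * cis (2 * pi * t)))) has_real_derivative
      2 * pi * Im (Ln (1 - of_real r * cis (2 * pi * t)))) (at t)"
proof -
  define w where "w t = of_real r * cis (2 * pi * t)" for t
  have "norm (w t) < 1" using assms by (simp add: w_def norm_mult)
  then obtain D where D: "(dilog has_field_derivative D) (at (w t))" "w t * D = - Ln (1 - w t)"
    using dilog_has_field_derivative by blast
  have "((\<lambda>z. of_real r * exp (2 * pi * \<i> * z)) has_field_derivative 2 * pi * \<i> * w t) (at (of_real t))"
    by (auto intro!: derivative_eq_intros simp: w_def cis_conv_exp mult_ac)
  moreover have w_exp: "w s = of_real r * exp (2 * pi * \<i> * of_real s)" for s
    by (simp add: w_def cis_conv_exp mult_ac)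
  ultimately have "((\<lambda>z. dilog (of_real r * exp (2 * pi * \<i> * z))) has_field_derivative D * (2 * pi * \<i> * w t)) (at (of_real t))"
    using D(1) by (intro DERIV_chain2[of dilog]) simp_all
  from has_vector_derivative_real_field[OF this, of UNIV]
  have "((\<lambda>s. dilog (w s)) has_vector_derivative D * (2 * pi * \<i> * w t)) (at t)"
    by (simp add: w_exp)
  from bounded_linear.has_vector_derivative[OF bounded_linear_Re this]
  have "((\<lambda>t. Re (dilog (w t))) has_real_derivative Re (D * (2 * pi * \<i> * w t))) (at t)"
    by (simp add: has_real_derivative_iff_has_vector_derivative)
  also have "D * (2 * pi * \<i> * w t) = of_real (2 * pi) * (\<i> * (w t * D))"
    by (simp add: mult_ac)
  also have "Re \<dots> = 2 * pi * Im (Ln (1 - w t))" by (simp add: D(2))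
  finally show ?thesis by (simp add: w_def)
qed

text \<open>Radii r_n < 1 keep the path inside the disc. The imaginary part of Ln is bounded by
  \<pi>, which justifies the limit under the integral, and the limit integrand is the derivative of
  \<pi>^2 (t^2 - t). Both end points stay inside (0, 1), away from the zero of 1 -
  cis(2\<pi>t).\<close>

lemma dilog_cis_diff:
  assumes "0 < x" "x \<le> y" "y < 1"
  shows "Re (dilog (cis (2 * pi * y))) - Re (dilog (cis (2 * pi * x))) = pi\<^sup>2 * (y\<^sup>2 - y) - pi\<^sup>2 * (x\<^sup>2 - x)"
proof -
  define r where "r n = 1 - 1 / real (Suc n)" for n
  have r: "0 \<le> r n" "r n < 1" for n by (auto simp: r_def field_simps)
  have r_lim: "r \<longlonglongrightarrow> 1"
    unfolding r_def[abs_def] using tendsto_diff[OF tendsto_const LIMSEQ_inverse_real_of_nat, of 1]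
    by (simp add: inverse_eq_divide)
  have Re_pos: "0 < Re (1 - of_real q * cis s)" if "0 \<le> q" "q < 1" for q s
  proof -
    have "q * cos s \<le> q" using that by (simp add: mult_left_le)
    then show ?thesis using that by simp
  qed
  have Ln_cont: "isCont (\<lambda>t. 2 * pi * Im (Ln (1 - of_real (r n) * cis (2 * pi * t)))) t" for n t
  proof -
    have "1 - of_real (r n) * cis (2 * pi * s) \<notin> \<real>\<^sub>\<le>\<^sub>0" for s
      using Re_pos[OF r, of n "2 * pi * s"] by (auto simp: complex_nonpos_Reals_iff)
    then have "continuous_on UNIV (\<lambda>t. 2 * pi * Im (Ln (1 - of_real (r n) * cis (2 * pi * t))))"
      by (intro continuous_intros) auto
    then show ?thesis by (simp add: continuous_on_eq_continuous_at)
  qed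
  let ?g = "\<lambda>n t. 2 * pi * Im (Ln (1 - of_real (r n) * cis (2 * pi * t))) * indicator {x..y} t"
  have ftc: "(\<integral>t. ?g n t \<partial>lborel) = Re (dilog (of_real (r n) * cis (2 * pi * y))) - Re (dilog (of_real (r n) * cis (2 * pi * x)))" for n
    by (rule integral_FTC_Icc_real[OF assms(2)]) (use dilog_cis_deriv[OF r] Ln_cont in auto)
  have lim1: "(\<lambda>n. \<integral>t. ?g n t \<partial>lborel) \<longlonglongrightarrow> (\<integral>t. 2 * pi * (pi * t - pi / 2) * indicator {x..y} t \<partial>lborel)"
  proof (rule integral_dominated_convergence[where w = "\<lambda>t. 2 * pi * pi * indicator {x..y} t"])
    show "(\<lambda>t. 2 * pi * (pi * t - pi / 2) * indicator {x..y} t) \<in> borel_measurable lborel" by measurable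
    show "?g n \<in> borel_measurable lborel" for n
    proof -
      have "(\<lambda>t. 2 * pi * Im (Ln (1 - of_real (r n) * cis (2 * pi * t)))) \<in> borel_measurable borel"
        by (intro borel_measurable_continuous_onI continuous_at_imp_continuous_on ballI Ln_cont)
      then show ?thesis by simp
    qed
    show "integrable lborel (\<lambda>t. 2 * pi * pi * indicator {x..y} t)"
      by (intro integrable_mult_right integrable_real_indicator) (auto simp: emeasure_lborel_Icc_eq)
    show "AE t in lborel. (\<lambda>n. ?g n t) \<longlonglongrightarrow> 2 * pi * (pi * t - pi / 2) * indicator {x..y} t"
    proof (rule AE_I2)
      fix t :: real
      show "(\<lambda>n. ?g n t) \<longlonglongrightarrow> 2 * pi * (pi * t - pi / 2) * indicator {x..y} t"
      proof (cases "t \<in> {x..y}")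
        case True
        then have t: "0 < t" "t < 1" using assms by auto
        have "cos (2 * pi * t) < 1"
          using cos_double_sin[of "pi * t"] sin_gt_zero[of "pi * t"] t by (simp add: mult.assoc)
        then have "1 - cis (2 * pi * t) \<notin> \<real>\<^sub>\<le>\<^sub>0" by (auto simp: complex_nonpos_Reals_iff)
        then have "(\<lambda>n. Im (Ln (1 - of_real (r n) * cis (2 * pi * t)))) \<longlonglongrightarrow> Im (Ln (1 - of_real 1 * cis (2 * pi * t)))"
          by (intro tendsto_intros r_lim) simp
        then show ?thesis
          using True t by (auto simp: Im_Ln_one_minus_cis intro!: tendsto_intros)
      qed simp
    qed
    show "AE t in lborel. norm (?g n t) \<le> 2 * pi * pi * indicator {x..y} t" for n
    proof (rule AE_I2)
      fix t :: real
      have "1 - of_real (r n) * cis (2 * pi * t) \<noteq> 0"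
        using Re_pos[OF r, of n "2 * pi * t"] by (metis less_irrefl zero_complex.sel(1))
      from mpi_less_Im_Ln[OF this] Im_Ln_le_pi[OF this]
      have "\<bar>Im (Ln (1 - of_real (r n) * cis (2 * pi * t)))\<bar> \<le> pi" unfolding abs_le_iff by linarith
      then show "norm (?g n t) \<le> 2 * pi * pi * indicator {x..y} t"
        by (auto simp: abs_mult indicator_def)
    qed
  qed
  have lim2: "(\<lambda>n. Re (dilog (of_real (r n) * cis (2 * pi * z)))) \<longlonglongrightarrow> Re (dilog (cis (2 * pi * z)))" for z
  proof -
    have "(\<lambda>n. dilog (of_real (r n) * cis (2 * pi * z))) \<longlonglongrightarrow> dilog (cis (2 * pi * z))"
    proof (rule continuous_on_tendsto_compose[OF continuous_dilog])
      have "(\<lambda>n. of_real (r n) * cis (2 * pi * z)) \<longlonglongrightarrow> of_real 1 * cis (2 * pi * z)"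
        by (intro tendsto_intros r_lim)
      then show "(\<lambda>n. of_real (r n) * cis (2 * pi * z)) \<longlonglongrightarrow> cis (2 * pi * z)" by simp
    qed (use r in \<open>auto simp: norm_mult less_imp_le\<close>)
    then show ?thesis by (rule tendsto_Re)
  qed
  have "(\<integral>t. 2 * pi * (pi * t - pi / 2) * indicator {x..y} t \<partial>lborel) =
      Re (dilog (cis (2 * pi * y))) - Re (dilog (cis (2 * pi * x)))"
    using lim1 unfolding ftc by (rule LIMSEQ_unique) (intro tendsto_diff lim2)
  moreover have "(\<integral>t. 2 * pi * (pi * t - pi / 2) * indicator {x..y} t \<partial>lborel) =
      pi\<^sup>2 * (y\<^sup>2 - y) - pi\<^sup>2 * (x\<^sup>2 - x)"
    by (rule integral_FTC_Icc_real[OF assms(2)])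
       (auto intro!: derivative_eq_intros continuous_intros simp: power2_eq_square algebra_simps)
  ultimately show ?thesis by simp
qed

lemma Re_dilog_cis: "Re (dilog (cis (2 * pi * x))) = (\<Sum>n. cos (2 * pi * real (Suc n) * x) / (real (Suc n))\<^sup>2)"
  and summable_cos_squares: "summable (\<lambda>n. cos (2 * pi * real (Suc n) * x) / (real (Suc n))\<^sup>2)"
proof -
  have "(\<lambda>n. 1 / (of_nat n)\<^sup>2 * cis (2 * pi * x) ^ n) sums dilog (cis (2 * pi * x))"
    unfolding dilog_def by (intro summable_sums dilog_summable) simp
  then have "(\<lambda>n. Re (1 / (of_nat n)\<^sup>2 * cis (2 * pi * x) ^ n)) sums Re (dilog (cis (2 * pi * x)))"
    by (rule sums_Re)
  moreover have "Re (1 / (of_nat n)\<^sup>2 * cis (2 * pi * x) ^ n) = cos (2 * pi * real n * x) / (real n)\<^sup>2" for n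
  proof -
    have "1 / (of_nat n)\<^sup>2 * cis (2 * pi * x) ^ n = of_real (1 / (real n)\<^sup>2) * cis (real n * (2 * pi * x))"
      by (simp only: Complex.DeMoivre) simp
    then have "Re (1 / (of_nat n)\<^sup>2 * cis (2 * pi * x) ^ n) = 1 / (real n)\<^sup>2 * cos (real n * (2 * pi * x))"
      by (simp only: Re_complex_of_real times_complex.sel Im_complex_of_real cis.sel mult_zero_left diff_zero)
    then show ?thesis by (simp add: mult_ac)
  qed
  ultimately have "(\<lambda>n. cos (2 * pi * real n * x) / (real n)\<^sup>2) sums Re (dilog (cis (2 * pi * x)))" by (simp only:)
  then have *: "(\<lambda>n. cos (2 * pi * real (Suc n) * x) / (real (Suc n))\<^sup>2) sums Re (dilog (cis (2 * pi * x)))"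
    using sums_Suc_iff[of "\<lambda>n. cos (2 * pi * real n * x) / (real n)\<^sup>2"] by simp
  from sums_unique[OF *] sums_summable[OF *]
  show "Re (dilog (cis (2 * pi * x))) = (\<Sum>n. cos (2 * pi * real (Suc n) * x) / (real (Suc n))\<^sup>2)"
    "summable (\<lambda>n. cos (2 * pi * real (Suc n) * x) / (real (Suc n))\<^sup>2)" by auto
qed

text \<open>The second Bernoulli polynomial, extended with period 1.\<close>

definition bern2 :: "real \<Rightarrow> real" where "bern2 x = (frac x)\<^sup>2 - frac x + 1 / 6"

text \<open>The difference formula determines the series on (0, 1) up to a constant. By continuity
  the constant can be read off at 0, where the series is the sum of the inverse squares; periodicity
  then covers all real x.\<close>

theorem bern2_sums: "(\<lambda>n. cos (2 * pi * real (Suc n) * x) / (pi * real (Suc n))\<^sup>2) sums bern2 x"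
proof -
  define S where "S x = Re (dilog (cis (2 * pi * x)))" for x
  have S_cont: "continuous_on UNIV S"
    unfolding S_def[abs_def]
    by (intro continuous_intros continuous_on_compose2[OF continuous_dilog]) auto
  have S0: "S 0 = pi\<^sup>2 / 6"
  proof -
    have "(\<lambda>n. 1 / (real (Suc n))\<^sup>2) sums (pi\<^sup>2 / 6)"
      using inverse_squares_sums by (simp add: add.commute)
    then show ?thesis using Re_dilog_cis[of 0] by (simp add: S_def sums_iff)
  qed
  define G where "G x = S x - pi\<^sup>2 * (x\<^sup>2 - x)" for x
  have G_const: "G x = G y" if "0 < x" "x < 1" "0 < y" "y < 1" for x y
    using dilog_cis_diff[of x y] dilog_cis_diff[of y x] that
    by (cases "x \<le> y") (auto simp: G_def S_def)
  have G_half: "G x = G (1/2)" if "0 < x" "x < 1" for x using G_const[of x "1/2"] that by simp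
  have "(\<lambda>n. G (1 / real (Suc (Suc n)))) \<longlonglongrightarrow> G 0"
  proof (rule continuous_on_tendsto_compose[of UNIV G])
    show "continuous_on UNIV G" unfolding G_def[abs_def] by (intro continuous_intros S_cont)
    show "(\<lambda>n. 1 / real (Suc (Suc n))) \<longlonglongrightarrow> 0"
      using LIMSEQ_Suc[OF LIMSEQ_inverse_real_of_nat] by (simp add: inverse_eq_divide)
  qed auto
  moreover have "G (1 / real (Suc (Suc n))) = G (1/2)" for n by (rule G_half) auto
  ultimately have "G 0 = G (1/2)" by (simp add: LIMSEQ_const_iff)
  then have val: "S x = pi\<^sup>2 * (x\<^sup>2 - x + 1/6)" if "0 \<le> x" "x < 1" for x
    using G_half[of x] that S0 by (cases "x = 0") (auto simp: G_def algebra_simps)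
  have "cis (2 * pi * x) = cis (2 * pi * frac x)"
  proof -
    have "cis (2 * pi * x) = cis (2 * pi * frac x + 2 * pi * of_int \<lfloor>x\<rfloor>)"
      by (simp add: frac_def algebra_simps)
    then show ?thesis by (simp add: cis_mult[symmetric] cis_multiple_2pi)
  qed
  then have "S x = S (frac x)" by (simp add: S_def)
  also have "\<dots> = pi\<^sup>2 * bern2 x" by (simp add: val frac_ge_0 frac_lt_1 bern2_def)
  finally have "(\<lambda>n. cos (2 * pi * real (Suc n) * x) / (real (Suc n))\<^sup>2) sums (pi\<^sup>2 * bern2 x)"
    using Re_dilog_cis[of x] summable_cos_squares[of x] by (simp add: S_def sums_iff)
  from sums_divide[OF this, of "pi\<^sup>2"] show ?thesis
    by (simp add: power_mult_distrib mult.commute del: of_nat_Suc)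
qed

section \<open>Autocorrelations of the sawtooth and of the periodic jump function\<close>

definition saw :: "real \<Rightarrow> real" where "saw x = frac x - 1 / 2"

lemma frac_measurable [measurable]: "(frac :: real \<Rightarrow> real) \<in> borel_measurable borel"
  unfolding frac_def[abs_def] by measurable

lemma saw_measurable [measurable]: "saw \<in> borel_measurable borel"
  unfolding saw_def[abs_def] by measurable

lemma frac_add_unit: "0 \<le> x \<Longrightarrow> x < 1 \<Longrightarrow> frac (x + a) = x + frac a - indicator {1 - frac a..} x"
  by (auto simp: frac_add frac_eq indicator_def)

lemma integral_poly_Icc_1:
  assumes "c \<le> 1"
  shows "(\<integral>x. (A + B * x + C * x\<^sup>2) * indicator {c..1::real} x \<partial>lborel) =
     A * (1 - c) + B * (1 - c\<^sup>2) / 2 + C * (1 - c ^ 3) / 3"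
proof -
  have "(\<integral>x. (A + B * x + C * x\<^sup>2) * indicator {c..1} x \<partial>lborel) =
    (A * 1 + B * 1\<^sup>2 / 2 + C * 1 ^ 3 / 3) - (A * c + B * c\<^sup>2 / 2 + C * c ^ 3 / 3)"
    by (rule integral_FTC_Icc_real[OF assms, where F = "\<lambda>x. A * x + B * x\<^sup>2 / 2 + C * x ^ 3 / 3"])
       (auto intro!: derivative_eq_intros continuous_intros simp: power2_eq_square)
  then show ?thesis by (simp add: algebra_simps diff_divide_distrib)
qed

lemma integrable_poly_Icc: "integrable lborel (\<lambda>x. (A + B * x + C * x\<^sup>2) * indicator {c..d::real} x)"
  using borel_integrable_compact[of "{c..d}" "\<lambda>x. A + B * x + C * x\<^sup>2"]
  by (simp add: continuous_intros mult.commute scaleR_conv_of_real indicator_times_eq_if if_distrib cong: if_cong)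

lemma saw_correlation_aux:
  fixes p q :: real
  assumes "0 \<le> p" "p \<le> q" "q < 1"
  shows "(\<integral>x. (x + p - 1/2 - indicator {1 - p..} x) * (x + q - 1/2 - indicator {1 - q..} x) * indicator {0..1} x \<partial>lborel)
    = ((q - p)\<^sup>2 - (q - p) + 1/6) / 2"
proof -
  define P where "P A B C c x = (A + B * x + C * x\<^sup>2) * indicator {c..1::real} x" for A B C c x
  have int: "integrable lborel (P A B C c)" for A B C c
    unfolding P_def[abs_def] by (rule integrable_poly_Icc)
  have val: "integral\<^sup>L lborel (P A B C c) = A * (1 - c) + B * (1 - c\<^sup>2) / 2 + C * (1 - c ^ 3) / 3" if "c \<le> 1" for A B C c
    unfolding P_def[abs_def] by (rule integral_poly_Icc_1[OF that])
  \<comment> \<open>As 1 - q \<le> 1 - p, the product of the two indicators is the one for p. This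
    adds -1 to the polynomial subtracted on [1 - p, 1].\<close>
  have eq: "(x + p - 1/2 - indicator {1 - p..} x) * (x + q - 1/2 - indicator {1 - q..} x) * indicator {0..1} x =
      P ((p - 1/2) * (q - 1/2)) (p + q - 1) 1 0 x - P (p - 1/2) 1 0 (1 - q) x - P (q - 1/2 - 1) 1 0 (1 - p) x" for x
    using assms unfolding P_def
    by (cases "x < 0"; cases "x > 1"; cases "x < 1 - p"; cases "x < 1 - q")
       (simp_all add: power2_eq_square algebra_simps add_divide_distrib)
  have "(\<integral>x. (x + p - 1/2 - indicator {1 - p..} x) * (x + q - 1/2 - indicator {1 - q..} x) * indicator {0..1} x \<partial>lborel)
     = integral\<^sup>L lborel (P ((p - 1/2) * (q - 1/2)) (p + q - 1) 1 0) - integral\<^sup>L lborel (P (p - 1/2) 1 0 (1 - q))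
       - integral\<^sup>L lborel (P (q - 1/2 - 1) 1 0 (1 - p))"
    unfolding eq by (subst Bochner_Integration.integral_diff, intro Bochner_Integration.integrable_diff int, rule int,
        subst Bochner_Integration.integral_diff) (simp_all add: int)
  also have "\<dots> = ((q - p)\<^sup>2 - (q - p) + 1/6) / 2"
    using assms by (simp add: val) (simp add: field_simps power2_eq_square power3_eq_cube)
  finally show ?thesis .
qed

text \<open>Only x modulo 1 matters, and the symmetry of y^2 - y under y \<mapsto> 1 - y makes the
  value depend on the distance of p and q alone.\<close>

lemma bern2_eq:
  assumes "0 \<le> p" "p < 1" "0 \<le> q" "q < 1" "x - (p - q) \<in> \<int>"
  shows "bern2 x = (p - q)\<^sup>2 - \<bar>p - q\<bar> + 1 / 6"
proof -
  have "x - (1 + (p - q)) \<in> \<int>"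
    using Ints_diff[OF assms(5) Ints_1] by (simp add: algebra_simps)
  then have "frac x = (if p < q then 1 + (p - q) else p - q)"
    using assms by (auto simp: frac_unique_iff)
  then show ?thesis by (auto simp: bern2_def power2_eq_square algebra_simps)
qed

lemma saw_correlation:
  "integrable lborel (\<lambda>x. saw (x + a) * saw (x + b) * indicator {0..1} x)"
  "(\<integral>x. saw (x + a) * saw (x + b) * indicator {0..1} x \<partial>lborel) = bern2 (a - b) / 2"
proof -
  have saw_bound: "\<bar>saw x\<bar> \<le> 1" for x
    using frac_ge_0[of x] frac_lt_1[of x] unfolding saw_def abs_le_iff by linarith
  have "integrable lborel (\<lambda>x. indicator {0..1::real} x :: real)"
    by (intro integrable_real_indicator) (auto simp: emeasure_lborel_Icc_eq)
  then show "integrable lborel (\<lambda>x. saw (x + a) * saw (x + b) * indicator {0..1} x)"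
    by (rule Bochner_Integration.integrable_bound)
       (auto simp: abs_mult indicator_def intro!: mult_le_one saw_bound)
  define p where "p = frac a" define q where "q = frac b"
  have pq: "0 \<le> p" "p < 1" "0 \<le> q" "q < 1" by (auto simp: p_def q_def frac_lt_1)
  have "(\<integral>x. saw (x + a) * saw (x + b) * indicator {0..1} x \<partial>lborel) =
     (\<integral>x. (x + p - 1/2 - indicator {1 - p..} x) * (x + q - 1/2 - indicator {1 - q..} x) * indicator {0..1} x \<partial>lborel)"
  proof (rule integral_cong_AE)
    show "AE x in lborel. saw (x + a) * saw (x + b) * indicator {0..1} x =
      (x + p - 1/2 - indicator {1 - p..} x) * (x + q - 1/2 - indicator {1 - q..} x) * indicator {0..1} x"
      using AE_lborel_singleton[of 1]
    proof eventually_elim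
      case (elim x)
      show ?case
      proof (cases "x \<in> {0..1}")
        case True
        then have "0 \<le> x" "x < 1" using elim by auto
        then have "saw (x + a) = x + p - 1/2 - indicator {1 - p..} x" "saw (x + b) = x + q - 1/2 - indicator {1 - q..} x"
          by (simp_all add: saw_def frac_add_unit p_def q_def)
        then show ?thesis by simp
      qed simp
    qed
  qed measurable
  also have "\<dots> = ((p - q)\<^sup>2 - \<bar>p - q\<bar> + 1 / 6) / 2"
  proof (cases "p \<le> q")
    case True
    then show ?thesis using saw_correlation_aux[OF pq(1) True pq(4)] by (simp add: power2_commute)
  next
    case False
    then show ?thesis using saw_correlation_aux[OF pq(3) _ pq(2)] by (simp add: mult.commute)
  qed
  also have "(p - q)\<^sup>2 - \<bar>p - q\<bar> + 1 / 6 = bern2 (a - b)"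
  proof (rule bern2_eq[symmetric, OF pq])
    have "a - b - (p - q) = of_int (\<lfloor>a\<rfloor> - \<lfloor>b\<rfloor>)" by (simp add: p_def q_def frac_def)
    then show "a - b - (p - q) \<in> \<int>" by (metis Ints_of_int)
  qed
  finally show "(\<integral>x. saw (x + a) * saw (x + b) * indicator {0..1} x \<partial>lborel) = bern2 (a - b) / 2" .
qed

text \<open>Both sides jump by +1 at v modulo 1 and by -1 at the integers, are constant in between
  and have mean zero.\<close>

lemma jump_eq_saw:
  assumes "0 < v" "v < 1"
  shows "indicator {v..} (frac x) - (1 - v) = saw x - saw (x - v)"
proof -
  have "frac (x - v) = (if v \<le> frac x then frac x - v else frac x - v + 1)"
  proof -
    have "x - v - (frac x - v) = of_int \<lfloor>x\<rfloor>" "x - v - (frac x - v + 1) = of_int (\<lfloor>x\<rfloor> - 1)"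
      by (simp_all add: frac_def)
    then have "x - v - (frac x - v) \<in> \<int>" "x - v - (frac x - v + 1) \<in> \<int>"
      by (simp_all only: Ints_of_int)
    moreover obtain q where q: "frac x = q" "0 \<le> q" "q < 1" using frac_ge_0[of x] frac_lt_1[of x] by blast
    ultimately have "x - v - (q - v) \<in> \<int>" "x - v - (q - v + 1) \<in> \<int>" by (simp_all only: q(1))
    then show ?thesis unfolding q(1) using assms q(2,3) by (auto simp: frac_unique_iff)
  qed
  then show ?thesis by (auto simp: saw_def)
qed

text \<open>With d = a - b the four sawtooth correlations combine to the second difference B(d) -
  (B(d + v) + B(d - v))/2 of \<open>bern2\<close>. At frequency n this multiplies the coefficient by
  1 - cos(2\<pi>nv) = 2 sin^2(\<pi>nv).\<close>

theorem jump_correlation: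
  assumes v: "0 < v" "v < 1"
  defines "\<kappa> \<equiv> \<lambda>u. indicator {v..} (frac u) - (1 - v)"
  shows "(\<lambda>n. 2 * (sin (pi * real (Suc n) * v))\<^sup>2 / (pi * real (Suc n))\<^sup>2 * cos (2 * pi * real (Suc n) * (a - b)))
     sums (\<integral>x. \<kappa> (x + a) * \<kappa> (x + b) * indicator {0..1} x \<partial>lborel)"
proof -
  have \<kappa>: "\<kappa> x = saw x - saw (x - v)" for x unfolding \<kappa>_def by (rule jump_eq_saw[OF v])
  let ?S = "\<lambda>a b x. saw (x + a) * saw (x + b) * indicator {0..1} x"
  have "\<kappa> (x + a) * \<kappa> (x + b) * indicator {0..1} x = ?S a b x - ?S a (b - v) x - ?S (a - v) b x + ?S (a - v) (b - v) x" for x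
    unfolding \<kappa> by (simp add: algebra_simps)
  then have "(\<integral>x. \<kappa> (x + a) * \<kappa> (x + b) * indicator {0..1} x \<partial>lborel) =
      (\<integral>x. ?S a b x - ?S a (b - v) x - ?S (a - v) b x + ?S (a - v) (b - v) x \<partial>lborel)" by simp
  also have "\<dots> = bern2 (a - b) / 2 - bern2 (a - (b - v)) / 2 - bern2 (a - v - b) / 2 + bern2 (a - v - (b - v)) / 2"
    by (simp only: Bochner_Integration.integral_add Bochner_Integration.integral_diff
        Bochner_Integration.integrable_diff Bochner_Integration.integrable_add saw_correlation)
  also have "\<dots> = bern2 (a - b) - bern2 (a - b + v) / 2 - bern2 (a - b - v) / 2"
    by (simp add: algebra_simps)
  finally have I: "(\<integral>x. \<kappa> (x + a) * \<kappa> (x + b) * indicator {0..1} x \<partial>lborel) =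
    bern2 (a - b) - bern2 (a - b + v) / 2 - bern2 (a - b - v) / 2" .
  let ?c = "\<lambda>x n. cos (2 * pi * real (Suc n) * x) / (pi * real (Suc n))\<^sup>2"
  have "(\<lambda>n. ?c (a - b) n - ?c (a - b + v) n / 2 - ?c (a - b - v) n / 2) sums
    (bern2 (a - b) - bern2 (a - b + v) / 2 - bern2 (a - b - v) / 2)"
    by (intro sums_diff sums_divide bern2_sums)
  moreover have "?c (a - b) n - ?c (a - b + v) n / 2 - ?c (a - b - v) n / 2 =
    2 * (sin (pi * real (Suc n) * v))\<^sup>2 / (pi * real (Suc n))\<^sup>2 * cos (2 * pi * real (Suc n) * (a - b))" for n
  proof -
    define D V Q where "D = 2 * pi * real (Suc n) * (a - b)" and "V = pi * real (Suc n) * v"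
      and "Q = (pi * real (Suc n))\<^sup>2"
    have c12: "cos (2 * pi * real (Suc n) * (a - b + v)) = cos D * cos (2 * V) - sin D * sin (2 * V)"
      "cos (2 * pi * real (Suc n) * (a - b - v)) = cos D * cos (2 * V) + sin D * sin (2 * V)"
      unfolding cos_add[symmetric] cos_diff[symmetric] by (simp_all add: D_def V_def algebra_simps)
    have c3: "cos (2 * V) = 1 - 2 * (sin V)\<^sup>2" by (simp add: cos_double_sin)
    show ?thesis
      unfolding c12 c3 D_def[symmetric] V_def[symmetric] Q_def[symmetric]
      by (simp add: algebra_simps diff_divide_distrib add_divide_distrib)
  qed
  ultimately show ?thesis unfolding I by simp
qed

section \<open>Divisor bounds and counting lattice points\<close>

text \<open>This is the number of divisors of \<open>N\<close>; it also bounds \<open>N / totient N\<close> because each factor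
  \<open>p / (p - 1)\<close> is at most \<open>2\<close>.\<close>

definition divisor_bound :: "nat \<Rightarrow> real" where
  "divisor_bound N = (\<Prod>p\<in>prime_factors N. real (multiplicity p N) + 1)"

lemma card_divisors_le_divisor_bound:
  assumes "N > 0"
  shows "real (card {d. d dvd N}) \<le> divisor_bound N"
proof -
  let ?P = "prime_factors N"
  define \<phi> where "\<phi> d = (\<lambda>p\<in>?P. multiplicity p d)" for d :: nat
  have "inj_on \<phi> {d. d dvd N}"
  proof (rule inj_onI)
    fix d e assume de: "d \<in> {d. d dvd N}" "e \<in> {d. d dvd N}" "\<phi> d = \<phi> e"
    have mult: "multiplicity p d = multiplicity p e" if p: "prime p" for p
    proof (cases "p \<in> ?P")
      case True
      then show ?thesis using fun_cong[OF de(3), of p] by (simp add: \<phi>_def)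
    next
      case False
      then have "\<not> p dvd N" using p assms by (simp add: prime_factors_dvd)
      then have "\<not> p dvd d" "\<not> p dvd e" using de(1,2) dvd_trans[of p d N] dvd_trans[of p e N] by auto
      then show ?thesis by (simp add: not_dvd_imp_multiplicity_0)
    qed
    have pos: "d > 0" "e > 0" using de(1,2) dvd_pos_nat[OF assms] by simp_all
    show "d = e" by (rule multiplicity_eq_nat[OF pos mult])
  qed
  moreover have "\<phi> ` {d. d dvd N} \<subseteq> Pi\<^sub>E ?P (\<lambda>p. {..multiplicity p N})"
  proof
    fix x assume "x \<in> \<phi> ` {d. d dvd N}"
    then obtain d where "x = \<phi> d" "d dvd N" by auto
    then show "x \<in> Pi\<^sub>E ?P (\<lambda>p. {..multiplicity p N})"
      using assms unfolding \<phi>_def by (auto intro: dvd_imp_multiplicity_le)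
  qed
  ultimately have "card {d. d dvd N} \<le> card (Pi\<^sub>E ?P (\<lambda>p. {..multiplicity p N}))"
    by (intro card_inj_on_le finite_PiE) auto
  also have "card (Pi\<^sub>E ?P (\<lambda>p. {..multiplicity p N})) = (\<Prod>p\<in>?P. Suc (multiplicity p N))"
    by (subst card_PiE) auto
  finally have "real (card {d. d dvd N}) \<le> real (\<Prod>p\<in>?P. Suc (multiplicity p N))"
    by (simp only: of_nat_le_iff)
  also have "\<dots> = divisor_bound N" by (simp add: divisor_bound_def add.commute)
  finally show ?thesis .
qed

lemma totient_ge:
  assumes "N > 0"
  shows "real N \<le> real (totient N) * divisor_bound N"
proof -
  let ?P = "prime_factors N"
  have "(\<Prod>p\<in>?P. 1 - 1 / real p) * divisor_bound N = (\<Prod>p\<in>?P. (1 - 1 / real p) * (real (multiplicity p N) + 1))"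
    by (simp add: divisor_bound_def prod.distrib)
  also have "\<dots> \<ge> 1"
  proof (rule prod_ge_1)
    fix p assume p: "p \<in> ?P"
    then have "p \<ge> 2" by (intro prime_ge_2_nat in_prime_factors_imp_prime)
    then have "1 / 2 \<le> 1 - 1 / real p" by (simp add: field_simps)
    moreover have "multiplicity p N \<ge> 1"
      using p assms by (auto simp: prime_factors_multiplicity)
    ultimately have "(1 / 2) * 2 \<le> (1 - 1 / real p) * (real (multiplicity p N) + 1)"
      by (intro mult_mono) auto
    then show "1 \<le> (1 - 1 / real p) * (real (multiplicity p N) + 1)" by simp
  qed
  finally have "1 \<le> (\<Prod>p\<in>?P. 1 - 1 / real p) * divisor_bound N" .
  then have "real N * 1 \<le> real N * ((\<Prod>p\<in>?P. 1 - 1 / real p) * divisor_bound N)"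
    by (intro mult_left_mono) auto
  then show ?thesis by (simp add: totient_formula2 mult.assoc)
qed

lemma divisor_bound_nonneg: "divisor_bound N \<ge> 0"
  by (auto simp: divisor_bound_def intro!: prod_nonneg)

text \<open>For primes p \<ge> 2^(1/\<delta>) one has a + 1 \<le> 2^a \<le> p^(a\<delta>), so they
  cost nothing. There are at most \<open>P0\<close> smaller primes, and each of them costs a
  constant factor K.\<close>

lemma divisor_bound_subpolynomial:
  assumes "\<delta> > 0"
  obtains C where "C > 0" "\<And>N. N > 0 \<Longrightarrow> divisor_bound N \<le> C * real N powr \<delta>"
proof -
  \<comment> \<open>Chosen so that a + 1 \<le> K (1 + a \<delta> ln 2) \<le> K exp(a \<delta> ln 2)
    = K 2^(a\<delta>).\<close>
  define K where "K = max 1 (1 / (\<delta> * ln 2))"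
  define P0 where "P0 = nat \<lceil>2 powr (1 / \<delta>)\<rceil>"
  have K: "K \<ge> 1" "K * (\<delta> * ln 2) \<ge> 1" using assms by (auto simp: K_def max_def field_simps)
  have key: "real a + 1 \<le> (if p < P0 then K else 1) * real p powr (real a * \<delta>)" if "p \<ge> 2" for a p :: nat
  proof (cases "p < P0")
    case True
    have "real a + 1 \<le> (K * (\<delta> * ln 2)) * real a + K"
      using K mult_right_mono[OF K(2), of "real a"] by simp
    also have "\<dots> = K * (1 + real a * \<delta> * ln 2)" by (simp add: algebra_simps)
    also have "\<dots> \<le> K * exp (real a * \<delta> * ln 2)"
      using K by (intro mult_left_mono) (auto intro: exp_ge_add_one_self)
    also have "exp (real a * \<delta> * ln 2) = 2 powr (real a * \<delta>)" by (simp add: powr_def)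
    also have "K * 2 powr (real a * \<delta>) \<le> K * real p powr (real a * \<delta>)"
      using K assms that by (intro mult_left_mono powr_mono2) auto
    finally show ?thesis using True by simp
  next
    case False
    then have "2 powr (1 / \<delta>) \<le> real p" unfolding P0_def by linarith
    then have "(2 powr (1 / \<delta>)) powr (real a * \<delta>) \<le> real p powr (real a * \<delta>)"
      using assms by (intro powr_mono2) auto
    moreover have "(2 powr (1 / \<delta>)) powr (real a * \<delta>) = 2 ^ a"
      using assms by (simp add: powr_powr powr_realpow)
    moreover have "real a + 1 \<le> 2 ^ a"
      using Bernoulli_inequality[of "1 :: real" a] by simp
    ultimately show ?thesis using False by simp
  qed
  have "divisor_bound N \<le> K ^ P0 * real N powr \<delta>" if N: "N > 0" for N
  proof -
    let ?P = "prime_factors N"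
    have p2: "p \<ge> 2" if "p \<in> ?P" for p
      using that by (intro prime_ge_2_nat in_prime_factors_imp_prime)
    have "divisor_bound N \<le> (\<Prod>p\<in>?P. (if p < P0 then K else 1) * real p powr (real (multiplicity p N) * \<delta>))"
      unfolding divisor_bound_def
    proof (intro prod_mono conjI)
      fix p assume "p \<in> ?P"
      then show "real (multiplicity p N) + 1 \<le> (if p < P0 then K else 1) * real p powr (real (multiplicity p N) * \<delta>)"
        by (intro key p2)
    qed simp
    also have "\<dots> = (\<Prod>p\<in>?P. if p < P0 then K else 1) * (\<Prod>p\<in>?P. real p powr (real (multiplicity p N) * \<delta>))"
      by (simp add: prod.distrib)
    also have "(\<Prod>p\<in>?P. if p < P0 then K else 1) = K ^ card (?P \<inter> {p. p < P0})"
      by (simp add: prod.If_cases)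
    also have "(\<Prod>p\<in>?P. real p powr (real (multiplicity p N) * \<delta>)) = (\<Prod>p\<in>?P. real (p ^ multiplicity p N)) powr \<delta>"
      unfolding prod_powr_distrib[symmetric]
    proof -
      have "real p powr (real (multiplicity p N) * \<delta>) = real (p ^ multiplicity p N) powr \<delta>" if "p \<in> ?P" for p
        using p2[OF that] by (simp add: powr_powr[symmetric] powr_realpow)
      then have "(\<Prod>p\<in>?P. real p powr (real (multiplicity p N) * \<delta>)) = (\<Prod>p\<in>?P. real (p ^ multiplicity p N) powr \<delta>)"
        by (intro prod.cong) auto
      also have "\<dots> = (\<Prod>p\<in>?P. real (p ^ multiplicity p N)) powr \<delta>"
        by (rule prod_powr_distrib[symmetric])
      finally show "(\<Prod>p\<in>?P. real p powr (real (multiplicity p N) * \<delta>)) = (\<Prod>p\<in>?P. real (p ^ multiplicity p N)) powr \<delta>" .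
    qed
    also have "(\<Prod>p\<in>?P. real (p ^ multiplicity p N)) = real N"
      unfolding of_nat_prod[symmetric] using prime_factorization_nat[OF N] by simp
    also have "K ^ card (?P \<inter> {p. p < P0}) * real N powr \<delta> \<le> K ^ P0 * real N powr \<delta>"
    proof (intro mult_right_mono power_increasing)
      have "card (?P \<inter> {p. p < P0}) \<le> card {..<P0}" by (intro card_mono) auto
      then show "card (?P \<inter> {p. p < P0}) \<le> P0" by simp
    qed (use K in auto)
    finally show ?thesis .
  qed
  moreover have "K ^ P0 > 0" using K by simp
  ultimately show ?thesis using that by blast
qed

text \<open>With g = gcd(h, N), two solutions differ by a multiple of N/g, so each of the g blocks
  of N/g consecutive numbers contains at most one.\<close>

lemma card_linear_congruence_le:
  fixes h c :: int and N :: nat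
  assumes "N > 0"
  shows "card {z \<in> {1..N}. int N dvd h * int z + c} \<le> nat (gcd h (int N))"
proof (cases "{z \<in> {1..N}. int N dvd h * int z + c} = {}")
  case False
  define g where "g = gcd h (int N)"
  have g: "g > 0" using assms by (simp add: g_def)
  obtain M where M: "int N = g * M" using gcd_dvd2[of h "int N"] unfolding g_def by (elim dvdE)
  obtain h' where h': "h = g * h'" using gcd_dvd1[of h "int N"] unfolding g_def by (elim dvdE)
  have "0 < g * M" using assms by (simp flip: M)
  then have M0: "M > 0" using g by (simp add: zero_less_mult_iff)
  have cop: "coprime M h'"
  proof -
    have "g = gcd (g * h') (g * M)" unfolding h'[symmetric] M[symmetric] by (rule g_def)
    also have "\<dots> = g * gcd h' M" using g by (simp add: gcd_mult_left abs_mult)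
    finally have "g * gcd h' M = g" by simp
    then have "gcd h' M = 1" using g by simp
    then show ?thesis by (simp add: coprime_iff_gcd_eq_1 gcd.commute)
  qed
  let ?A = "{z \<in> {1..N}. int N dvd h * int z + c}"
  \<comment> \<open>The index of the block containing z; the shift by 1 makes {1..N} consist of
    exactly g blocks of length M.\<close>
  let ?f = "\<lambda>z. nat ((int z - 1) div M)"
  have "inj_on ?f ?A"
  proof (rule inj_onI)
    fix x y assume xy: "x \<in> ?A" "y \<in> ?A" "?f x = ?f y"
    have "int N dvd (h * int x + c) - (h * int y + c)" using xy by (intro dvd_diff) auto
    then have "g * M dvd g * (h' * (int x - int y))" using M h' by (simp add: algebra_simps)
    then have "M dvd h' * (int x - int y)" using g by simp
    then have "M dvd (int x - 1) - (int y - 1)" using cop coprime_dvd_mult_right_iff by auto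
    then have "(int x - 1) mod M = (int y - 1) mod M" by (simp add: mod_eq_dvd_iff)
    moreover have "(int x - 1) div M = (int y - 1) div M"
      using xy M0 by (auto simp: nat_eq_iff2 pos_imp_zdiv_nonneg_iff split: if_splits)
    ultimately have "int x - 1 = int y - 1" by (metis div_mult_mod_eq)
    then show "x = y" by simp
  qed
  moreover have "?f ` ?A \<subseteq> {..<nat g}"
  proof
    fix q assume "q \<in> ?f ` ?A"
    then obtain z where z: "z \<in> ?A" "q = ?f z" by auto
    then have "int z - 1 < g * M" using M by auto
    moreover have "M * ((int z - 1) div M) \<le> int z - 1"
      using mult_div_mod_eq[of M "int z - 1"] pos_mod_sign[OF M0, of "int z - 1"] by linarith
    ultimately have "M * ((int z - 1) div M) < M * g" by (simp add: mult.commute)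
    then have "(int z - 1) div M < g" using M0 by (simp add: mult_less_cancel_left_pos)
    then show "q \<in> {..<nat g}" using z g by auto
  qed
  ultimately have "card ?A \<le> card {..<nat g}" by (intro card_inj_on_le) auto
  then show ?thesis by (simp add: g_def)
next
  case True
  show ?thesis unfolding True by simp
qed

lemma finite_unit_residues: "finite (unit_residues N)"
  by (simp add: unit_residues_def)

lemma card_unit_residues: "N > 0 \<Longrightarrow> card (unit_residues N) = totient N"
proof -
  assume "N > 0"
  then have "unit_residues N = totatives N"
    by (auto simp: unit_residues_def totatives_def)
  then show ?thesis by (simp add: totient_def)
qed

abbreviation generators :: "nat \<Rightarrow> (nat ^ 'n::finite) set" where
  "generators N \<equiv> {Z. \<forall>j. Z $ j \<in> unit_residues N}"

lemma finite_generators: "finite (generators N :: (nat ^ 'n::finite) set)"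
proof -
  have "generators N \<subseteq> vec_lambda ` (Pi\<^sub>E UNIV (\<lambda>_. unit_residues N) :: ('n \<Rightarrow> nat) set)"
  proof
    fix Z :: "nat ^ 'n" assume "Z \<in> generators N"
    then show "Z \<in> vec_lambda ` (Pi\<^sub>E UNIV (\<lambda>_. unit_residues N) :: ('n \<Rightarrow> nat) set)"
      by (intro image_eqI[of _ _ "($) Z"]) auto
  qed
  then show ?thesis by (rule finite_subset) (intro finite_imageI finite_PiE finite_unit_residues finite)
qed

lemma one_in_unit_residues: "N > 0 \<Longrightarrow> 1 \<in> unit_residues N"
  by (simp add: unit_residues_def)

lemma generators_nonempty: "N > 0 \<Longrightarrow> (generators N :: (nat ^ 'n::finite) set) \<noteq> {}"
  using one_in_unit_residues by (auto intro!: exI[of _ "\<chi> j. 1"])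

definition upd :: "nat ^ 'n \<Rightarrow> 'n \<Rightarrow> nat \<Rightarrow> nat ^ 'n" where
  "upd Z i a = (\<chi> j. if j = i then a else Z $ j)"

lemma upd_nth: "upd Z i a $ j = (if j = i then a else Z $ j)"
  by (simp add: upd_def)

lemma upd_upd: "upd (upd Z i a) i b = upd Z i b" "upd Z i (Z $ i) = Z"
  by (simp_all add: vec_eq_iff upd_nth)

text \<open>Resampling the \<open>i\<close>-th coordinate of \<open>Z\<close> preserves the uniform distribution, so it suffices to
  count solutions of a congruence in that coordinate.\<close>

lemma card_dual_lattice_le:
  fixes h :: "'n::finite \<Rightarrow> int"
  assumes "N > 0" "i \<in> w"
  shows "card {Z \<in> generators N. int N dvd (\<Sum>j\<in>w. h j * int (Z $ j))} * totient N \<le>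
     card (generators N :: (nat ^ 'n) set) * nat (gcd (h i) (int N))"
proof -
  let ?G = "unit_residues N" and ?GG = "generators N :: (nat ^ 'n) set"
  define f :: "nat ^ 'n \<Rightarrow> nat" where "f Z = (if int N dvd (\<Sum>j\<in>w. h j * int (Z $ j)) then 1 else 0)" for Z
  have "card {Z \<in> ?GG. int N dvd (\<Sum>j\<in>w. h j * int (Z $ j))} * totient N = (\<Sum>Z\<in>?GG. \<Sum>a\<in>?G. f Z)"
    using assms finite_generators[of N, where 'n = 'n]
    by (simp add: f_def card_unit_residues sum.If_cases Int_def flip: sum_distrib_left)
  also have "\<dots> = (\<Sum>x\<in>?GG \<times> ?G. f (fst x))"
    unfolding sum.cartesian_product by (simp add: split_beta')
  \<comment> \<open>Exchanging the i-th component of Z with the extra residue a is an involution on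
    the pairs (Z, a).\<close>
  also have "\<dots> = (\<Sum>x\<in>?GG \<times> ?G. f (upd (fst x) i (snd x)))"
    by (rule sum.reindex_bij_witness[of _ "\<lambda>x. (upd (fst x) i (snd x), fst x $ i)" "\<lambda>x. (upd (fst x) i (snd x), fst x $ i)"])
       (auto simp: upd_upd upd_nth)
  also have "\<dots> = (\<Sum>Z\<in>?GG. \<Sum>a\<in>?G. f (upd Z i a))"
    unfolding sum.cartesian_product by (simp add: split_beta')
  also have "\<dots> \<le> (\<Sum>Z\<in>?GG. nat (gcd (h i) (int N)))"
  proof (rule sum_mono)
    fix Z assume "Z \<in> ?GG"
    define c where "c = (\<Sum>j\<in>w-{i}. h j * int (Z $ j))"
    have "(\<Sum>j\<in>w. h j * int (upd Z i a $ j)) = h i * int a + c" for a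
      using assms(2) by (subst sum.remove[of _ i]) (auto simp: upd_nth c_def intro!: sum.cong)
    then have "(\<Sum>a\<in>?G. f (upd Z i a)) = card {a \<in> ?G. int N dvd h i * int a + c}"
      by (simp add: f_def sum.If_cases finite_unit_residues Int_def)
    also have "\<dots> \<le> card {a \<in> {1..N}. int N dvd h i * int a + c}"
      by (intro card_mono) (auto simp: unit_residues_def)
    also have "\<dots> \<le> nat (gcd (h i) (int N))" by (rule card_linear_congruence_le[OF assms(1)])
    finally show "(\<Sum>a\<in>?G. f (upd Z i a)) \<le> nat (gcd (h i) (int N))" .
  qed
  also have "\<dots> = card ?GG * nat (gcd (h i) (int N))" by simp
  finally show ?thesis .
qed

subsection \<open>Sums over nonzero integer frequencies\<close>

abbreviation freqs :: "'n set \<Rightarrow> ('n \<Rightarrow> int) set" where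
  "freqs w \<equiv> Pi\<^sub>E w (\<lambda>_. - {0})"

lemma countable_freqs: "finite w \<Longrightarrow> countable (freqs w)"
  by (intro countable_PiE) auto

interpretation freq_prod: product_sigma_finite "\<lambda>_::'n. count_space (- {0 :: int})"
  by (intro product_sigma_finite.intro sigma_finite_measure_count_space_countable) auto

text \<open>Multiple series over nonzero frequencies are treated as integrals for a product measure,
  so that sums of products factor and sums and integrals can be exchanged by Fubini's
  theorem.\<close>

lemma count_space_freqs:
  assumes "finite w"
  shows "count_space (freqs w) = Pi\<^sub>M w (\<lambda>_. count_space (- {0}))"
proof (rule measure_eqI_countable'[where A = "freqs w"])
  have singleton: "{x} = Pi\<^sub>E w (\<lambda>i. {x i})" if "x \<in> freqs w" for x
    using that by (intro PiE_singleton[symmetric]) (simp add: PiE_iff)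
  fix x assume x: "x \<in> freqs w"
  show "{x} \<in> sets (Pi\<^sub>M w (\<lambda>_. count_space (- {0})))"
    unfolding singleton[OF x] using assms x by (intro sets_PiM_I_finite) auto
  have "emeasure (Pi\<^sub>M w (\<lambda>_. count_space (- {0}))) {x} = (\<Prod>i\<in>w. emeasure (count_space (- {0})) {x i})"
    by (subst singleton[OF x], subst freq_prod.emeasure_PiM) (use assms x in auto)
  also have "\<dots> = 1"
    using x by (intro prod.neutral ballI) (auto simp: emeasure_count_space_finite PiE_iff)
  finally show "emeasure (count_space (freqs w)) {x} = emeasure (Pi\<^sub>M w (\<lambda>_. count_space (- {0}))) {x}"
    using x by (simp add: emeasure_count_space_finite)
qed (use assms in \<open>auto simp: space_PiM countable_freqs\<close>)

lemma
  fixes f :: "int \<Rightarrow> 'a :: {banach, second_countable_topology}"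
  assumes "summable (\<lambda>n. norm (f (int (Suc n))))" "summable (\<lambda>n. norm (f (- int (Suc n))))"
  shows integrable_nonzero_ints: "integrable (count_space (- {0})) f"
    and integral_nonzero_ints: "(\<integral>h. f h \<partial>count_space (- {0})) = (\<Sum>n. f (int (Suc n)) + f (- int (Suc n)))"
proof -
  have bij: "bij_betw (\<lambda>n. int (Suc n)) UNIV {0<..}" "bij_betw (\<lambda>n. - int (Suc n)) UNIV {..<0}"
    by (rule bij_betw_byWitness[where f' = "\<lambda>h. nat (h - 1)"], auto)
       (rule bij_betw_byWitness[where f' = "\<lambda>h. nat (- h - 1)"], auto)
  have eq: "- {0} = {0<..} \<union> {..<(0::int)}" by auto
  have 1: "Infinite_Set_Sum.abs_summable_on f {0<..}" "Infinite_Set_Sum.abs_summable_on f {..<0}"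
    using assms by (simp_all add: abs_summable_on_reindex_bij_betw[OF bij(1), symmetric]
      abs_summable_on_reindex_bij_betw[OF bij(2), symmetric] abs_summable_on_nat_iff' del: of_nat_Suc)
  then have "Infinite_Set_Sum.abs_summable_on f (- {0})" unfolding eq by (rule Infinite_Set_Sum.abs_summable_on_union)
  then show "integrable (count_space (- {0})) f" by (simp add: Infinite_Set_Sum.abs_summable_on_def)
  have "(\<integral>h. f h \<partial>count_space (- {0})) = infsetsum f ({0<..} \<union> {..<0})"
    by (simp add: infsetsum_def eq)
  also have "\<dots> = infsetsum f {0<..} + infsetsum f {..<0}"
    by (rule infsetsum_Un_disjoint[OF 1]) auto
  also have "infsetsum f {0<..} = (\<Sum>n. f (int (Suc n)))"
    unfolding infsetsum_reindex_bij_betw[OF bij(1), symmetric]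
    by (rule infsetsum_nat') (use assms in \<open>simp add: abs_summable_on_nat_iff' del: of_nat_Suc\<close>)
  also have "infsetsum f {..<0} = (\<Sum>n. f (- int (Suc n)))"
    unfolding infsetsum_reindex_bij_betw[OF bij(2), symmetric]
    by (rule infsetsum_nat') (use assms in \<open>simp add: abs_summable_on_nat_iff' del: of_nat_Suc\<close>)
  finally show "(\<integral>h. f h \<partial>count_space (- {0})) = (\<Sum>n. f (int (Suc n)) + f (- int (Suc n)))"
    by (subst suminf_add[symmetric]) (use assms in \<open>auto intro: summable_norm_cancel simp del: of_nat_Suc\<close>)
qed

lemma integrable_powr_nonzero_ints:
  assumes "\<alpha> > 1"
  shows "integrable (count_space (- {0})) (\<lambda>h. \<bar>real_of_int h\<bar> powr (- \<alpha>))"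
proof (rule integrable_nonzero_ints)
  have "summable (\<lambda>n. real n powr (- \<alpha>))" using assms by (simp add: summable_real_powr_iff)
  then have "summable (\<lambda>n. real (Suc n) powr (- \<alpha>))" by (subst summable_Suc_iff)
  then show "summable (\<lambda>n. norm (\<bar>real_of_int (int (Suc n))\<bar> powr (- \<alpha>)))"
    "summable (\<lambda>n. norm (\<bar>real_of_int (- int (Suc n))\<bar> powr (- \<alpha>)))"
    by (simp_all del: of_nat_Suc)
qed

definition zeta_sum :: "real \<Rightarrow> ennreal" where
  "zeta_sum \<alpha> = (\<integral>\<^sup>+h. ennreal (\<bar>real_of_int h\<bar> powr (- \<alpha>)) \<partial>count_space (- {0}))"

lemma zeta_sum_finite: "\<alpha> > 1 \<Longrightarrow> zeta_sum \<alpha> < \<infinity>"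
  using integrable_powr_nonzero_ints[of \<alpha>] by (simp add: zeta_sum_def integrable_iff_bounded)

text \<open>The gcd is itself one of the divisors d of N that divide h, so it is at most the sum of
  all of them. Writing h = d k, each d contributes d^(1-\<alpha>) \<le> 1 times the zeta sum; what
  remains is the number of divisors of N.\<close>

lemma gcd_sum_le:
  assumes "\<alpha> > 1" "N > 0"
  shows "(\<integral>\<^sup>+h. ennreal (\<bar>real_of_int h\<bar> powr (- \<alpha>) * real (nat (gcd h (int N)))) \<partial>count_space (- {0})) \<le>
    ennreal (divisor_bound N) * zeta_sum \<alpha>"
proof -
  let ?D = "{d. d dvd N}"
  have fin: "finite ?D" using assms by simp
  have "(\<integral>\<^sup>+h. ennreal (\<bar>real_of_int h\<bar> powr (- \<alpha>) * real (nat (gcd h (int N)))) \<partial>count_space (- {0})) \<le>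
     (\<integral>\<^sup>+h. (\<Sum>d\<in>?D. ennreal (\<bar>real_of_int h\<bar> powr (- \<alpha>) * real d) * indicator {h. int d dvd h} h) \<partial>count_space (- {0}))"
  proof (rule nn_integral_mono)
    fix h :: int
    let ?g = "nat (gcd h (int N))"
    have "?g \<in> ?D" by (simp add: nat_dvd_iff)
    moreover have "int ?g dvd h" by simp
    ultimately have "ennreal (\<bar>real_of_int h\<bar> powr (- \<alpha>) * real ?g) =
       ennreal (\<bar>real_of_int h\<bar> powr (- \<alpha>) * real ?g) * indicator {h. int ?g dvd h} h" by simp
    also have "\<dots> \<le> (\<Sum>d\<in>?D. ennreal (\<bar>real_of_int h\<bar> powr (- \<alpha>) * real d) * indicator {h. int d dvd h} h)"
      by (rule member_le_sum[of _ _ "\<lambda>d. ennreal (\<bar>real_of_int h\<bar> powr (- \<alpha>) * real d) * indicator {h. int d dvd h} h"])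
         (use \<open>?g \<in> ?D\<close> fin in auto)
    finally show "ennreal (\<bar>real_of_int h\<bar> powr (- \<alpha>) * real ?g) \<le>
      (\<Sum>d\<in>?D. ennreal (\<bar>real_of_int h\<bar> powr (- \<alpha>) * real d) * indicator {h. int d dvd h} h)" .
  qed
  also have "\<dots> = (\<Sum>d\<in>?D. \<integral>\<^sup>+h. ennreal (\<bar>real_of_int h\<bar> powr (- \<alpha>) * real d) * indicator {h. int d dvd h} h \<partial>count_space (- {0}))"
    by (rule nn_integral_sum) simp
  also have "\<dots> \<le> (\<Sum>d\<in>?D. zeta_sum \<alpha>)"
  proof (rule sum_mono)
    fix d assume "d \<in> ?D"
    then have d: "d > 0" using assms by (auto intro: Nat.gr0I)
    have "(\<integral>\<^sup>+h. ennreal (\<bar>real_of_int h\<bar> powr (- \<alpha>) * real d) * indicator {h. int d dvd h} h \<partial>count_space (- {0})) =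
       (\<integral>\<^sup>+h. ennreal (\<bar>real_of_int h\<bar> powr (- \<alpha>) * real d) \<partial>count_space ({h. int d dvd h} \<inter> - {0}))"
      by (subst (1 2) nn_integral_count_space_indicator) (auto intro!: nn_integral_cong simp: indicator_def)
    also have "\<dots> = (\<integral>\<^sup>+k. ennreal (\<bar>real_of_int (int d * k)\<bar> powr (- \<alpha>) * real d) \<partial>count_space (- {0}))"
      by (rule nn_integral_bij_count_space[symmetric],
          rule bij_betw_byWitness[where f' = "\<lambda>h. h div int d"]) (use d in auto)
    also have "\<dots> \<le> zeta_sum \<alpha>"
      unfolding zeta_sum_def
    proof (intro nn_integral_mono ennreal_leI)
      fix k :: int
      have "\<bar>real_of_int (int d * k)\<bar> powr (- \<alpha>) * real d = (real d powr (- \<alpha>) * real d powr 1) * \<bar>real_of_int k\<bar> powr (- \<alpha>)"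
        using d by (simp add: abs_mult powr_mult)
      also have "real d powr (- \<alpha>) * real d powr 1 = real d powr (1 - \<alpha>)"
        by (simp only: powr_add[symmetric]) (simp add: algebra_simps)
      also have "real d powr (1 - \<alpha>) \<le> real d powr 0" using d assms by (intro powr_mono) auto
      finally show "\<bar>real_of_int (int d * k)\<bar> powr (- \<alpha>) * real d \<le> \<bar>real_of_int k\<bar> powr (- \<alpha>)"
        using d by (simp add: mult_left_le_one_le mult_right_mono)
    qed
    finally show "(\<integral>\<^sup>+h. ennreal (\<bar>real_of_int h\<bar> powr (- \<alpha>) * real d) * indicator {h. int d dvd h} h \<partial>count_space (- {0})) \<le> zeta_sum \<alpha>" .
  qed
  also have "\<dots> = ennreal (real (card ?D)) * zeta_sum \<alpha>" by (simp add: ennreal_of_nat_eq_real_of_nat)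
  also have "\<dots> \<le> ennreal (divisor_bound N) * zeta_sum \<alpha>"
    by (intro mult_right_mono ennreal_leI card_divisors_le_divisor_bound assms) simp
  finally show ?thesis .
qed

text \<open>The part with support exactly w of the classical figure of merit P_\<alpha> of the
  lattice generated by Z; summing over nonempty w runs through the dual lattice without 0.\<close>

definition dual_sum :: "nat \<Rightarrow> 'n::finite set \<Rightarrow> real \<Rightarrow> nat ^ 'n \<Rightarrow> ennreal" where
  "dual_sum N w \<alpha> Z = (\<integral>\<^sup>+h. ennreal (\<Prod>j\<in>w. \<bar>real_of_int (h j)\<bar> powr (- \<alpha>)) *
      indicator {h. int N dvd (\<Sum>j\<in>w. h j * int (Z $ j))} h \<partial>count_space (freqs w))"

lemma sum_dual_sum_le:
  fixes w :: "'n::finite set"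
  assumes \<alpha>: "\<alpha> > 1" and N: "N > 0" and i: "i \<in> w"
  shows "(\<Sum>Z\<in>generators N. dual_sum N w \<alpha> Z) * ennreal (real (totient N)) \<le>
    ennreal (real (card (generators N :: (nat ^ 'n) set))) * (ennreal (divisor_bound N) * zeta_sum \<alpha> ^ card w)"
proof -
  let ?GG = "generators N :: (nat ^ 'n) set"
  let ?W = "\<lambda>h. \<Prod>j\<in>w. \<bar>real_of_int (h j)\<bar> powr (- \<alpha>)"
  let ?C = "\<lambda>h. card {Z \<in> ?GG. int N dvd (\<Sum>j\<in>w. h j * int (Z $ j))}"
  have "(\<Sum>Z\<in>?GG. dual_sum N w \<alpha> Z) = (\<integral>\<^sup>+h. (\<Sum>Z\<in>?GG. ennreal (?W h) *
      indicator {h. int N dvd (\<Sum>j\<in>w. h j * int (Z $ j))} h) \<partial>count_space (freqs w))"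
    unfolding dual_sum_def by (rule nn_integral_sum[symmetric]) simp
  also have "\<dots> = (\<integral>\<^sup>+h. ennreal (?W h * real (?C h)) \<partial>count_space (freqs w))"
  proof (intro nn_integral_cong)
    fix h :: "'n \<Rightarrow> int"
    have "(\<Sum>Z\<in>?GG. ennreal (?W h) * indicator {h. int N dvd (\<Sum>j\<in>w. h j * int (Z $ j))} h) =
       ennreal (?W h) * (\<Sum>Z\<in>?GG. indicator {Z. int N dvd (\<Sum>j\<in>w. h j * int (Z $ j))} Z)"
      by (simp add: sum_distrib_left indicator_def)
    also have "(\<Sum>Z\<in>?GG. indicator {Z. int N dvd (\<Sum>j\<in>w. h j * int (Z $ j))} Z :: ennreal) = of_nat (?C h)"
      using finite_generators[of N, where 'n = 'n] by (simp add: sum.If_cases indicator_def Int_def)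
    finally show "(\<Sum>Z\<in>?GG. ennreal (?W h) * indicator {h. int N dvd (\<Sum>j\<in>w. h j * int (Z $ j))} h) = ennreal (?W h * real (?C h))"
      by (simp add: ennreal_mult prod_nonneg ennreal_of_nat_eq_real_of_nat)
  qed
  finally have "(\<Sum>Z\<in>?GG. dual_sum N w \<alpha> Z) * ennreal (real (totient N)) =
     (\<integral>\<^sup>+h. ennreal (?W h * real (?C h)) * ennreal (real (totient N)) \<partial>count_space (freqs w))"
    by (simp add: nn_integral_multc)
  also have "\<dots> \<le> (\<integral>\<^sup>+h. ennreal (real (card ?GG)) * (\<Prod>j\<in>w. ennreal (\<bar>real_of_int (h j)\<bar> powr (- \<alpha>) *
      (if j = i then real (nat (gcd (h j) (int N))) else 1))) \<partial>count_space (freqs w))"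
  proof (intro nn_integral_mono)
    fix h :: "'n \<Rightarrow> int"
    have W: "?W h \<ge> 0" by (simp add: prod_nonneg)
    have "real (?C h * totient N) \<le> real (card ?GG * nat (gcd (h i) (int N)))"
      using card_dual_lattice_le[OF N i, of h] by (simp only: of_nat_le_iff)
    then have "?W h * (real (?C h) * real (totient N)) \<le> ?W h * (real (card ?GG) * real (nat (gcd (h i) (int N))))"
      using W by (intro mult_left_mono) simp_all
    also have "\<dots> = real (card ?GG) * (\<Prod>j\<in>w. \<bar>real_of_int (h j)\<bar> powr (- \<alpha>) * (if j = i then real (nat (gcd (h j) (int N))) else 1))"
      using i by (simp add: prod.distrib prod.delta)
    finally show "ennreal (?W h * real (?C h)) * ennreal (real (totient N)) \<le>
      ennreal (real (card ?GG)) * (\<Prod>j\<in>w. ennreal (\<bar>real_of_int (h j)\<bar> powr (- \<alpha>) * (if j = i then real (nat (gcd (h j) (int N))) else 1)))"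
      using W by (subst prod_ennreal) (auto simp: ennreal_mult[symmetric] prod_nonneg mult.assoc intro!: ennreal_leI)
  qed
  also have "\<dots> = ennreal (real (card ?GG)) * (\<integral>\<^sup>+h. (\<Prod>j\<in>w. ennreal (\<bar>real_of_int (h j)\<bar> powr (- \<alpha>) *
      (if j = i then real (nat (gcd (h j) (int N))) else 1))) \<partial>count_space (freqs w))"
    by (rule nn_integral_cmult) simp
  also have "(\<integral>\<^sup>+h. (\<Prod>j\<in>w. ennreal (\<bar>real_of_int (h j)\<bar> powr (- \<alpha>) *
      (if j = i then real (nat (gcd (h j) (int N))) else 1))) \<partial>count_space (freqs w)) =
     (\<Prod>j\<in>w. \<integral>\<^sup>+h. ennreal (\<bar>real_of_int h\<bar> powr (- \<alpha>) * (if j = i then real (nat (gcd h (int N))) else 1)) \<partial>count_space (- {0}))"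
    unfolding count_space_freqs[OF finite] by (rule freq_prod.product_nn_integral_prod) auto
  also have "\<dots> = (\<integral>\<^sup>+h. ennreal (\<bar>real_of_int h\<bar> powr (- \<alpha>) * real (nat (gcd h (int N)))) \<partial>count_space (- {0})) *
      zeta_sum \<alpha> ^ (card w - 1)"
    using i by (subst prod.remove[of _ i]) (auto simp: zeta_sum_def)
  also have "\<dots> \<le> (ennreal (divisor_bound N) * zeta_sum \<alpha>) * zeta_sum \<alpha> ^ (card w - 1)"
    by (intro mult_right_mono gcd_sum_le[OF \<alpha> N]) simp
  also have "\<dots> = ennreal (divisor_bound N) * zeta_sum \<alpha> ^ card w"
  proof -
    obtain n where "card w = Suc n" using i by (cases "card w") auto
    then show ?thesis by (simp add: mult.assoc)
  qed
  finally show ?thesis by (simp add: mult_left_mono)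
qed

text \<open>Two factors \<open>divisor_bound N\<close> arise, one from N / \<open>totient N\<close>
  and one from the sum of the gcds; each is bounded with exponent
  \<open>\<delta> / 2\<close>.\<close>

theorem average_dual_sum:
  assumes \<alpha>: "\<alpha> > 1" and \<delta>: "\<delta> > 0"
  obtains C where "C > 0" "\<And>N (w :: 'n::finite set). N > 0 \<Longrightarrow> w \<noteq> {} \<Longrightarrow>
    (\<Sum>Z\<in>generators N. dual_sum N w \<alpha> Z) \<le>
      ennreal (C * real N powr (\<delta> - 1) * real (card (generators N :: (nat ^ 'n) set)))"
proof -
  obtain K where K: "K > 0" "\<And>N. N > 0 \<Longrightarrow> divisor_bound N \<le> K * real N powr (\<delta> / 2)"
    using divisor_bound_subpolynomial[of "\<delta> / 2"] \<delta> by auto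
  define z where "z = max 1 (enn2real (zeta_sum \<alpha>))"
  have "zeta_sum \<alpha> = ennreal (enn2real (zeta_sum \<alpha>))" using zeta_sum_finite[OF \<alpha>] by simp
  also have "\<dots> \<le> ennreal z" by (intro ennreal_leI) (simp add: z_def)
  finally have z: "z \<ge> 1" "zeta_sum \<alpha> \<le> ennreal z" by (simp_all add: z_def)
  define C where "C = K * K * z ^ CARD('n)"
  have "(\<Sum>Z\<in>generators N. dual_sum N w \<alpha> Z) \<le> ennreal (C * real N powr (\<delta> - 1) * real (card (generators N :: (nat ^ 'n) set)))"
    if N: "N > 0" and w: "w \<noteq> {}" for N and w :: "'n set"
  proof -
    obtain i where i: "i \<in> w" using w by auto
    let ?S = "\<Sum>Z\<in>generators N. dual_sum N w \<alpha> Z" and ?g = "real (card (generators N :: (nat ^ 'n) set))"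
    let ?d = "divisor_bound N"
    have "?S * ennreal (real N) \<le> ?S * ennreal (real (totient N) * ?d)"
      by (intro mult_left_mono ennreal_leI totient_ge N) simp
    also have "\<dots> = (?S * ennreal (real (totient N))) * ennreal ?d"
      by (simp add: ennreal_mult divisor_bound_nonneg mult.assoc)
    also have "\<dots> \<le> (ennreal ?g * (ennreal ?d * zeta_sum \<alpha> ^ card w)) * ennreal ?d"
      by (intro mult_right_mono sum_dual_sum_le[OF \<alpha> N i]) simp
    also have "\<dots> \<le> (ennreal ?g * (ennreal ?d * ennreal z ^ CARD('n))) * ennreal ?d"
    proof (intro mult_right_mono mult_left_mono)
      have "zeta_sum \<alpha> ^ card w \<le> ennreal z ^ card w" by (intro power_mono z) simp
      also have "\<dots> \<le> ennreal z ^ CARD('n)"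
        using z(1) by (intro power_increasing card_mono) (auto intro: order.trans[OF _ ennreal_leI[OF z(1)]])
      finally show "zeta_sum \<alpha> ^ card w \<le> ennreal z ^ CARD('n)" .
    qed simp_all
    also have "\<dots> = ennreal (?g * z ^ CARD('n) * ?d ^ 2)"
      using z(1) by (simp add: ennreal_mult ennreal_power divisor_bound_nonneg power2_eq_square mult_ac)
    also have "\<dots> \<le> ennreal (?g * z ^ CARD('n) * (K * real N powr (\<delta> / 2)) ^ 2)"
      using z(1) by (intro ennreal_leI mult_left_mono power_mono K N divisor_bound_nonneg) auto
    also have "?g * z ^ CARD('n) * (K * real N powr (\<delta> / 2)) ^ 2 = C * real N powr (\<delta> - 1) * ?g * real N"
    proof -
      have "(real N powr (\<delta> / 2)) ^ 2 = real N powr (\<delta> - 1) * real N powr 1"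
        by (simp only: power2_eq_square powr_add[symmetric]) simp
      then show ?thesis using N by (simp add: C_def power_mult_distrib power2_eq_square mult_ac)
    qed
    also have "ennreal (C * real N powr (\<delta> - 1) * ?g * real N) = ennreal (C * real N powr (\<delta> - 1) * ?g) * ennreal (real N)"
      using K z by (intro ennreal_mult) (auto simp: C_def)
    finally have "?S * ennreal (real N) \<le> ennreal (C * real N powr (\<delta> - 1) * ?g) * ennreal (real N)" .
    then show ?thesis
      using N by (subst (asm) (1 2) mult.commute) (simp add: ennreal_mult_le_mult_iff)
  qed
  moreover have "C > 0" using K z by (simp add: C_def)
  ultimately show ?thesis using that by blast
qed

text \<open>Each term a is at most the whole sum, hence at most x, so a^p \<le> x^(p-1) a, and
  summation gives x^p. A bound near exponent 1 is thereby upgraded to the exponent of the smoothness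
  class.\<close>

lemma dual_sum_powr:
  fixes w :: "'n::finite set"
  assumes \<alpha>: "\<alpha> > 0" and p: "p \<ge> 1" and X: "dual_sum N w \<alpha> Z \<le> ennreal x" and x: "x \<ge> 0"
  shows "dual_sum N w (p * \<alpha>) Z \<le> ennreal (x powr p)"
proof -
  let ?I = "{h. int N dvd (\<Sum>j\<in>w. h j * int (Z $ j))}"
  let ?W = "\<lambda>h. \<Prod>j\<in>w. \<bar>real_of_int (h j)\<bar> powr (- \<alpha>)"
  have W: "?W h \<ge> 0" for h by (simp add: prod_nonneg)
  have le: "?W h \<le> x" if h: "h \<in> freqs w" "h \<in> ?I" for h
  proof -
    have "ennreal (?W h) = (\<integral>\<^sup>+h'. ennreal (?W h') * indicator ?I h' * indicator {h} h' \<partial>count_space (freqs w))"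
      using h by (subst nn_integral_indicator_singleton) auto
    also have "\<dots> \<le> dual_sum N w \<alpha> Z"
      unfolding dual_sum_def by (intro nn_integral_mono) (auto simp: indicator_def)
    also have "\<dots> \<le> ennreal x" by (rule X)
    finally show ?thesis using x by (simp add: ennreal_le_iff)
  qed
  have "dual_sum N w (p * \<alpha>) Z \<le> (\<integral>\<^sup>+h. ennreal (x powr (p - 1)) * (ennreal (?W h) * indicator ?I h) \<partial>count_space (freqs w))"
    unfolding dual_sum_def
  proof (rule nn_integral_mono)
    fix h assume "h \<in> space (count_space (freqs w))"
    then have h: "h \<in> freqs w" by simp
    show "ennreal (\<Prod>j\<in>w. \<bar>real_of_int (h j)\<bar> powr (- (p * \<alpha>))) * indicator ?I h \<le>
       ennreal (x powr (p - 1)) * (ennreal (?W h) * indicator ?I h)"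
    proof (cases "h \<in> ?I")
      case True
      have pos: "?W h > 0" using h by (intro prod_pos) (auto simp: PiE_iff)
      have "(\<Prod>j\<in>w. \<bar>real_of_int (h j)\<bar> powr (- (p * \<alpha>))) = ?W h powr p"
        by (simp add: prod_powr_distrib powr_powr mult.commute)
      also have "\<dots> = ?W h powr (p - 1) * ?W h powr 1" by (simp only: powr_add[symmetric]) simp
      also have "\<dots> \<le> x powr (p - 1) * ?W h"
        using le[OF h True] p pos by (simp add: mult_right_mono powr_mono2)
      finally show ?thesis
        using True W by (simp add: ennreal_mult[symmetric] ennreal_leI)
    qed simp
  qed
  also have "\<dots> = ennreal (x powr (p - 1)) * dual_sum N w \<alpha> Z"
    unfolding dual_sum_def by (rule nn_integral_cmult) simp
  also have "\<dots> \<le> ennreal (x powr (p - 1)) * ennreal x" by (intro mult_left_mono X) simp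
  also have "\<dots> = ennreal (x powr p)"
    using x by (cases "x = 0") (auto simp: ennreal_mult[symmetric] powr_diff)
  finally show ?thesis .
qed

section \<open>The mean square error of a shifted lattice rule\<close>

definition jump :: "real \<Rightarrow> real \<Rightarrow> real" where
  "jump v x = indicator {v..} (frac x) - (1 - v)"

definition jump_coeff :: "real \<Rightarrow> int \<Rightarrow> real" where
  "jump_coeff v h = (sin (pi * real_of_int h * v))\<^sup>2 / (pi\<^sup>2 * (real_of_int h)\<^sup>2)"

lemma jump_measurable [measurable]:
  assumes [measurable]: "f \<in> borel_measurable M" "g \<in> borel_measurable M"
  shows "(\<lambda>x. jump (f x) (g x)) \<in> borel_measurable M"
  unfolding jump_def atLeast_def indicator_def by measurable

lemma jump_coeff_nonneg: "jump_coeff v h \<ge> 0"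
  by (simp add: jump_coeff_def)

lemma abs_jump_le_1: "0 < v \<Longrightarrow> v < 1 \<Longrightarrow> \<bar>jump v x\<bar> \<le> 1"
  by (auto simp: jump_def indicator_def)

text \<open>The cosine series is rewritten in characters over the nonzero integers, which halves the
  coefficients. Unlike cosines, characters in different coordinates multiply to a single
  character.\<close>

lemma
  assumes v: "0 < v" "v < 1"
  shows jump_series_integrable: "integrable (count_space (- {0})) (\<lambda>h. complex_of_real (jump_coeff v h) * cis (2 * pi * real_of_int h * d))"
    and jump_series: "complex_of_real (\<integral>x. jump v (x + a) * jump v (x + b) * indicator {0..1} x \<partial>lborel) =
      (\<integral>h. complex_of_real (jump_coeff v h) * cis (2 * pi * real_of_int h * (a - b)) \<partial>count_space (- {0}))"
proof -
  let ?f = "\<lambda>d h. complex_of_real (jump_coeff v h) * cis (2 * pi * real_of_int h * d)"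
  have norm: "norm (?f d h) = jump_coeff v h" for d h
    by (simp add: norm_mult jump_coeff_nonneg)
  have sym: "jump_coeff v (- h) = jump_coeff v h" for h by (simp add: jump_coeff_def)
  have S: "summable (\<lambda>n. jump_coeff v (int (Suc n)))"
  proof (rule summable_comparison_test')
    show "summable (\<lambda>n. 1 / pi\<^sup>2 * (1 / (real (Suc n))\<^sup>2))"
      using inverse_squares_sums by (intro summable_mult) (simp add: sums_iff add.commute)
    show "norm (jump_coeff v (int (Suc n))) \<le> 1 / pi\<^sup>2 * (1 / (real (Suc n))\<^sup>2)" for n
      unfolding jump_coeff_def
      by (simp add: abs_square_le_1 divide_right_mono power_le_one_iff del: of_nat_Suc)
  qed
  have sums: "summable (\<lambda>n. norm (?f d (int (Suc n))))" "summable (\<lambda>n. norm (?f d (- int (Suc n))))" for d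
    unfolding norm using S by (simp_all only: sym)
  show "integrable (count_space (- {0})) (?f d)" by (rule integrable_nonzero_ints[OF sums])
  have "(\<integral>h. ?f (a - b) h \<partial>count_space (- {0})) = (\<Sum>n. ?f (a - b) (int (Suc n)) + ?f (a - b) (- int (Suc n)))"
    by (rule integral_nonzero_ints[OF sums])
  also have "\<dots> = (\<Sum>n. complex_of_real (2 * (sin (pi * real (Suc n) * v))\<^sup>2 / (pi * real (Suc n))\<^sup>2 * cos (2 * pi * real (Suc n) * (a - b))))"
  proof (intro suminf_cong)
    fix n
    let ?s = "2 * pi * real (Suc n) * (a - b)"
    have "?f (a - b) (int (Suc n)) + ?f (a - b) (- int (Suc n)) = complex_of_real (jump_coeff v (int (Suc n))) * (cis ?s + cis (- ?s))"
      by (simp add: sym distrib_left del: of_nat_Suc)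
    also have "cis ?s + cis (- ?s) = complex_of_real (2 * cos ?s)" by (simp add: complex_eq_iff)
    finally show "?f (a - b) (int (Suc n)) + ?f (a - b) (- int (Suc n)) =
      complex_of_real (2 * (sin (pi * real (Suc n) * v))\<^sup>2 / (pi * real (Suc n))\<^sup>2 * cos ?s)"
      by (simp add: jump_coeff_def power_mult_distrib del: of_nat_Suc)
  qed
  also have "\<dots> = complex_of_real (\<integral>x. jump v (x + a) * jump v (x + b) * indicator {0..1} x \<partial>lborel)"
    using jump_correlation[OF v, of a b]
    unfolding jump_def by (intro sums_unique[symmetric] sums_of_real)
  finally show "complex_of_real (\<integral>x. jump v (x + a) * jump v (x + b) * indicator {0..1} x \<partial>lborel) =
      (\<integral>h. ?f (a - b) h \<partial>count_space (- {0}))" by simp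
qed

section \<open>Character sums and the mean square over the shift\<close>

lemma character_sum:
  assumes "N > 0"
  shows "(\<Sum>n=1..N. cis (2 * pi * real n * real_of_int m / real N)) = (if int N dvd m then of_nat N else 0)"
proof -
  define z where "z = cis (2 * pi * real_of_int m / real N)"
  have cis_z: "cis (2 * pi * real n * real_of_int m / real N) = z ^ n" for n
    by (simp add: z_def Complex.DeMoivre mult_ac)
  have "z ^ N = cis (2 * pi * real_of_int m)"
    using assms by (simp add: z_def Complex.DeMoivre)
  then have zN: "z ^ N = 1" by (simp add: cis_multiple_2pi)
  have z1: "z = 1 \<longleftrightarrow> int N dvd m"
  proof
    assume "z = 1"
    then have "cos (2 * pi * real_of_int m / real N) = 1" by (simp add: z_def complex_eq_iff)
    then obtain q :: int where "2 * pi * real_of_int m / real N = real_of_int q * 2 * pi"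
      by (auto simp: cos_one_2pi_int)
    then have "real_of_int m = real_of_int (q * int N)" using assms by (simp add: field_simps)
    then have "m = q * int N" by (simp only: of_int_eq_iff)
    then show "int N dvd m" by simp
  next
    assume "int N dvd m"
    then obtain q where "m = int N * q" by (elim dvdE)
    then have "2 * pi * real_of_int m / real N = 2 * pi * real_of_int q" using assms by simp
    then show "z = 1" unfolding z_def by (simp only: cis_multiple_2pi Ints_of_int)
  qed
  \<comment> \<open>The nodes are numbered from 1 to N, which costs one factor z against the
    geometric sum from 0.\<close>
  have "(\<Sum>n=1..N. z ^ n) = z * (\<Sum>n<N. z ^ n)"
    by (simp add: sum_distrib_left sum.atLeast1_atMost_eq)
  also have "\<dots> = (if int N dvd m then of_nat N else 0)"
    using zN z1 by (auto simp: geometric_sum)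
  finally show ?thesis by (simp add: cis_z)
qed

lemma character_double_sum:
  assumes "N > 0"
  shows "(\<Sum>n=1..N. \<Sum>n'=1..N. cis (2 * pi * real_of_int m * ((real n - real n') / real N))) =
     (if int N dvd m then (of_nat N)\<^sup>2 else 0)"
proof -
  let ?c = "\<lambda>n m. cis (2 * pi * real n * real_of_int m / real N)"
  have "cis (2 * pi * real_of_int m * ((real n - real n') / real N)) = ?c n m * ?c n' (- m)" for n n'
    by (simp add: cis_mult diff_divide_distrib right_diff_distrib mult_ac)
  then have "(\<Sum>n=1..N. \<Sum>n'=1..N. cis (2 * pi * real_of_int m * ((real n - real n') / real N))) =
      (\<Sum>n=1..N. ?c n m) * (\<Sum>n'=1..N. ?c n' (- m))"
    by (simp only: sum_product)
  then show ?thesis by (simp only: character_sum[OF assms]) (simp add: power2_eq_square)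
qed

text \<open>Expanding the square into pairs (n, n'), the integral over the shift factors into
  one-dimensional autocorrelations at the lags (n - n') Z_j / N. Their Fourier series multiply out,
  and the double sum over n and n' gives N^2 for h in the dual lattice and 0 otherwise.\<close>

lemma shifted_product_square_integral:
  fixes w :: "'n::finite set" and v :: "'n \<Rightarrow> real" and Z :: "nat ^ 'n"
  assumes N: "N > 0" and v: "\<And>j. 0 < v j" "\<And>j. v j < 1"
  shows "(\<integral>\<^sup>+\<delta>. ennreal ((1 / real N * (\<Sum>n=1..N. \<Prod>j\<in>w. jump (v j) (real n * real (Z $ j) / real N + \<delta> j)))\<^sup>2 *
       (\<Prod>j\<in>UNIV. indicator {0..1} (\<delta> j))) \<partial>lebesgue_prod UNIV) =
     (\<integral>\<^sup>+h. ennreal (\<Prod>j\<in>w. jump_coeff (v j) (h j)) *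
       indicator {h. int N dvd (\<Sum>j\<in>w. h j * int (Z $ j))} h \<partial>count_space (freqs w))"
proof -
  let ?a = "\<lambda>n j. real n * real (Z $ j) / real N"
  \<comment> \<open>Coordinates outside w get the factor 1 on [0, 1], so that the product runs over
    all coordinates, as the shift does.\<close>
  let ?F = "\<lambda>n n' j x. (if j \<in> w then jump (v j) (x + ?a n j) * jump (v j) (x + ?a n' j) else 1) * indicator {0..1::real} x"
  let ?I = "{h. int N dvd (\<Sum>j\<in>w. h j * int (Z $ j))}"
  let ?E = "\<lambda>\<delta>. (1 / real N * (\<Sum>n=1..N. \<Prod>j\<in>w. jump (v j) (?a n j + \<delta> j)))\<^sup>2 * (\<Prod>j\<in>UNIV. indicator {0..1} (\<delta> j)) :: real"
  let ?\<sigma> = "\<lambda>h. \<Prod>j\<in>w. jump_coeff (v j) (h j)"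
  have F_int: "integrable lborel (?F n n' j)" for n n' j
  proof (rule Bochner_Integration.integrable_bound)
    show "integrable lborel (indicat_real {0..1::real})"
      by (intro integrable_real_indicator) (auto simp: emeasure_lborel_Icc_eq)
    show "?F n n' j \<in> borel_measurable lborel" by (cases "j \<in> w") simp_all
    show "AE x in lborel. norm (?F n n' j x) \<le> norm (indicat_real {0..1} x)"
      using abs_jump_le_1[OF v] by (auto simp: indicator_def abs_mult intro!: mult_le_one)
  qed
  have E_eq: "?E \<delta> = (1 / real N)\<^sup>2 * (\<Sum>n=1..N. \<Sum>n'=1..N. \<Prod>j\<in>UNIV. ?F n n' j (\<delta> j))" for \<delta>
  proof -
    have "(\<Prod>j\<in>UNIV. ?F n n' j (\<delta> j)) = (\<Prod>j\<in>w. jump (v j) (?a n j + \<delta> j)) * (\<Prod>j\<in>w. jump (v j) (?a n' j + \<delta> j)) * (\<Prod>j\<in>UNIV. indicator {0..1} (\<delta> j))" for n n'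
      by (simp add: prod.distrib prod.If_cases add.commute)
    then have "(\<Sum>n=1..N. \<Sum>n'=1..N. \<Prod>j\<in>UNIV. ?F n n' j (\<delta> j)) =
       (\<Sum>n=1..N. \<Sum>n'=1..N. (\<Prod>j\<in>w. jump (v j) (?a n j + \<delta> j)) * (\<Prod>j\<in>w. jump (v j) (?a n' j + \<delta> j))) * (\<Prod>j\<in>UNIV. indicator {0..1} (\<delta> j))"
      by (simp only: sum_distrib_right)
    also have "(\<Sum>n=1..N. \<Sum>n'=1..N. (\<Prod>j\<in>w. jump (v j) (?a n j + \<delta> j)) * (\<Prod>j\<in>w. jump (v j) (?a n' j + \<delta> j))) =
       (\<Sum>n=1..N. \<Prod>j\<in>w. jump (v j) (?a n j + \<delta> j)) * (\<Sum>n'=1..N. \<Prod>j\<in>w. jump (v j) (?a n' j + \<delta> j))"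
      by (simp only: sum_product)
    finally show ?thesis by (simp only: power_mult_distrib power2_eq_square mult_ac)
  qed
  have P_int: "integrable (lebesgue_prod UNIV) (\<lambda>\<delta>. \<Prod>j\<in>UNIV. ?F n n' j (\<delta> j))" for n n'
    by (rule lebesgue_prod.product_integrable_prod) (auto intro: F_int)
  have E_int: "integrable (lebesgue_prod UNIV) ?E"
    unfolding E_eq by (intro integrable_mult_right Bochner_Integration.integrable_sum P_int)
  let ?s = "\<lambda>j h. complex_of_real (jump_coeff (v j) h)"
  have s_int: "integrable (count_space (freqs w)) (\<lambda>h. \<Prod>j\<in>w. ?s j (h j) * cis (2 * pi * real_of_int (h j) * (?a n j - ?a n' j)))" for n n'
    unfolding count_space_freqs[OF finite]
    by (rule freq_prod.product_integrable_prod) (auto intro: jump_series_integrable v)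
  have prod_cis: "(\<Prod>j\<in>w. ?s j (h j) * cis (2 * pi * real_of_int (h j) * (?a n j - ?a n' j))) =
     of_real (?\<sigma> h) * cis (2 * pi * real_of_int (\<Sum>j\<in>w. h j * int (Z $ j)) * ((real n - real n') / real N))" for h n n'
  proof -
    have prod_cis': "(\<Prod>j\<in>w. cis (x j)) = cis (\<Sum>j\<in>w. x j)" for x
      by (induction w rule: infinite_finite_induct) (simp_all add: cis_mult)
    have "(\<Sum>j\<in>w. 2 * pi * real_of_int (h j) * (?a n j - ?a n' j)) =
        2 * pi * real_of_int (\<Sum>j\<in>w. h j * int (Z $ j)) * ((real n - real n') / real N)"
      by (simp add: sum_distrib_left sum_distrib_right sum_divide_distrib diff_divide_distrib algebra_simps)
    then show ?thesis by (simp add: prod.distrib prod_cis')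
  qed
  have \<sigma>_int: "integrable (count_space (freqs w)) (\<lambda>h. ?\<sigma> h)"
  proof -
    have "integrable (count_space (freqs w)) (\<lambda>h. complex_of_real (?\<sigma> h))"
      using s_int[of 1 1] by simp
    then show ?thesis by (simp only: complex_of_real_integrable_eq)
  qed
  have "complex_of_real (\<integral>\<delta>. ?E \<delta> \<partial>lebesgue_prod UNIV) =
      of_real ((1 / real N)\<^sup>2) * (\<Sum>n=1..N. \<Sum>n'=1..N. of_real (\<integral>\<delta>. (\<Prod>j\<in>UNIV. ?F n n' j (\<delta> j)) \<partial>lebesgue_prod UNIV))"
    unfolding E_eq by (simp add: Bochner_Integration.integral_sum P_int Bochner_Integration.integrable_sum)
  also have "(\<Sum>n=1..N. \<Sum>n'=1..N. complex_of_real (\<integral>\<delta>. (\<Prod>j\<in>UNIV. ?F n n' j (\<delta> j)) \<partial>lebesgue_prod UNIV)) =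
     (\<Sum>n=1..N. \<Sum>n'=1..N. \<integral>h. (\<Prod>j\<in>w. ?s j (h j) * cis (2 * pi * real_of_int (h j) * (?a n j - ?a n' j))) \<partial>count_space (freqs w))"
  proof (intro sum.cong refl)
    fix n n'
    have "(\<integral>\<delta>. (\<Prod>j\<in>UNIV. ?F n n' j (\<delta> j)) \<partial>lebesgue_prod UNIV) = (\<Prod>j\<in>UNIV. \<integral>x. ?F n n' j x \<partial>lborel)"
      by (rule lebesgue_prod.product_integral_prod) (auto intro: F_int)
    also have "\<dots> = (\<Prod>j\<in>w. \<integral>x. jump (v j) (x + ?a n j) * jump (v j) (x + ?a n' j) * indicator {0..1} x \<partial>lborel)"
      by (rule prod.mono_neutral_cong_right) auto
    finally have "complex_of_real (\<integral>\<delta>. (\<Prod>j\<in>UNIV. ?F n n' j (\<delta> j)) \<partial>lebesgue_prod UNIV) =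
      (\<Prod>j\<in>w. \<integral>h. ?s j h * cis (2 * pi * real_of_int h * (?a n j - ?a n' j)) \<partial>count_space (- {0}))"
      by (simp add: jump_series v)
    also have "\<dots> = (\<integral>h. (\<Prod>j\<in>w. ?s j (h j) * cis (2 * pi * real_of_int (h j) * (?a n j - ?a n' j))) \<partial>count_space (freqs w))"
      unfolding count_space_freqs[OF finite]
      by (rule freq_prod.product_integral_prod[symmetric]) (auto intro: jump_series_integrable v)
    finally show "complex_of_real (\<integral>\<delta>. (\<Prod>j\<in>UNIV. ?F n n' j (\<delta> j)) \<partial>lebesgue_prod UNIV) =
      (\<integral>h. (\<Prod>j\<in>w. ?s j (h j) * cis (2 * pi * real_of_int (h j) * (?a n j - ?a n' j))) \<partial>count_space (freqs w))" .
  qed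
  also have "of_real ((1 / real N)\<^sup>2) * \<dots> =
     (\<integral>h. of_real ((1 / real N)\<^sup>2) * (\<Sum>n=1..N. \<Sum>n'=1..N. \<Prod>j\<in>w. ?s j (h j) * cis (2 * pi * real_of_int (h j) * (?a n j - ?a n' j))) \<partial>count_space (freqs w))"
    by (simp add: Bochner_Integration.integral_sum s_int Bochner_Integration.integrable_sum)
  also have "\<dots> = (\<integral>h. complex_of_real (?\<sigma> h * indicator ?I h) \<partial>count_space (freqs w))"
  proof (intro Bochner_Integration.integral_cong refl)
    fix h
    have "(\<Sum>n=1..N. \<Sum>n'=1..N. \<Prod>j\<in>w. ?s j (h j) * cis (2 * pi * real_of_int (h j) * (?a n j - ?a n' j))) =
       of_real (?\<sigma> h) * (if int N dvd (\<Sum>j\<in>w. h j * int (Z $ j)) then (of_nat N)\<^sup>2 else 0)"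
      unfolding prod_cis sum_distrib_left[symmetric] character_double_sum[OF N] ..
    then show "of_real ((1 / real N)\<^sup>2) * (\<Sum>n=1..N. \<Sum>n'=1..N. \<Prod>j\<in>w. ?s j (h j) * cis (2 * pi * real_of_int (h j) * (?a n j - ?a n' j))) =
        complex_of_real (?\<sigma> h * indicator ?I h)"
      using N by (simp add: power_divide indicator_def)
  qed
  finally have "(\<integral>\<delta>. ?E \<delta> \<partial>lebesgue_prod UNIV) = (\<integral>h. ?\<sigma> h * indicator ?I h \<partial>count_space (freqs w))"
    by (simp only: integral_complex_of_real of_real_eq_iff)
  moreover have "(\<integral>\<^sup>+\<delta>. ennreal (?E \<delta>) \<partial>lebesgue_prod UNIV) = ennreal (\<integral>\<delta>. ?E \<delta> \<partial>lebesgue_prod UNIV)"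
    by (rule nn_integral_eq_integral[OF E_int]) (simp add: prod_nonneg)
  moreover have "(\<integral>\<^sup>+h. ennreal (?\<sigma> h * indicator ?I h) \<partial>count_space (freqs w)) = ennreal (\<integral>h. ?\<sigma> h * indicator ?I h \<partial>count_space (freqs w))"
  proof (rule nn_integral_eq_integral)
    show "integrable (count_space (freqs w)) (\<lambda>h. ?\<sigma> h * indicator ?I h)"
      by (rule Bochner_Integration.integrable_bound[OF \<sigma>_int]) (auto simp: indicator_def)
  qed (simp add: prod_nonneg jump_coeff_nonneg)
  moreover have "ennreal (?\<sigma> h) * indicator ?I h = ennreal (?\<sigma> h * indicator ?I h)" for h
    by (simp add: indicator_def)
  ultimately show ?thesis by (simp only:)
qed

text \<open>From |sin x| \<le> |x|, and from the symmetry of sin^2(\<pi>hv) under v \<mapsto> 1 - v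
  for integer h. With v = \<Phi>(t) the two bounds control the two tails of the integral in
  \<open>theta_hat\<close> by the squared envelope.\<close>

lemma jump_coeff_le:
  assumes "0 < v" "v < 1"
  shows "jump_coeff v h \<le> v\<^sup>2" "jump_coeff v h \<le> (1 - v)\<^sup>2"
proof -
  have le: "jump_coeff v h \<le> x\<^sup>2" if "(sin (pi * real_of_int h * v))\<^sup>2 = (sin (pi * real_of_int h * x))\<^sup>2" for x
  proof (cases "h = 0")
    case False
    have "(sin (pi * real_of_int h * x))\<^sup>2 \<le> (pi * real_of_int h * x)\<^sup>2"
      using abs_sin_x_le_abs_x[of "pi * real_of_int h * x"] by (simp add: abs_le_square_iff)
    then show ?thesis using False unfolding jump_coeff_def that
      by (simp add: field_simps power_mult_distrib)
  qed (simp add: jump_coeff_def)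
  show "jump_coeff v h \<le> v\<^sup>2" by (rule le) simp
  have s0: "sin (pi * real_of_int h) = 0" using sin_times_pi_eq_0[of "real_of_int h"] by (simp add: mult.commute)
  then have c1: "(cos (pi * real_of_int h))\<^sup>2 = 1" using sin_cos_squared_add[of "pi * real_of_int h"] by simp
  have "pi * real_of_int h * (1 - v) = pi * real_of_int h - pi * real_of_int h * v" by (simp add: algebra_simps)
  then have "sin (pi * real_of_int h * (1 - v)) = - (cos (pi * real_of_int h) * sin (pi * real_of_int h * v))"
    by (simp add: sin_diff s0)
  then show "jump_coeff v h \<le> (1 - v)\<^sup>2" by (intro le) (simp add: power_mult_distrib c1)
qed

lemma jump_coeff_measurable [measurable]: "(\<lambda>v. jump_coeff v h) \<in> borel_measurable borel"
  unfolding jump_coeff_def by measurable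

abbreviation unit_cube :: "(real ^ 'n::finite) set" where
  "unit_cube \<equiv> {x. \<forall>j. 0 \<le> x $ j \<and> x $ j \<le> 1}"

lemma unit_cube_eq: "unit_cube = cbox (\<chi> j. 0) (\<chi> j. 1)"
  by (auto simp: mem_box_cart)

lemma emeasure_unit_cube: "emeasure lborel (unit_cube :: (real ^ 'n::finite) set) = 1"
proof -
  have "emeasure lborel (cbox (\<chi> j. 0) (\<chi> j. 1) :: (real ^ 'n) set) =
      ennreal (\<Prod>b\<in>Basis. ((\<chi> j. 1) - (\<chi> j. 0) :: real ^ 'n) \<bullet> b)"
    by (rule emeasure_lborel_cbox) (auto simp: Basis_vec_def inner_axis)
  also have "(\<Prod>b\<in>Basis. ((\<chi> j. 1) - (\<chi> j. 0) :: real ^ 'n) \<bullet> b) = 1"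
    by (rule prod.neutral) (auto simp: Basis_vec_def inner_axis)
  finally show ?thesis unfolding unit_cube_eq by simp
qed

lemma nn_integral_unit_cube:
  fixes F :: "real ^ 'n::finite \<Rightarrow> ennreal"
  assumes [measurable]: "F \<in> borel_measurable borel"
  shows "(\<integral>\<^sup>+x. F x \<partial>uniform_measure lborel unit_cube) =
     (\<integral>\<^sup>+\<delta>. F (vec_lambda \<delta>) * ennreal (\<Prod>j\<in>UNIV. indicator {0..1} (\<delta> j)) \<partial>lebesgue_prod UNIV)"
proof -
  have [measurable]: "unit_cube \<in> sets (borel :: (real ^ 'n) measure)" unfolding unit_cube_eq by simp
  have "(\<integral>\<^sup>+x. F x \<partial>uniform_measure lborel unit_cube) = (\<integral>\<^sup>+x. F x * indicator unit_cube x \<partial>lborel)"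
    by (subst nn_integral_uniform_measure) (auto simp: emeasure_unit_cube divide_ennreal_def)
  also have "\<dots> = (\<integral>\<^sup>+\<delta>. F (vec_lambda \<delta>) * indicator unit_cube (vec_lambda \<delta>) \<partial>lebesgue_prod UNIV)"
    by (subst lborel_eq_distr_vec_lambda, subst nn_integral_distr) simp_all
  also have "\<dots> = (\<integral>\<^sup>+\<delta>. F (vec_lambda \<delta>) * ennreal (\<Prod>j\<in>UNIV. indicator {0..1} (\<delta> j)) \<partial>lebesgue_prod UNIV)"
  proof (intro nn_integral_cong)
    fix \<delta> :: "'n \<Rightarrow> real"
    have "(\<Prod>j\<in>UNIV. indicator {0..1} (\<delta> j)) = indicat_real unit_cube (vec_lambda \<delta>)"
      by (auto simp: indicator_def intro!: prod.neutral)
    then show "F (vec_lambda \<delta>) * indicator unit_cube (vec_lambda \<delta>) = F (vec_lambda \<delta>) * ennreal (\<Prod>j\<in>UNIV. indicator {0..1} (\<delta> j))"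
      by (simp add: indicator_def)
  qed
  finally show ?thesis .
qed

section \<open>Quantile transformation and the error of a single shifted rule\<close>

context prob_density
begin

definition quantile :: "real \<Rightarrow> real" where "quantile = the_inv \<Phi>"

lemma Phi_quantile: "0 < x \<Longrightarrow> x < 1 \<Longrightarrow> \<Phi> (quantile x) = x"
  unfolding quantile_def using f_the_inv_into_f_bij_betw[OF Phi_invertible] by simp

lemma le_quantile_iff: "0 < x \<Longrightarrow> x < 1 \<Longrightarrow> t \<le> quantile x \<longleftrightarrow> \<Phi> t \<le> x"
  using Phi_le_iff[of t "quantile x"] by (simp add: Phi_quantile)

lemma quantile_measurable [measurable]: "quantile \<in> borel_measurable borel"
proof (rule borel_measurableI_ge)
  fix a
  \<comment> \<open>Outside (0, 1) no y satisfies \<Phi>(y) = x, so \<open>the_inv\<close> takes one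
    and the same default value there.\<close>
  define c where "c = (THE y::real. False)"
  have out: "quantile x = c" if "\<not> (0 < x \<and> x < 1)" for x
  proof -
    have "\<Phi> y \<noteq> x" for y using that Phi_bounds[of y] by auto
    then show ?thesis by (simp add: quantile_def the_inv_into_def c_def)
  qed
  have "{x. a \<le> quantile x} = ({0<..<1} \<inter> {\<Phi> a..}) \<union> (if a \<le> c then - {0<..<1} else {})"
  proof (rule set_eqI)
    fix x
    show "x \<in> {x. a \<le> quantile x} \<longleftrightarrow> x \<in> ({0<..<1} \<inter> {\<Phi> a..}) \<union> (if a \<le> c then - {0<..<1} else {})"
    proof (cases "0 < x \<and> x < 1")
      case True
      then show ?thesis using le_quantile_iff[of x a] by simp
    next
      case False
      then show ?thesis using out[OF False] by auto
    qed
  qed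
  then show "{x \<in> space borel. a \<le> quantile x} \<in> sets borel" by simp
qed

lemma kern_quantile: "frac u \<noteq> 0 \<Longrightarrow> kern (quantile (frac u)) t = jump (\<Phi> t) u"
  using le_quantile_iff[of "frac u" t] frac_lt_1[of u] frac_ge_0[of u]
  by (auto simp: kern_def jump_def indicator_def less_le)

definition node :: "nat \<Rightarrow> nat ^ 'n \<Rightarrow> ('n \<Rightarrow> real) \<Rightarrow> nat \<Rightarrow> real ^ 'n" where
  "node N Z \<delta> n = (\<chi> j. quantile (frac (real n * real (Z $ j) / real N + \<delta> j)))"

lemma lattice_rule_node:
  "lattice_rule \<phi> N f Z (vec_lambda \<delta>) = 1 / real N * (\<Sum>n=1..N. f (node N Z \<delta> n))"
  by (simp add: lattice_rule_def node_def quantile_def)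

lemma lattice_rule_measurable:
  fixes f :: "real ^ 'n::finite \<Rightarrow> real"
  assumes f [measurable]: "f \<in> borel_measurable borel"
  shows "lattice_rule \<phi> N f Z \<in> borel_measurable borel"
proof -
  have 1: "(\<lambda>\<Delta>. (\<chi> j. quantile (frac (real n * real (Z $ j) / real N + \<Delta> $ j)))) \<in> borel_measurable (borel :: (real ^ 'n) measure)" for n
    by (subst borel_measurable_euclidean_space) (auto simp: Basis_vec_def inner_axis)
  show ?thesis
    unfolding lattice_rule_def[abs_def] quantile_def[symmetric]
    by (intro borel_measurable_times borel_measurable_const borel_measurable_sum measurable_compose[OF 1 f])
qed

text \<open>At argument 0 the quantile is only a default value. The shifts that put a node
  coordinate there lie on countably many hyperplanes.\<close>

lemma AE_nodes_nonzero:
  "AE \<delta> in lebesgue_prod (UNIV :: 'n::finite set). \<forall>n\<in>{1..N}. \<forall>j. frac (real n * real (Z $ j) / real N + \<delta> j) \<noteq> 0"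
proof (intro AE_finite_allI)
  fix n
  have "AE \<delta> in lebesgue_prod (UNIV :: 'n set). \<forall>j\<in>UNIV. \<forall>k::int. \<delta> j \<noteq> of_int k - real n * real (Z $ j) / real N"
    by (intro AE_finite_allI) (auto simp: AE_all_countable intro: AE_lebesgue_prod_neq)
  then show "AE \<delta> in lebesgue_prod (UNIV :: 'n set). \<forall>j. frac (real n * real (Z $ j) / real N + \<delta> j) \<noteq> 0"
  proof eventually_elim
    case (elim \<delta>)
    show ?case
    proof
      fix j
      show "frac (real n * real (Z $ j) / real N + \<delta> j) \<noteq> 0"
      proof
        assume "frac (real n * real (Z $ j) / real N + \<delta> j) = 0"
        then obtain k :: int where "real n * real (Z $ j) / real N + \<delta> j = of_int k"
          by (auto simp: frac_eq_0_iff elim: Ints_cases)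
        then have "\<delta> j = of_int k - real n * real (Z $ j) / real N" by simp
        then show False using elim by blast
      qed
    qed
  qed
qed simp

end

context sobolev_weights
begin

text \<open>The integral in \<open>theta_hat\<close> would be 0 by convention if it diverged, so
  integrability has to be established first; the squared quotient of \<open>envelope 0\<close> by
  \<psi>_j dominates.\<close>

lemma jump_coeff_integral:
  assumes "h \<noteq> 0"
  shows "(\<integral>\<^sup>+t. ennreal (jump_coeff (\<Phi> t) h * (inverse (\<psi> j t))\<^sup>2) \<partial>lborel) = ennreal (theta_hat \<phi> (\<psi> j) h)"
    and "theta_hat \<phi> (\<psi> j) h \<ge> 0"
proof -
  have "integrable lborel (\<lambda>t. jump_coeff (\<Phi> t) h * (inverse (\<psi> j t))\<^sup>2)"
  proof (rule integrableI_bounded)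
    have "(\<integral>\<^sup>+t. ennreal (norm (jump_coeff (\<Phi> t) h * (inverse (\<psi> j t))\<^sup>2)) \<partial>lborel) \<le>
        (\<integral>\<^sup>+t. ennreal ((envelope 0 t / \<psi> j t)\<^sup>2) \<partial>lborel)"
    proof (intro nn_integral_mono ennreal_leI)
      fix t
      have "jump_coeff (\<Phi> t) h \<le> (envelope 0 t)\<^sup>2"
      proof (cases "t \<le> 0")
        case True
        then have "\<Phi> t \<le> envelope 0 t" using Phi_bounds[of t] by (simp add: envelope_def indicator_def)
        then have "(\<Phi> t)\<^sup>2 \<le> (envelope 0 t)\<^sup>2" using Phi_bounds[of t] by (intro power_mono) auto
        then show ?thesis using jump_coeff_le(1)[OF Phi_bounds, of t h] by linarith
      next
        case False
        then have "1 - \<Phi> t \<le> envelope 0 t" using Phi_bounds[of t] by (simp add: envelope_def indicator_def)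
        then have "(1 - \<Phi> t)\<^sup>2 \<le> (envelope 0 t)\<^sup>2" using Phi_bounds[of t] by (intro power_mono) auto
        then show ?thesis using jump_coeff_le(2)[OF Phi_bounds, of t h] by linarith
      qed
      then show "norm (jump_coeff (\<Phi> t) h * (inverse (\<psi> j t))\<^sup>2) \<le> (envelope 0 t / \<psi> j t)\<^sup>2"
        by (simp add: abs_mult jump_coeff_nonneg divide_inverse power_mult_distrib mult_right_mono)
    qed
    also have "\<dots> < \<infinity>" by (rule envelope_sq_integral)
    finally show "(\<integral>\<^sup>+t. ennreal (norm (jump_coeff (\<Phi> t) h * (inverse (\<psi> j t))\<^sup>2)) \<partial>lborel) < \<infinity>" .
  qed measurable
  then have "(\<integral>\<^sup>+t. ennreal (jump_coeff (\<Phi> t) h * (inverse (\<psi> j t))\<^sup>2) \<partial>lborel) =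
      ennreal (\<integral>t. jump_coeff (\<Phi> t) h * (inverse (\<psi> j t))\<^sup>2 \<partial>lborel)"
    by (rule nn_integral_eq_integral) (simp add: jump_coeff_nonneg)
  also have "(\<integral>t. jump_coeff (\<Phi> t) h * (inverse (\<psi> j t))\<^sup>2 \<partial>lborel) = theta_hat \<phi> (\<psi> j) h"
  proof -
    have "jump_coeff (\<Phi> t) h * (inverse (\<psi> j t))\<^sup>2 =
        1 / (pi\<^sup>2 * (real_of_int h)\<^sup>2) * ((sin (pi * real_of_int h * \<Phi> t))\<^sup>2 / (\<psi> j t)\<^sup>2)" for t
      by (simp add: jump_coeff_def divide_inverse power_inverse)
    then have "(\<integral>t. jump_coeff (\<Phi> t) h * (inverse (\<psi> j t))\<^sup>2 \<partial>lborel) =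
        (\<integral>t. 1 / (pi\<^sup>2 * (real_of_int h)\<^sup>2) * ((sin (pi * real_of_int h * \<Phi> t))\<^sup>2 / (\<psi> j t)\<^sup>2) \<partial>lborel)"
      by (simp only:)
    then show ?thesis unfolding theta_hat_def by (simp only: integral_mult_right_zero)
  qed
  finally show "(\<integral>\<^sup>+t. ennreal (jump_coeff (\<Phi> t) h * (inverse (\<psi> j t))\<^sup>2) \<partial>lborel) = ennreal (theta_hat \<phi> (\<psi> j) h)" .
  show "theta_hat \<phi> (\<psi> j) h \<ge> 0" unfolding theta_hat_def by (intro mult_nonneg_nonneg integral_nonneg_AE) auto
qed

definition shifted_average :: "nat \<Rightarrow> nat ^ 'n \<Rightarrow> 'n set \<Rightarrow> ('n \<Rightarrow> real) \<Rightarrow> ('n \<Rightarrow> real) \<Rightarrow> real" where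
  "shifted_average N Z w \<delta> t = 1 / real N * (\<Sum>n=1..N. \<Prod>j\<in>w. jump (\<Phi> (t j)) (real n * real (Z $ j) / real N + \<delta> j))"

text \<open>Everything is nonnegative, so the shift, the kernel variables and the frequencies may be
  integrated in any order. For fixed t the shift integral is the dual-lattice sum of jump
  coefficients, and integrating these against the inverse squared weights produces
  \<open>theta_hat\<close>.\<close>

lemma shifted_average_sq_integral:
  assumes N: "N > 0"
  shows "(\<integral>\<^sup>+\<delta>. (\<integral>\<^sup>+t. ennreal ((shifted_average N Z w \<delta> t * (\<Prod>j\<in>w. inverse (\<psi> j (t j))))\<^sup>2) \<partial>lebesgue_prod w) *
       ennreal (\<Prod>j\<in>UNIV. indicator {0..1} (\<delta> j)) \<partial>lebesgue_prod UNIV) =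
     (\<integral>\<^sup>+h. ennreal (\<Prod>j\<in>w. theta_hat \<phi> (\<psi> j) (h j)) *
       indicator {h. int N dvd (\<Sum>j\<in>w. h j * int (Z $ j))} h \<partial>count_space (freqs w))"
proof -
  interpret P: pair_sigma_finite "lebesgue_prod w" "lebesgue_prod (UNIV :: 'n set)"
    by (rule pair_sigma_finite_lebesgue_prod) auto
  let ?cube = "\<lambda>\<delta>. \<Prod>j\<in>(UNIV :: 'n set). indicator {0..1::real} (\<delta> j) :: real"
  let ?E = "shifted_average N Z w"
  let ?I = "{h. int N dvd (\<Sum>j\<in>w. h j * int (Z $ j))}"
  let ?\<psi> = "\<lambda>t. \<Prod>j\<in>w. (inverse (\<psi> j (t j)))\<^sup>2"
  have E_meas [measurable]: "(\<lambda>x. ?E (snd x) (fst x)) \<in> borel_measurable (lebesgue_prod w \<Otimes>\<^sub>M lebesgue_prod UNIV)"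
    unfolding shifted_average_def by measurable
  have \<psi>_meas [measurable]: "?\<psi> \<in> borel_measurable (lebesgue_prod w)" by measurable
  have sq: "ennreal ((?E \<delta> t * (\<Prod>j\<in>w. inverse (\<psi> j (t j))))\<^sup>2) * ennreal (?cube \<delta>) =
      ennreal (?\<psi> t) * ennreal ((?E \<delta> t)\<^sup>2 * ?cube \<delta>)" for \<delta> t
    by (simp add: power_mult_distrib prod_power_distrib ennreal_mult[symmetric] prod_nonneg mult_ac)
  have "(\<integral>\<^sup>+\<delta>. (\<integral>\<^sup>+t. ennreal ((?E \<delta> t * (\<Prod>j\<in>w. inverse (\<psi> j (t j))))\<^sup>2) \<partial>lebesgue_prod w) *
       ennreal (?cube \<delta>) \<partial>lebesgue_prod UNIV) =
     (\<integral>\<^sup>+\<delta>. (\<integral>\<^sup>+t. ennreal (?\<psi> t) * ennreal ((?E \<delta> t)\<^sup>2 * ?cube \<delta>) \<partial>lebesgue_prod w) \<partial>lebesgue_prod UNIV)"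
  proof (intro nn_integral_cong)
    fix \<delta> :: "'n \<Rightarrow> real" assume \<delta>: "\<delta> \<in> space (lebesgue_prod UNIV)"
    have "(\<lambda>t. ?E \<delta> t) \<in> borel_measurable (lebesgue_prod w)"
      using measurable_compose[OF measurable_Pair2'[OF \<delta>, of "lebesgue_prod w"] E_meas] by simp
    then have "(\<lambda>t. ennreal ((?E \<delta> t * (\<Prod>j\<in>w. inverse (\<psi> j (t j))))\<^sup>2)) \<in> borel_measurable (lebesgue_prod w)"
      by measurable
    then show "(\<integral>\<^sup>+t. ennreal ((?E \<delta> t * (\<Prod>j\<in>w. inverse (\<psi> j (t j))))\<^sup>2) \<partial>lebesgue_prod w) * ennreal (?cube \<delta>) =
        (\<integral>\<^sup>+t. ennreal (?\<psi> t) * ennreal ((?E \<delta> t)\<^sup>2 * ?cube \<delta>) \<partial>lebesgue_prod w)"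
      unfolding sq[symmetric] by (rule nn_integral_multc[symmetric])
  qed
  also have "\<dots> = (\<integral>\<^sup>+t. (\<integral>\<^sup>+\<delta>. ennreal (?\<psi> t) * ennreal ((?E \<delta> t)\<^sup>2 * ?cube \<delta>) \<partial>lebesgue_prod UNIV) \<partial>lebesgue_prod w)"
    by (rule P.Fubini') (simp add: split_beta')
  also have "\<dots> = (\<integral>\<^sup>+t. (\<integral>\<^sup>+h. ennreal (?\<psi> t) * (ennreal (\<Prod>j\<in>w. jump_coeff (\<Phi> (t j)) (h j)) * indicator ?I h) \<partial>count_space (freqs w)) \<partial>lebesgue_prod w)"
  proof (intro nn_integral_cong)
    fix t assume t: "t \<in> space (lebesgue_prod w)"
    have "(\<lambda>\<delta>. ?E \<delta> t) \<in> borel_measurable (lebesgue_prod UNIV)"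
      using measurable_compose[OF measurable_Pair1'[OF t, of "lebesgue_prod UNIV"] E_meas] by simp
    then have m: "(\<lambda>\<delta>. ennreal ((?E \<delta> t)\<^sup>2 * ?cube \<delta>)) \<in> borel_measurable (lebesgue_prod UNIV)" by measurable
    show "(\<integral>\<^sup>+\<delta>. ennreal (?\<psi> t) * ennreal ((?E \<delta> t)\<^sup>2 * ?cube \<delta>) \<partial>lebesgue_prod UNIV) =
      (\<integral>\<^sup>+h. ennreal (?\<psi> t) * (ennreal (\<Prod>j\<in>w. jump_coeff (\<Phi> (t j)) (h j)) * indicator ?I h) \<partial>count_space (freqs w))"
    proof -
      have "(\<integral>\<^sup>+\<delta>. ennreal (?\<psi> t) * ennreal ((?E \<delta> t)\<^sup>2 * ?cube \<delta>) \<partial>lebesgue_prod UNIV) =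
          ennreal (?\<psi> t) * (\<integral>\<^sup>+\<delta>. ennreal ((?E \<delta> t)\<^sup>2 * ?cube \<delta>) \<partial>lebesgue_prod UNIV)"
        by (rule nn_integral_cmult[OF m])
      also have "\<dots> = ennreal (?\<psi> t) * (\<integral>\<^sup>+h. ennreal (\<Prod>j\<in>w. jump_coeff (\<Phi> (t j)) (h j)) * indicator ?I h \<partial>count_space (freqs w))"
        unfolding shifted_average_def
        by (simp only: shifted_product_square_integral[OF N, of "\<lambda>j. \<Phi> (t j)", OF Phi_bounds])
      also have "\<dots> = (\<integral>\<^sup>+h. ennreal (?\<psi> t) * (ennreal (\<Prod>j\<in>w. jump_coeff (\<Phi> (t j)) (h j)) * indicator ?I h) \<partial>count_space (freqs w))"
        by (rule nn_integral_cmult[symmetric]) simp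
      finally show ?thesis .
    qed
  qed
  also have "\<dots> = (\<integral>\<^sup>+h. (\<integral>\<^sup>+t. ennreal (?\<psi> t) * (ennreal (\<Prod>j\<in>w. jump_coeff (\<Phi> (t j)) (h j)) * indicator ?I h) \<partial>lebesgue_prod w) \<partial>count_space (freqs w))"
    by (rule nn_integral_count_space_nn_integral) (auto intro: countable_freqs)
  also have "\<dots> = (\<integral>\<^sup>+h. ennreal (\<Prod>j\<in>w. theta_hat \<phi> (\<psi> j) (h j)) * indicator ?I h \<partial>count_space (freqs w))"
  proof (intro nn_integral_cong)
    fix h assume "h \<in> space (count_space (freqs w))"
    then have h: "\<And>j. j \<in> w \<Longrightarrow> h j \<noteq> 0" by (auto simp: PiE_iff)
    have "(\<integral>\<^sup>+t. ennreal (?\<psi> t) * (ennreal (\<Prod>j\<in>w. jump_coeff (\<Phi> (t j)) (h j)) * indicator ?I h) \<partial>lebesgue_prod w) =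
       (\<integral>\<^sup>+t. (\<Prod>j\<in>w. ennreal (jump_coeff (\<Phi> (t j)) (h j) * (inverse (\<psi> j (t j)))\<^sup>2)) * indicator ?I h \<partial>lebesgue_prod w)"
      by (intro nn_integral_cong)
         (simp add: prod_ennreal jump_coeff_nonneg prod.distrib ennreal_mult prod_nonneg mult_ac)
    also have "\<dots> = (\<integral>\<^sup>+t. (\<Prod>j\<in>w. ennreal (jump_coeff (\<Phi> (t j)) (h j) * (inverse (\<psi> j (t j)))\<^sup>2)) \<partial>lebesgue_prod w) * indicator ?I h"
      by (rule nn_integral_multc) measurable
    also have "(\<integral>\<^sup>+t. (\<Prod>j\<in>w. ennreal (jump_coeff (\<Phi> (t j)) (h j) * (inverse (\<psi> j (t j)))\<^sup>2)) \<partial>lebesgue_prod w) =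
       (\<Prod>j\<in>w. \<integral>\<^sup>+t. ennreal (jump_coeff (\<Phi> t) (h j) * (inverse (\<psi> j t))\<^sup>2) \<partial>lborel)"
      by (rule lebesgue_prod.product_nn_integral_prod) auto
    also have "\<dots> = (\<Prod>j\<in>w. ennreal (theta_hat \<phi> (\<psi> j) (h j)))"
      by (intro prod.cong refl jump_coeff_integral h)
    also have "\<dots> = ennreal (\<Prod>j\<in>w. theta_hat \<phi> (\<psi> j) (h j))"
      by (rule prod_ennreal) (rule jump_coeff_integral(2)[OF h])
    finally show "(\<integral>\<^sup>+t. ennreal (?\<psi> t) * (ennreal (\<Prod>j\<in>w. jump_coeff (\<Phi> (t j)) (h j)) * indicator ?I h) \<partial>lebesgue_prod w) =
       ennreal (\<Prod>j\<in>w. theta_hat \<phi> (\<psi> j) (h j)) * indicator ?I h" .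
  qed
  finally show ?thesis .
qed

text \<open>The constant term of the representation cancels against the integral, and the error is
  the sum over nonempty w of the integrals of m_w against \<open>shifted_average\<close>.
  Cauchy-Schwarz enters twice: over w, at the cost of the number of subsets, and in t, with \<psi>
  on m_w and its inverse on the average.\<close>

theorem mean_square_error_le:
  assumes f: "f \<in> sobolev_space \<phi> \<gamma> \<psi>" and \<gamma>: "\<And>u. \<gamma> u > 0" and norm: "sobolev_norm \<phi> \<gamma> \<psi> f \<le> 1" and N: "N > 0"
  shows "(\<integral>\<^sup>+\<Delta>. ennreal ((lattice_rule \<phi> N (cont_rep f) Z \<Delta> - weighted_integral \<phi> f)\<^sup>2) \<partial>uniform_measure lborel unit_cube) \<le>
    (\<Sum>w\<in>UNIV-{{}}. ennreal (card (UNIV :: 'n set set)) * (ennreal (\<gamma> w) * (\<integral>\<^sup>+h. ennreal (\<Prod>j\<in>w. theta_hat \<phi> (\<psi> j) (h j)) *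
       indicator {h. int N dvd (\<Sum>j\<in>w. h j * int (Z $ j))} h \<partial>count_space (freqs w))))"
proof -
  obtain m where m_meas: "\<And>w. m w \<in> borel_measurable (lebesgue_prod w)"
    and m_norm: "\<And>w. (\<integral>\<^sup>+t. ennreal ((m w t)\<^sup>2 * (\<Prod>j\<in>w. (\<psi> j (t j))\<^sup>2)) \<partial>lebesgue_prod w) \<le> ennreal (\<gamma> w)"
    and m_env: "\<And>w b. (\<integral>\<^sup>+t. ennreal (\<bar>m w t\<bar> * (\<Prod>j\<in>w. envelope b (t j))) \<partial>lebesgue_prod w) < \<infinity>"
    and rep: "\<And>x. cont_rep f x = weighted_integral \<phi> f +
       (\<Sum>w\<in>UNIV-{{}}. \<integral>t. m w t * (\<Prod>j\<in>w. kern (x $ j) (t j)) \<partial>lebesgue_prod w)"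
    and cont: "continuous_on UNIV (cont_rep f)"
    by (rule sobolev_representation[OF f \<gamma> norm], rule that)
  note [measurable] = m_meas
  have f_meas: "cont_rep f \<in> borel_measurable borel" using cont by (rule borel_measurable_continuous_onI)
  note [measurable] = lattice_rule_measurable[OF f_meas]
  let ?W = "UNIV - {{}} :: 'n set set" and ?c = "real (card (UNIV :: 'n set set))"
  let ?cube = "\<lambda>\<delta>. \<Prod>j\<in>(UNIV :: 'n set). indicator {0..1::real} (\<delta> j) :: real"
  let ?E = "shifted_average N Z"
  let ?Q = "\<lambda>w \<delta>. \<integral>\<^sup>+t. ennreal ((?E w \<delta> t * (\<Prod>j\<in>w. inverse (\<psi> j (t j))))\<^sup>2) \<partial>lebesgue_prod w"
  have E_meas [measurable]: "(\<lambda>x. ?E w (snd x) (fst x)) \<in> borel_measurable (lebesgue_prod w \<Otimes>\<^sub>M lebesgue_prod UNIV)" for w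
    unfolding shifted_average_def by measurable
  have E_meas1: "?E w \<delta> \<in> borel_measurable (lebesgue_prod w)" for w \<delta>
    unfolding shifted_average_def[abs_def] by measurable
  \<comment> \<open>For these shifts the kernel at every node is the jump function of the shifted
    lattice point; almost every shift qualifies.\<close>
  have pointwise: "ennreal ((lattice_rule \<phi> N (cont_rep f) Z (vec_lambda \<delta>) - weighted_integral \<phi> f)\<^sup>2) \<le>
      (\<Sum>w\<in>?W. ennreal ?c * (ennreal (\<gamma> w) * ?Q w \<delta>))"
    if nz: "\<forall>n\<in>{1..N}. \<forall>j. frac (real n * real (Z $ j) / real N + \<delta> j) \<noteq> 0" for \<delta>
  proof -
    let ?L = "\<lambda>w. \<integral>t. m w t * ?E w \<delta> t \<partial>lebesgue_prod w"
    have kern_node: "kern (node N Z \<delta> n $ j) (t j) = jump (\<Phi> (t j)) (real n * real (Z $ j) / real N + \<delta> j)"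
      if "n \<in> {1..N}" for n j t
      using nz that by (simp add: node_def kern_quantile)
    have int: "integrable (lebesgue_prod w) (\<lambda>t. m w t * (\<Prod>j\<in>w. kern (y $ j) (t j)))" for w and y :: "real ^ 'n"
    proof (rule integrableI_bounded)
      have "(\<integral>\<^sup>+t. ennreal (norm (m w t * (\<Prod>j\<in>w. kern (y $ j) (t j)))) \<partial>lebesgue_prod w) \<le>
         (\<integral>\<^sup>+t. ennreal (\<bar>m w t\<bar> * (\<Prod>j\<in>w. envelope (norm y) (t j))) \<partial>lebesgue_prod w)"
        unfolding real_norm_def abs_mult abs_prod
        by (intro nn_integral_mono ennreal_leI mult_left_mono prod_mono)
           (auto intro!: abs_kern_le_envelope component_le_norm_cart)
      also have "\<dots> < \<infinity>" by (rule m_env)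
      finally show "(\<integral>\<^sup>+t. ennreal (norm (m w t * (\<Prod>j\<in>w. kern (y $ j) (t j)))) \<partial>lebesgue_prod w) < \<infinity>" .
    qed measurable
    have L: "?L w = 1 / real N * (\<Sum>n=1..N. \<integral>t. m w t * (\<Prod>j\<in>w. kern (node N Z \<delta> n $ j) (t j)) \<partial>lebesgue_prod w)" for w
    proof -
      have "m w t * ?E w \<delta> t = 1 / real N * (\<Sum>n=1..N. m w t * (\<Prod>j\<in>w. kern (node N Z \<delta> n $ j) (t j)))" for t
        unfolding shifted_average_def by (simp add: kern_node sum_distrib_left mult.left_commute)
      then show ?thesis
        by (simp only: integral_mult_right_zero Bochner_Integration.integral_sum[OF int])
    qed
    have "lattice_rule \<phi> N (cont_rep f) Z (vec_lambda \<delta>) - weighted_integral \<phi> f =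
        1 / real N * (\<Sum>n=1..N. (\<Sum>w\<in>?W. \<integral>t. m w t * (\<Prod>j\<in>w. kern (node N Z \<delta> n $ j) (t j)) \<partial>lebesgue_prod w))"
      using N by (simp add: lattice_rule_node rep sum.distrib field_simps)
    also have "\<dots> = (\<Sum>w\<in>?W. ?L w)"
      unfolding L by (subst sum.swap) (simp only: sum_distrib_left)
    finally have "(lattice_rule \<phi> N (cont_rep f) Z (vec_lambda \<delta>) - weighted_integral \<phi> f)\<^sup>2 = (\<Sum>w\<in>?W. ?L w)\<^sup>2" by simp
    also have "\<dots> \<le> (\<Sum>w\<in>?W. (?L w)\<^sup>2) * card ?W" by (rule sum_squared_le_sum_of_squares)
    also have "\<dots> \<le> (\<Sum>w\<in>?W. (?L w)\<^sup>2) * ?c"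
      by (intro mult_left_mono sum_nonneg) (auto intro!: card_mono)
    finally have "ennreal ((lattice_rule \<phi> N (cont_rep f) Z (vec_lambda \<delta>) - weighted_integral \<phi> f)\<^sup>2) \<le>
        ennreal ((\<Sum>w\<in>?W. (?L w)\<^sup>2) * ?c)" by (rule ennreal_leI)
    also have "\<dots> = (\<Sum>w\<in>?W. ennreal ?c * ennreal ((?L w)\<^sup>2))"
    proof -
      have "ennreal ((\<Sum>w\<in>?W. (?L w)\<^sup>2) * ?c) = ennreal ?c * ennreal (\<Sum>w\<in>?W. (?L w)\<^sup>2)"
        by (subst mult.commute, rule ennreal_mult) (simp_all add: sum_nonneg)
      also have "ennreal (\<Sum>w\<in>?W. (?L w)\<^sup>2) = (\<Sum>w\<in>?W. ennreal ((?L w)\<^sup>2))"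
        by (rule sum_ennreal[symmetric]) simp
      finally show ?thesis by (simp only: sum_distrib_left)
    qed
    also have "\<dots> \<le> (\<Sum>w\<in>?W. ennreal ?c * (ennreal (\<gamma> w) * ?Q w \<delta>))"
    proof (intro sum_mono mult_left_mono)
      fix w
      note [measurable] = E_meas1[of w \<delta>]
      have "ennreal ((?L w)\<^sup>2) = (ennreal (norm (?L w)))\<^sup>2" by (simp add: ennreal_power)
      also have "\<dots> \<le> (\<integral>\<^sup>+t. ennreal (norm (m w t * ?E w \<delta> t)) \<partial>lebesgue_prod w)\<^sup>2"
        by (intro power_mono integral_norm_bound_nn_integral) simp
      also have "(\<integral>\<^sup>+t. ennreal (norm (m w t * ?E w \<delta> t)) \<partial>lebesgue_prod w) =
         (\<integral>\<^sup>+t. ennreal (\<bar>m w t\<bar> * (\<Prod>j\<in>w. \<psi> j (t j))) * ennreal (\<bar>?E w \<delta> t\<bar> * (\<Prod>j\<in>w. inverse (\<psi> j (t j)))) \<partial>lebesgue_prod w)"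
      proof (intro nn_integral_cong)
        fix t
        have "(\<Prod>j\<in>w. \<psi> j (t j)) * (\<Prod>j\<in>w. inverse (\<psi> j (t j))) = 1"
          unfolding prod.distrib[symmetric] using psi_pos by (intro prod.neutral) (auto simp: less_imp_neq[symmetric])
        then have "(\<bar>m w t\<bar> * (\<Prod>j\<in>w. \<psi> j (t j))) * (\<bar>?E w \<delta> t\<bar> * (\<Prod>j\<in>w. inverse (\<psi> j (t j)))) = \<bar>m w t\<bar> * \<bar>?E w \<delta> t\<bar>"
          by (simp add: mult_ac)
        moreover have "0 \<le> \<bar>m w t\<bar> * (\<Prod>j\<in>w. \<psi> j (t j))" "0 \<le> \<bar>?E w \<delta> t\<bar> * (\<Prod>j\<in>w. inverse (\<psi> j (t j)))"
          by (auto intro!: mult_nonneg_nonneg prod_nonneg simp: psi_pos less_imp_le)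
        ultimately show "ennreal (norm (m w t * ?E w \<delta> t)) =
            ennreal (\<bar>m w t\<bar> * (\<Prod>j\<in>w. \<psi> j (t j))) * ennreal (\<bar>?E w \<delta> t\<bar> * (\<Prod>j\<in>w. inverse (\<psi> j (t j))))"
          by (simp only: ennreal_mult[symmetric] real_norm_def abs_mult)
      qed
      also have "\<dots>\<^sup>2 \<le> (\<integral>\<^sup>+t. (ennreal (\<bar>m w t\<bar> * (\<Prod>j\<in>w. \<psi> j (t j))))\<^sup>2 \<partial>lebesgue_prod w) *
          (\<integral>\<^sup>+t. (ennreal (\<bar>?E w \<delta> t\<bar> * (\<Prod>j\<in>w. inverse (\<psi> j (t j)))))\<^sup>2 \<partial>lebesgue_prod w)"
        by (rule Cauchy_Schwarz_nn_integral) measurable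
      also have "\<dots> = (\<integral>\<^sup>+t. ennreal ((m w t)\<^sup>2 * (\<Prod>j\<in>w. (\<psi> j (t j))\<^sup>2)) \<partial>lebesgue_prod w) * ?Q w \<delta>"
        by (simp add: ennreal_power prod_nonneg psi_pos less_imp_le power_mult_distrib prod_power_distrib)
      also have "\<dots> \<le> ennreal (\<gamma> w) * ?Q w \<delta>" by (intro mult_right_mono m_norm) simp
      finally show "ennreal ((?L w)\<^sup>2) \<le> ennreal (\<gamma> w) * ?Q w \<delta>" .
    qed simp
    finally show ?thesis .
  qed
  have Q_meas [measurable]: "?Q w \<in> borel_measurable (lebesgue_prod UNIV)" for w
  proof -
    interpret P: pair_sigma_finite "lebesgue_prod (UNIV :: 'n set)" "lebesgue_prod w"
      by (rule pair_sigma_finite_lebesgue_prod) auto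
    have "(\<lambda>x. ?E w (fst x) (snd x)) \<in> borel_measurable (lebesgue_prod UNIV \<Otimes>\<^sub>M lebesgue_prod w)"
      unfolding shifted_average_def by measurable
    then show ?thesis by (intro P.M2.borel_measurable_nn_integral) (simp add: split_beta')
  qed
  have "(\<integral>\<^sup>+\<Delta>. ennreal ((lattice_rule \<phi> N (cont_rep f) Z \<Delta> - weighted_integral \<phi> f)\<^sup>2) \<partial>uniform_measure lborel unit_cube) =
     (\<integral>\<^sup>+\<delta>. ennreal ((lattice_rule \<phi> N (cont_rep f) Z (vec_lambda \<delta>) - weighted_integral \<phi> f)\<^sup>2) * ennreal (?cube \<delta>) \<partial>lebesgue_prod UNIV)"
    by (rule nn_integral_unit_cube) measurable
  also have "\<dots> \<le> (\<integral>\<^sup>+\<delta>. (\<Sum>w\<in>?W. ennreal ?c * (ennreal (\<gamma> w) * (?Q w \<delta> * ennreal (?cube \<delta>)))) \<partial>lebesgue_prod UNIV)"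
  proof (rule nn_integral_mono_AE)
    show "AE \<delta> in lebesgue_prod UNIV. ennreal ((lattice_rule \<phi> N (cont_rep f) Z (vec_lambda \<delta>) - weighted_integral \<phi> f)\<^sup>2) * ennreal (?cube \<delta>)
        \<le> (\<Sum>w\<in>?W. ennreal ?c * (ennreal (\<gamma> w) * (?Q w \<delta> * ennreal (?cube \<delta>))))"
      using AE_nodes_nonzero[of N Z]
    proof eventually_elim
      case (elim \<delta>)
      from mult_right_mono[OF pointwise[OF elim], of "ennreal (?cube \<delta>)"] show ?case
        by (simp add: sum_distrib_right mult.assoc)
    qed
  qed
  also have "\<dots> = (\<Sum>w\<in>?W. ennreal ?c * (ennreal (\<gamma> w) * (\<integral>\<^sup>+\<delta>. ?Q w \<delta> * ennreal (?cube \<delta>) \<partial>lebesgue_prod UNIV)))"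
    by (subst nn_integral_sum) (simp_all add: nn_integral_cmult)
  finally show ?thesis by (simp only: shifted_average_sq_integral[OF N])
qed

end

section \<open>The median of independent estimators\<close>

lemma length_filter_sort: "length (filter P (sort xs)) = length (filter P xs)"
proof -
  have "mset (filter P (sort xs)) = mset (filter P xs)" by (simp add: mset_filter)
  then show ?thesis by (rule mset_eq_length)
qed

text \<open>If c is at most the median, the upper half of the sorted list is at least as far from c
  as the median; otherwise the lower half is. Either half includes the median itself, hence the +
  1.\<close>

lemma card_ge_median:
  fixes xs :: "real list"
  assumes "odd (length xs)"
  shows "card {l. l < length xs \<and> \<bar>median xs - c\<bar> \<le> \<bar>xs ! l - c\<bar>} \<ge> length xs div 2 + 1"
proof -
  define k where "k = length xs"
  define m where "m = k div 2"
  define s where "s = sort xs"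
  have k: "k = 2 * m + 1" using assms by (simp add: m_def k_def)
  have len: "length s = k" by (simp add: s_def k_def)
  have mono: "s ! i \<le> s ! j" if "i \<le> j" "j < k" for i j
    using that sorted_nth_mono[of s i j] by (simp add: s_def k_def)
  have med: "median xs = s ! m" by (simp add: median_def s_def m_def k_def)
  let ?P = "\<lambda>x. \<bar>median xs - c\<bar> \<le> \<bar>x - c\<bar>"
  have "m + 1 \<le> card {i. i < k \<and> ?P (s ! i)}"
  proof (cases "c \<le> s ! m")
    case True
    have "{m..<k} \<subseteq> {i. i < k \<and> ?P (s ! i)}"
    proof
      fix i assume "i \<in> {m..<k}"
      then have "s ! m \<le> s ! i" "i < k" using mono[of m i] by auto
      then show "i \<in> {i. i < k \<and> ?P (s ! i)}" using True by (auto simp: med)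
    qed
    then have "card {m..<k} \<le> card {i. i < k \<and> ?P (s ! i)}" by (intro card_mono) auto
    then show ?thesis using k by simp
  next
    case False
    have "{..m} \<subseteq> {i. i < k \<and> ?P (s ! i)}"
    proof
      fix i assume "i \<in> {..m}"
      then have "s ! i \<le> s ! m" "i < k" using mono[of i m] k by auto
      then show "i \<in> {i. i < k \<and> ?P (s ! i)}" using False by (auto simp: med)
    qed
    then have "card {..m} \<le> card {i. i < k \<and> ?P (s ! i)}" by (intro card_mono) auto
    then show ?thesis by simp
  qed
  also have "card {i. i < k \<and> ?P (s ! i)} = length (filter ?P s)"
    by (simp only: length_filter_conv_card len)
  also have "\<dots> = length (filter ?P xs)" unfolding s_def by (rule length_filter_sort)
  also have "\<dots> = card {l. l < length xs \<and> ?P (xs ! l)}" by (simp only: length_filter_conv_card)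
  finally show ?thesis by (simp only: m_def k_def)
qed

text \<open>If the median deviates by more than \<open>a\<close>, then so do \<open>k div 2 + 1\<close> indices at least as badly as the
  median itself; the sum runs over the candidate index sets. Singling out one index leaves
  \<open>k div 2\<close> independent tail events.\<close>

lemma median_deviation_le:
  fixes f :: "nat \<Rightarrow> real"
  assumes k: "odd k" and a: "a \<ge> 0"
  shows "\<bar>median (map f [0..<k]) - c\<bar> \<le>
    a + (\<Sum>S | S \<subseteq> {..<k} \<and> card S = k div 2 + 1. \<bar>f (Min S) - c\<bar> * (\<Prod>l\<in>S-{Min S}. indicator {x. a < \<bar>x - c\<bar>} (f l)))"
proof (cases "\<bar>median (map f [0..<k]) - c\<bar> \<le> a")
  case True
  have "0 \<le> (\<Sum>S | S \<subseteq> {..<k} \<and> card S = k div 2 + 1. \<bar>f (Min S) - c\<bar> * (\<Prod>l\<in>S-{Min S}. indicator {x. a < \<bar>x - c\<bar>} (f l)))"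
    by (intro sum_nonneg mult_nonneg_nonneg prod_nonneg) simp_all
  with True show ?thesis by linarith
next
  case False
  let ?M = "\<bar>median (map f [0..<k]) - c\<bar>"
  let ?term = "\<lambda>S. \<bar>f (Min S) - c\<bar> * (\<Prod>l\<in>S-{Min S}. indicator {x. a < \<bar>x - c\<bar>} (f l)) :: real"
  have "{l. l < length (map f [0..<k]) \<and> ?M \<le> \<bar>map f [0..<k] ! l - c\<bar>} = {l. l < k \<and> ?M \<le> \<bar>f l - c\<bar>}" by auto
  then have "k div 2 + 1 \<le> card {l. l < k \<and> ?M \<le> \<bar>f l - c\<bar>}"
    using card_ge_median[of "map f [0..<k]" c] k by simp
  then obtain S where S: "S \<subseteq> {l. l < k \<and> ?M \<le> \<bar>f l - c\<bar>}" "card S = k div 2 + 1"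
    by (rule obtain_subset_with_card_n)
  from S(2) have "card S > 0" by simp
  then have fin: "finite S" "S \<noteq> {}" by (simp_all add: card_gt_0_iff)
  have "?M \<le> \<bar>f (Min S) - c\<bar>" using S(1) Min_in[OF fin] by auto
  also have "\<dots> = ?term S"
  proof -
    have "(\<Prod>l\<in>S-{Min S}. indicator {x. a < \<bar>x - c\<bar>} (f l)) = (1 :: real)"
      using S(1) False by (intro prod.neutral) (auto simp: indicator_def)
    then show ?thesis by simp
  qed
  also have "\<dots> \<le> (\<Sum>S | S \<subseteq> {..<k} \<and> card S = k div 2 + 1. ?term S)"
  proof (rule member_le_sum)
    show "finite {S. S \<subseteq> {..<k} \<and> card S = k div 2 + 1}" by (rule finite_subset[of _ "Pow {..<k}"]) auto
    show "0 \<le> ?term S" for S by (intro mult_nonneg_nonneg prod_nonneg) simp_all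
  qed (use S in auto)
  finally show ?thesis using a by linarith
qed

text \<open>The error of an estimator is unbounded, so one index pays with its first moment A and
  \<open>k div 2\<close> others with the tail probability p; independence multiplies these costs.
  The power of 2 bounds the number of candidate index sets.\<close>

theorem median_expected_error:
  fixes X :: "'a \<Rightarrow> real"
  assumes M: "prob_space M" and X [measurable]: "X \<in> borel_measurable M"
    and k: "odd k" and a: "a \<ge> 0"
    and A: "(\<integral>\<^sup>+x. ennreal \<bar>X x - c\<bar> \<partial>M) \<le> A"
    and p: "emeasure M {x \<in> space M. a < \<bar>X x - c\<bar>} \<le> p"
  shows "(\<integral>\<^sup>+\<omega>. ennreal \<bar>median (map (\<lambda>l. X (\<omega> l)) [0..<k]) - c\<bar> \<partial>Pi\<^sub>M {..<k} (\<lambda>_. M)) \<le>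
    ennreal a + 2 ^ k * (A * p ^ (k div 2))"
proof -
  interpret prob_space M by (rule M)
  interpret P: product_prob_space "\<lambda>_::nat. M" by unfold_locales
  let ?Q = "Pi\<^sub>M {..<k} (\<lambda>_. M)"
  let ?\<S> = "{S. S \<subseteq> {..<k} \<and> card S = k div 2 + 1}"
  let ?I = "indicator {x. a < \<bar>x - c\<bar>} :: real \<Rightarrow> real"
  have fin\<S>: "finite ?\<S>" by (rule finite_subset[of _ "Pow {..<k}"]) auto
  \<comment> \<open>Writing each term as a product over all l < k, with factor 1 outside S, lets its
    integral over the product measure factor.\<close>
  define g where "g S l = (if l = Min S then (\<lambda>x. ennreal \<bar>X x - c\<bar>) else if l \<in> S then (\<lambda>x. ennreal (?I (X x))) else (\<lambda>_. 1))" for S and l :: nat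
  have g_meas: "g S l \<in> borel_measurable M" for S l
    unfolding g_def by (auto intro!: measurable_compose[OF X])
  have term_eq: "ennreal (\<bar>X (\<omega> (Min S)) - c\<bar> * (\<Prod>l\<in>S-{Min S}. ?I (X (\<omega> l)))) = (\<Prod>l\<in>{..<k}. g S l (\<omega> l))"
    if S: "S \<in> ?\<S>" for S \<omega>
  proof -
    have "card S > 0" using S by simp
    then have fin: "finite S" "S \<noteq> {}" by (simp_all add: card_gt_0_iff)
    have min: "Min S \<in> S" by (rule Min_in[OF fin])
    have "(\<Prod>l\<in>{..<k}. g S l (\<omega> l)) = (\<Prod>l\<in>S. g S l (\<omega> l))"
      using S min by (intro prod.mono_neutral_right) (auto simp: g_def)
    also have "\<dots> = g S (Min S) (\<omega> (Min S)) * (\<Prod>l\<in>S-{Min S}. g S l (\<omega> l))"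
      by (rule prod.remove[OF fin(1) min])
    also have "(\<Prod>l\<in>S-{Min S}. g S l (\<omega> l)) = (\<Prod>l\<in>S-{Min S}. ennreal (?I (X (\<omega> l))))"
      by (intro prod.cong) (auto simp: g_def)
    also have "\<dots> = ennreal (\<Prod>l\<in>S-{Min S}. ?I (X (\<omega> l)))" by (rule prod_ennreal) simp
    finally show ?thesis by (simp add: g_def ennreal_mult prod_nonneg)
  qed
  have term_int: "(\<integral>\<^sup>+\<omega>. (\<Prod>l\<in>{..<k}. g S l (\<omega> l)) \<partial>?Q) \<le> A * p ^ (k div 2)" if S: "S \<in> ?\<S>" for S
  proof -
    have "card S > 0" using S by simp
    then have fin: "finite S" "S \<noteq> {}" by (simp_all add: card_gt_0_iff)
    have min: "Min S \<in> S" by (rule Min_in[OF fin])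
    have "(\<integral>\<^sup>+\<omega>. (\<Prod>l\<in>{..<k}. g S l (\<omega> l)) \<partial>?Q) = (\<Prod>l\<in>{..<k}. \<integral>\<^sup>+x. g S l x \<partial>M)"
      by (rule P.product_nn_integral_prod) (auto intro: g_meas)
    also have "\<dots> = (\<Prod>l\<in>S. \<integral>\<^sup>+x. g S l x \<partial>M)"
      using S min by (intro prod.mono_neutral_right) (auto simp: g_def emeasure_space_1)
    also have "\<dots> = (\<integral>\<^sup>+x. g S (Min S) x \<partial>M) * (\<Prod>l\<in>S-{Min S}. \<integral>\<^sup>+x. g S l x \<partial>M)"
      by (rule prod.remove[OF fin(1) min])
    also have "(\<Prod>l\<in>S-{Min S}. \<integral>\<^sup>+x. g S l x \<partial>M) = (\<Prod>l\<in>S-{Min S}. emeasure M {x \<in> space M. a < \<bar>X x - c\<bar>})"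
    proof (intro prod.cong refl)
      fix l assume "l \<in> S - {Min S}"
      then have "(\<integral>\<^sup>+x. g S l x \<partial>M) = (\<integral>\<^sup>+x. indicator {x \<in> space M. a < \<bar>X x - c\<bar>} x \<partial>M)"
        by (intro nn_integral_cong) (auto simp: g_def indicator_def)
      then show "(\<integral>\<^sup>+x. g S l x \<partial>M) = emeasure M {x \<in> space M. a < \<bar>X x - c\<bar>}" by simp
    qed
    also have "(\<integral>\<^sup>+x. g S (Min S) x \<partial>M) * (\<Prod>l\<in>S-{Min S}. emeasure M {x \<in> space M. a < \<bar>X x - c\<bar>}) \<le> A * p ^ (k div 2)"
    proof (rule mult_mono)
      show "(\<integral>\<^sup>+x. g S (Min S) x \<partial>M) \<le> A" using A by (simp add: g_def)
      have "card (S - {Min S}) = k div 2" using S fin min by simp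
      then show "(\<Prod>l\<in>S-{Min S}. emeasure M {x \<in> space M. a < \<bar>X x - c\<bar>}) \<le> p ^ (k div 2)"
        by (simp add: power_mono p)
    qed simp_all
    finally show ?thesis .
  qed
  have card\<S>: "of_nat (card ?\<S>) \<le> (2 ^ k :: ennreal)"
  proof -
    have "card ?\<S> \<le> card (Pow {..<k})" by (rule card_mono) auto
    then have "card ?\<S> \<le> 2 ^ k" by (simp add: card_Pow)
    then have "of_nat (card ?\<S>) \<le> (of_nat (2 ^ k) :: ennreal)" by (simp only: of_nat_le_iff)
    then show ?thesis by simp
  qed
  have "(\<integral>\<^sup>+\<omega>. ennreal \<bar>median (map (\<lambda>l. X (\<omega> l)) [0..<k]) - c\<bar> \<partial>?Q) \<le>
     (\<integral>\<^sup>+\<omega>. ennreal a + (\<Sum>S\<in>?\<S>. \<Prod>l\<in>{..<k}. g S l (\<omega> l)) \<partial>?Q)"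
  proof (rule nn_integral_mono)
    fix \<omega>
    have "ennreal \<bar>median (map (\<lambda>l. X (\<omega> l)) [0..<k]) - c\<bar> \<le>
      ennreal (a + (\<Sum>S\<in>?\<S>. \<bar>X (\<omega> (Min S)) - c\<bar> * (\<Prod>l\<in>S-{Min S}. ?I (X (\<omega> l)))))"
      by (intro ennreal_leI median_deviation_le[OF k a])
    also have "\<dots> = ennreal a + (\<Sum>S\<in>?\<S>. ennreal (\<bar>X (\<omega> (Min S)) - c\<bar> * (\<Prod>l\<in>S-{Min S}. ?I (X (\<omega> l)))))"
      using a by (simp add: sum_ennreal sum_nonneg prod_nonneg)
    also have "\<dots> = ennreal a + (\<Sum>S\<in>?\<S>. \<Prod>l\<in>{..<k}. g S l (\<omega> l))"
      by (intro arg_cong2[where f = "(+)"] refl sum.cong term_eq)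
    finally show "ennreal \<bar>median (map (\<lambda>l. X (\<omega> l)) [0..<k]) - c\<bar> \<le> ennreal a + (\<Sum>S\<in>?\<S>. \<Prod>l\<in>{..<k}. g S l (\<omega> l))" .
  qed
  also have "\<dots> = ennreal a + (\<Sum>S\<in>?\<S>. \<integral>\<^sup>+\<omega>. (\<Prod>l\<in>{..<k}. g S l (\<omega> l)) \<partial>?Q)"
  proof -
    interpret Q: prob_space ?Q by (intro prob_space_PiM M)
    have [measurable]: "(\<lambda>\<omega>. \<Prod>l\<in>{..<k}. g S l (\<omega> l)) \<in> borel_measurable ?Q" for S
    proof (rule borel_measurable_prod_ennreal)
      fix l assume "l \<in> {..<k}"
      then show "(\<lambda>\<omega>. g S l (\<omega> l)) \<in> borel_measurable ?Q"
        by (rule measurable_compose[OF measurable_component_singleton[of l "{..<k}" "\<lambda>_. M"] g_meas[of S l]])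
    qed
    show ?thesis by (simp add: nn_integral_add nn_integral_sum Q.emeasure_space_1)
  qed
  also have "\<dots> \<le> ennreal a + (\<Sum>S\<in>?\<S>. A * p ^ (k div 2))"
    by (intro add_left_mono sum_mono term_int)
  also have "\<dots> = ennreal a + of_nat (card ?\<S>) * (A * p ^ (k div 2))" by simp
  also have "\<dots> \<le> ennreal a + 2 ^ k * (A * p ^ (k div 2))"
    by (intro add_left_mono mult_right_mono card\<S>) simp
  finally show ?thesis .
qed

section \<open>The error of the median rule\<close>

text \<open>A crude bound, uniform in N and Z, for the first moment, which has to cover the bad
  generators as well.\<close>

lemma dual_sum_le_zeta: "dual_sum N w \<alpha> Z \<le> zeta_sum \<alpha> ^ card w"
proof -
  have "dual_sum N w \<alpha> Z \<le> (\<integral>\<^sup>+h. (\<Prod>j\<in>w. ennreal (\<bar>real_of_int (h j)\<bar> powr (- \<alpha>))) \<partial>count_space (freqs w))"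
    unfolding dual_sum_def by (intro nn_integral_mono) (auto simp: indicator_def prod_ennreal)
  also have "\<dots> = (\<Prod>j\<in>w. zeta_sum \<alpha>)"
    unfolding count_space_freqs[OF finite] zeta_sum_def
    by (rule freq_prod.product_nn_integral_prod) auto
  finally show ?thesis by simp
qed

text \<open>For k = 2m + 1 the left-hand side is 2 / 4^m. With L = r log_2 N \<ge> 0 the hypothesis
  gives 2m \<ge> 4L - 2 \<ge> L - 2, so 4^m \<ge> N^r / 4; the constant 8 is 2 times 4.\<close>

lemma four_power_ge:
  assumes N: "N > 0" and r: "r \<ge> 0" and k: "odd k" "int k \<ge> 4 * \<lceil>r * log 2 (real N)\<rceil> - 1"
  shows "2 ^ k * (1 / 16 :: real) ^ (k div 2) \<le> 8 * real N powr (- r)"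
proof -
  define m where "m = k div 2"
  have km: "k = 2 * m + 1" using k(1) by (simp add: m_def)
  have "r * log 2 (real N) \<le> of_int \<lceil>r * log 2 (real N)\<rceil>" by simp
  moreover have "of_int (4 * \<lceil>r * log 2 (real N)\<rceil> - 1) \<le> real k" using k(2) by linarith
  ultimately have "4 * (r * log 2 (real N)) - 2 \<le> 2 * real m" using km by linarith
  moreover have "0 \<le> r * log 2 (real N)" using N r by simp
  ultimately have "r * log 2 (real N) - 2 \<le> 2 * real m" by linarith
  then have "2 powr (r * log 2 (real N) - 2) \<le> 2 powr (2 * real m)" by (rule powr_mono) simp
  also have "2 powr (2 * real m) = (4 :: real) ^ m"
  proof -
    have "2 powr (2 * real m) = (2 powr 2) powr real m" by (simp only: powr_powr)
    then show ?thesis by (simp add: powr_realpow)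
  qed
  also have "2 powr (r * log 2 (real N) - 2) = real N powr r / 4"
  proof -
    have "2 powr (r * log 2 (real N)) = (2 powr log 2 (real N)) powr r" by (simp add: powr_powr mult.commute)
    then show ?thesis using N by (simp add: powr_diff)
  qed
  finally have "real N powr r / 4 \<le> 4 ^ m" .
  then have "1 / 4 ^ m \<le> 4 * real N powr (- r)"
    using N by (simp add: powr_minus field_simps)
  moreover have "2 ^ k * (1 / 16 :: real) ^ m = 2 * (1 / 4 ^ m)"
  proof -
    have "(2::real) ^ (2 * m) = 4 ^ m" by (simp add: power_mult)
    moreover have "(16::real) ^ m = 4 ^ m * 4 ^ m" by (simp add: power_mult_distrib[symmetric])
    ultimately show ?thesis by (simp add: km power_divide)
  qed
  ultimately show ?thesis by (simp add: m_def)
qed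

section \<open>Tail and first moment of a random rule, and the choice of constants\<close>

context sobolev_weights
begin

abbreviation shift_law :: "(real ^ 'n) measure" where
  "shift_law \<equiv> uniform_measure lborel unit_cube"

abbreviation rule_law :: "nat \<Rightarrow> ((nat ^ 'n) \<times> (real ^ 'n)) measure" where
  "rule_law N \<equiv> measure_pmf (pmf_of_set (generators N)) \<Otimes>\<^sub>M shift_law"

lemma prob_space_shift_law: "prob_space shift_law"
  by (intro prob_space_uniform_measure) (simp_all add: emeasure_unit_cube)

lemma prob_space_rule_law: "prob_space (rule_law N)"
proof -
  interpret S: prob_space shift_law by (rule prob_space_shift_law)
  interpret P: pair_prob_space "measure_pmf (pmf_of_set (generators N :: (nat ^ 'n) set))" shift_law ..
  show ?thesis by (rule P.prob_space_axioms)
qed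

lemma lattice_rule_pair_measurable:
  assumes f [measurable]: "f \<in> borel_measurable borel"
  shows "(\<lambda>x. lattice_rule \<phi> N f (fst x) (snd x)) \<in> borel_measurable (rule_law N)"
proof -
  have 1: "(\<lambda>x. real n * real (fst x $ j) / real N + snd x $ j) \<in> borel_measurable (rule_law N)" for n and j :: 'n
  proof (rule borel_measurable_add)
    show "(\<lambda>x. real n * real (fst x $ j) / real N) \<in> borel_measurable (rule_law N)"
      by (rule measurable_compose[OF measurable_fst]) simp
    show "(\<lambda>x. snd x $ j) \<in> borel_measurable (rule_law N)"
      by (rule measurable_compose[OF measurable_snd]) simp
  qed
  have 2: "(\<lambda>x. (\<chi> j. quantile (frac (real n * real (fst x $ j) / real N + snd x $ j)))) \<in> borel_measurable (rule_law N)" for n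
  proof (subst borel_measurable_euclidean_space, intro ballI)
    fix i :: "real ^ 'n" assume "i \<in> Basis"
    then obtain j where i: "i = axis j 1" by (auto simp: Basis_vec_def)
    have "(\<lambda>x. quantile (frac (real n * real (fst x $ j) / real N + snd x $ j))) \<in> borel_measurable (rule_law N)"
      by (intro measurable_compose[OF measurable_compose[OF 1 frac_measurable] quantile_measurable])
    then show "(\<lambda>x. (\<chi> j. quantile (frac (real n * real (fst x $ j) / real N + snd x $ j))) \<bullet> i) \<in> borel_measurable (rule_law N)"
      by (simp add: i inner_axis)
  qed
  show ?thesis
    unfolding lattice_rule_def quantile_def[symmetric]
    by (intro borel_measurable_times borel_measurable_const borel_measurable_sum measurable_compose[OF 2 f])
qed

lemma nn_integral_rule_law:
  assumes N: "N > 0" and F: "F \<in> borel_measurable (rule_law N)"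
  shows "(\<integral>\<^sup>+x. F x \<partial>rule_law N) = (\<Sum>Z\<in>generators N. \<integral>\<^sup>+\<Delta>. F (Z, \<Delta>) \<partial>shift_law) / of_nat (card (generators N :: (nat ^ 'n) set))"
proof -
  interpret S: prob_space shift_law by (rule prob_space_shift_law)
  have "(\<integral>\<^sup>+x. F x \<partial>rule_law N) = (\<integral>\<^sup>+Z. (\<integral>\<^sup>+\<Delta>. F (Z, \<Delta>) \<partial>shift_law) \<partial>measure_pmf (pmf_of_set (generators N)))"
    by (rule S.nn_integral_fst[symmetric, OF F])
  also have "\<dots> = (\<Sum>Z\<in>generators N. \<integral>\<^sup>+\<Delta>. F (Z, \<Delta>) \<partial>shift_law) / of_nat (card (generators N :: (nat ^ 'n) set))"
    using nn_integral_pmf_of_set[OF generators_nonempty[OF N] finite_generators, of "\<lambda>Z. \<integral>\<^sup>+\<Delta>. F (Z, \<Delta>) \<partial>shift_law"]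
    by (simp add: ennreal_of_nat_eq_real_of_nat)
  finally show ?thesis .
qed

lemma mean_square_error_dual:
  assumes f: "f \<in> sobolev_space \<phi> \<gamma> \<psi>" and \<gamma>: "\<And>u. \<gamma> u > 0" and norm: "sobolev_norm \<phi> \<gamma> \<psi> f \<le> 1" and N: "N > 0"
    and D: "D \<ge> 1" "\<And>j h. h \<noteq> 0 \<Longrightarrow> theta_hat \<phi> (\<psi> j) h \<le> D * \<bar>real_of_int h\<bar> powr (- s)"
  shows "(\<integral>\<^sup>+\<Delta>. ennreal ((lattice_rule \<phi> N (cont_rep f) Z \<Delta> - weighted_integral \<phi> f)\<^sup>2) \<partial>shift_law) \<le>
    ennreal (real (card (UNIV :: 'n set set)) * ((\<Sum>w\<in>UNIV. \<gamma> w) * D ^ CARD('n))) * (\<Sum>w\<in>UNIV-{{}}. dual_sum N w s Z)"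
proof -
  let ?c = "real (card (UNIV :: 'n set set))" and ?\<Gamma> = "\<Sum>w\<in>UNIV. \<gamma> w"
  have \<Gamma>: "?\<Gamma> \<ge> 0" by (intro sum_nonneg) (simp add: \<gamma> less_imp_le)
  have "(\<integral>\<^sup>+h. ennreal (\<Prod>j\<in>w. theta_hat \<phi> (\<psi> j) (h j)) *
       indicator {h. int N dvd (\<Sum>j\<in>w. h j * int (Z $ j))} h \<partial>count_space (freqs w)) \<le>
      ennreal (D ^ CARD('n)) * dual_sum N w s Z" for w
  proof -
    let ?I = "{h. int N dvd (\<Sum>j\<in>w. h j * int (Z $ j))}"
    let ?P = "\<lambda>h. \<Prod>j\<in>w. \<bar>real_of_int (h j)\<bar> powr (- s)"
    have "(\<integral>\<^sup>+h. ennreal (\<Prod>j\<in>w. theta_hat \<phi> (\<psi> j) (h j)) * indicator ?I h \<partial>count_space (freqs w)) \<le>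
      (\<integral>\<^sup>+h. ennreal (D ^ CARD('n)) * (ennreal (?P h) * indicator ?I h) \<partial>count_space (freqs w))"
    proof (rule nn_integral_mono)
      fix h assume "h \<in> space (count_space (freqs w))"
      then have h: "h j \<noteq> 0" if "j \<in> w" for j using that by (auto simp: PiE_iff)
      have "(\<Prod>j\<in>w. theta_hat \<phi> (\<psi> j) (h j)) \<le> (\<Prod>j\<in>w. D * \<bar>real_of_int (h j)\<bar> powr (- s))"
        by (intro prod_mono conjI jump_coeff_integral(2) D(2) h)
      also have "\<dots> = D ^ card w * ?P h" by (simp add: prod.distrib)
      also have "\<dots> \<le> D ^ CARD('n) * ?P h"
        using D(1) by (intro mult_right_mono power_increasing card_mono prod_nonneg) auto
      finally have "ennreal (\<Prod>j\<in>w. theta_hat \<phi> (\<psi> j) (h j)) \<le> ennreal (D ^ CARD('n)) * ennreal (?P h)"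
        using D(1) by (simp add: ennreal_mult[symmetric] prod_nonneg ennreal_leI)
      then show "ennreal (\<Prod>j\<in>w. theta_hat \<phi> (\<psi> j) (h j)) * indicator ?I h \<le>
          ennreal (D ^ CARD('n)) * (ennreal (?P h) * indicator ?I h)"
        unfolding mult.assoc[symmetric] by (rule mult_right_mono) simp
    qed
    also have "\<dots> = ennreal (D ^ CARD('n)) * dual_sum N w s Z"
      unfolding dual_sum_def by (rule nn_integral_cmult) simp
    finally show ?thesis .
  qed
  note le = this
  have "(\<integral>\<^sup>+\<Delta>. ennreal ((lattice_rule \<phi> N (cont_rep f) Z \<Delta> - weighted_integral \<phi> f)\<^sup>2) \<partial>shift_law) \<le>
    (\<Sum>w\<in>UNIV-{{}}. ennreal ?c * (ennreal (\<gamma> w) * (\<integral>\<^sup>+h. ennreal (\<Prod>j\<in>w. theta_hat \<phi> (\<psi> j) (h j)) *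
       indicator {h. int N dvd (\<Sum>j\<in>w. h j * int (Z $ j))} h \<partial>count_space (freqs w))))"
    by (rule mean_square_error_le[OF f \<gamma> norm N])
  also have "\<dots> \<le> (\<Sum>w\<in>UNIV-{{}}. ennreal ?c * (ennreal ?\<Gamma> * (ennreal (D ^ CARD('n)) * dual_sum N w s Z)))"
  proof (intro sum_mono mult_left_mono mult_mono le)
    fix w show "ennreal (\<gamma> w) \<le> ennreal ?\<Gamma>"
      by (intro ennreal_leI member_le_sum) (auto simp: \<gamma> less_imp_le)
  qed simp_all
  also have "\<dots> = ennreal (?c * (?\<Gamma> * D ^ CARD('n))) * (\<Sum>w\<in>UNIV-{{}}. dual_sum N w s Z)"
    using \<Gamma> D(1) by (simp add: ennreal_mult sum_distrib_left mult.assoc)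
  finally show ?thesis .
qed

text \<open>Chebyshev's inequality over the shift alone, to be applied with the generator
  fixed.\<close>

lemma shift_tail_le:
  assumes meas: "Y \<in> borel_measurable borel" and a: "a > 0"
  shows "emeasure shift_law {\<Delta> \<in> space shift_law. a < \<bar>Y \<Delta> - c\<bar>} \<le>
    ennreal (1 / a\<^sup>2) * (\<integral>\<^sup>+\<Delta>. ennreal ((Y \<Delta> - c)\<^sup>2) \<partial>shift_law)"
proof -
  have [measurable]: "Y \<in> borel_measurable shift_law" using meas by simp
  have "emeasure shift_law {\<Delta> \<in> space shift_law. a < \<bar>Y \<Delta> - c\<bar>} =
      (\<integral>\<^sup>+\<Delta>. indicator {\<Delta> \<in> space shift_law. a < \<bar>Y \<Delta> - c\<bar>} \<Delta> \<partial>shift_law)"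
    by (rule nn_integral_indicator[symmetric]) measurable
  also have "\<dots> \<le> (\<integral>\<^sup>+\<Delta>. ennreal (1 / a\<^sup>2) * ennreal ((Y \<Delta> - c)\<^sup>2) \<partial>shift_law)"
  proof (rule nn_integral_mono)
    fix \<Delta>
    have "1 \<le> 1 / a\<^sup>2 * (Y \<Delta> - c)\<^sup>2" if "a < \<bar>Y \<Delta> - c\<bar>"
    proof -
      have "a\<^sup>2 \<le> \<bar>Y \<Delta> - c\<bar>\<^sup>2" using that a by (intro power_mono) auto
      then show ?thesis using a by (simp add: field_simps)
    qed
    then show "indicator {\<Delta> \<in> space shift_law. a < \<bar>Y \<Delta> - c\<bar>} \<Delta> \<le> ennreal (1 / a\<^sup>2) * ennreal ((Y \<Delta> - c)\<^sup>2)"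
      by (auto simp: indicator_def ennreal_mult[symmetric])
  qed
  also have "\<dots> = ennreal (1 / a\<^sup>2) * (\<integral>\<^sup>+\<Delta>. ennreal ((Y \<Delta> - c)\<^sup>2) \<partial>shift_law)"
    by (rule nn_integral_cmult) measurable
  finally show ?thesis .
qed

theorem median_rule_error:
  assumes \<gamma>: "\<And>u. \<gamma> u > 0" and r: "r > 1 / 2" and \<epsilon>: "0 < \<epsilon>" "\<epsilon> \<le> r - 1 / 2"
    and D: "D \<ge> 1" "\<And>j h. h \<noteq> 0 \<Longrightarrow> theta_hat \<phi> (\<psi> j) h \<le> D * \<bar>real_of_int h\<bar> powr (- (2 * r))"
  obtains c where "c > 0" "\<And>N k f. N > 0 \<Longrightarrow> odd k \<Longrightarrow> int k \<ge> 4 * \<lceil>r * log 2 (real N)\<rceil> - 1 \<Longrightarrow>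
      f \<in> sobolev_space \<phi> \<gamma> \<psi> \<Longrightarrow> sobolev_norm \<phi> \<gamma> \<psi> f \<le> 1 \<Longrightarrow>
      (\<integral>\<^sup>+\<omega>. ennreal \<bar>median_rule \<phi> N k f \<omega> - weighted_integral \<phi> f\<bar> \<partial>sample_measure N k)
        \<le> ennreal (c * real N powr (- r + \<epsilon>))"
proof -
  txt \<open>The exponents are chosen such that \<open>p * \<alpha> = 2 * r\<close> and \<open>p * (\<delta> - 1) = - 2 * (r - \<epsilon>)\<close>, with
    \<open>\<alpha> > 1\<close>, \<open>\<delta> > 0\<close> and \<open>p \<ge> 1\<close>.\<close>
  define q where "q = (r - \<epsilon>) / r"
  have q: "0 < q" "q < 1" using r \<epsilon> by (auto simp: q_def)
  \<comment> \<open>The loss factor q is shared evenly, one square root for \<alpha> and one for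
    \<delta>: then p = 2r/\<alpha> and p (1 - \<delta>) = 2rq = 2(r - \<epsilon>).\<close>
  define \<alpha> where "\<alpha> = 1 / sqrt q"
  define \<delta> where "\<delta> = 1 - sqrt q"
  define p where "p = 2 * r * sqrt q"
  have \<alpha>: "\<alpha> > 1" using q by (simp add: \<alpha>_def)
  have \<delta>: "\<delta> > 0" using q by (simp add: \<delta>_def)
  have p\<alpha>: "p * \<alpha> = 2 * r" using q by (simp add: p_def \<alpha>_def)
  have p\<delta>: "p * (\<delta> - 1) = - 2 * (r - \<epsilon>)"
    using q r by (simp add: p_def \<delta>_def mult.assoc) (simp add: q_def field_simps)
  \<comment> \<open>Here \<epsilon> \<le> r - 1/2 enters: p^2 = (2r)(2(r - \<epsilon>)), and both
    factors are at least 1.\<close>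
  have p1: "p \<ge> 1"
  proof -
    have "1 \<le> (2 * r) * (2 * (r - \<epsilon>))" using r \<epsilon> mult_mono[of 1 "2 * r" 1 "2 * (r - \<epsilon>)"] by simp
    also have "\<dots> = p\<^sup>2" using q r by (simp add: p_def power_mult_distrib) (simp add: q_def field_simps power2_eq_square)
    finally show ?thesis
      using q r by (intro power2_le_imp_le[of 1 p]) (auto simp: p_def)
  qed
  obtain C where C: "C > 0" "\<And>N (w :: 'n set). N > 0 \<Longrightarrow> w \<noteq> {} \<Longrightarrow>
    (\<Sum>Z\<in>generators N. dual_sum N w \<alpha> Z) \<le>
      ennreal (C * real N powr (\<delta> - 1) * real (card (generators N :: (nat ^ 'n) set)))"
    by (rule average_dual_sum[OF \<alpha> \<delta>], rule that)
  let ?W = "UNIV - {{}} :: 'n set set"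
  define n where "n = real (card (UNIV :: 'n set set))"
  have n: "n \<ge> 1" "real (card ?W) \<le> n"
  proof -
    have "card (UNIV :: 'n set set) > 0" by (simp add: card_gt_0_iff)
    then show "n \<ge> 1" by (simp add: n_def)
    show "real (card ?W) \<le> n" unfolding n_def of_nat_le_iff by (rule card_mono) auto
  qed
  define K where "K = n * ((\<Sum>w\<in>UNIV. \<gamma> w) * D ^ CARD('n))"
  have K: "K > 0"
  proof -
    have "(\<Sum>w\<in>(UNIV :: 'n set set). \<gamma> w) > 0" by (intro sum_pos) (auto simp: \<gamma>)
    then show ?thesis using n D by (simp add: K_def)
  qed
  \<comment> \<open>The tail budget 1/16 is split in two. By Markov's inequality at most 1/32 of the
    generators have a dual sum above x = B N^(\<delta>-1) at exponent \<alpha>, since the averages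
    over the at most n sets w add up to at most n C N^(\<delta>-1). For the others the mean square
    error is at most K n x^p, and Chebyshev's inequality with a^2 = 32 K n x^p costs another
    1/32.\<close>
  define B where "B = 32 * n * C"
  have B: "B > 0" using n C by (simp add: B_def)
  define a0 where "a0 = sqrt (32 * K * n * B powr p)"
  have a0: "a0 > 0" using K n B by (simp add: a0_def)
  define z where "z = max 1 (enn2real (zeta_sum (2 * r)))"
  have z: "z \<ge> 1" "zeta_sum (2 * r) \<le> ennreal z"
  proof -
    have "zeta_sum (2 * r) = ennreal (enn2real (zeta_sum (2 * r)))" using zeta_sum_finite[of "2 * r"] r by simp
    also have "\<dots> \<le> ennreal z" by (intro ennreal_leI) (simp add: z_def)
    finally show "zeta_sum (2 * r) \<le> ennreal z" .
  qed (simp add: z_def)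
  \<comment> \<open>From |y| \<le> 1 + y^2 and the uniform bound on the dual sums; \<open>z\<close>
    is at least 1, so its powers may be raised to the number of coordinates.\<close>
  define A where "A = 1 + K * (n * z ^ CARD('n))"
  have A: "A > 0" using K n z by (simp add: A_def add_pos_nonneg)
  have main: "(\<integral>\<^sup>+\<omega>. ennreal \<bar>median_rule \<phi> N k f \<omega> - weighted_integral \<phi> f\<bar> \<partial>sample_measure N k)
        \<le> ennreal ((a0 + 8 * A) * real N powr (- r + \<epsilon>))"
    if N: "N > 0" and k: "odd k" "int k \<ge> 4 * \<lceil>r * log 2 (real N)\<rceil> - 1"
      and f: "f \<in> sobolev_space \<phi> \<gamma> \<psi>" and norm: "sobolev_norm \<phi> \<gamma> \<psi> f \<le> 1" for N k f
  proof -
    define I where "I = weighted_integral \<phi> f"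
    define X where "X x = lattice_rule \<phi> N (cont_rep f) (fst x) (snd x)" for x :: "(nat ^ 'n) \<times> (real ^ 'n)"
    have "continuous_on UNIV (cont_rep f)" by (rule sobolev_representation[OF f \<gamma> norm])
    then have fm: "cont_rep f \<in> borel_measurable borel" by (rule borel_measurable_continuous_onI)
    have Xm [measurable]: "X \<in> borel_measurable (rule_law N)"
      unfolding X_def[abs_def] by (rule lattice_rule_pair_measurable[OF fm])
    note Xm1 = lattice_rule_measurable[OF fm, of N]
    let ?G = "generators N :: (nat ^ 'n) set"
    let ?g = "of_nat (card ?G) :: ennreal"
    have g: "card ?G > 0" using generators_nonempty[OF N, where 'n = 'n] finite_generators[of N, where 'n = 'n] by (simp add: card_gt_0_iff)
    have g': "?g \<noteq> 0" "?g \<noteq> \<infinity>" using g by auto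
    let ?mse = "\<lambda>Z. \<integral>\<^sup>+\<Delta>. ennreal ((X (Z, \<Delta>) - I)\<^sup>2) \<partial>shift_law"
    have mse: "?mse Z \<le> ennreal K * (\<Sum>w\<in>?W. dual_sum N w (2 * r) Z)" for Z
      using mean_square_error_dual[OF f \<gamma> norm N D, of Z] by (simp add: X_def I_def K_def n_def)
    define x where "x = B * real N powr (\<delta> - 1)"
    have x: "x > 0" using B N by (simp add: x_def)
    define a where "a = a0 * real N powr (- r + \<epsilon>)"
    have a: "a > 0" using a0 N by (simp add: a_def)
    have a2: "a\<^sup>2 = 32 * (K * (n * x powr p))"
    proof -
      have "(real N powr (- r + \<epsilon>))\<^sup>2 = real N powr (p * (\<delta> - 1))"
        unfolding p\<delta> by (simp add: power2_eq_square powr_add[symmetric] algebra_simps)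
      moreover have "x powr p = B powr p * real N powr (p * (\<delta> - 1))"
        using B by (simp add: x_def powr_mult powr_powr mult.commute)
      moreover have "a0\<^sup>2 = 32 * K * n * B powr p" using K n by (simp add: a0_def)
      ultimately show ?thesis by (simp add: a_def power_mult_distrib mult_ac)
    qed
    have first_moment: "(\<integral>\<^sup>+y. ennreal \<bar>X y - I\<bar> \<partial>rule_law N) \<le> ennreal A"
    proof -
      have inner: "(\<integral>\<^sup>+\<Delta>. ennreal \<bar>X (Z, \<Delta>) - I\<bar> \<partial>shift_law) \<le> ennreal A" for Z
      proof -
        interpret S: prob_space shift_law by (rule prob_space_shift_law)
        have Ym [measurable]: "(\<lambda>\<Delta>. X (Z, \<Delta>)) \<in> borel_measurable shift_law" using Xm1 by (simp add: X_def)
        have "(\<integral>\<^sup>+\<Delta>. ennreal \<bar>X (Z, \<Delta>) - I\<bar> \<partial>shift_law) \<le> (\<integral>\<^sup>+\<Delta>. 1 + ennreal ((X (Z, \<Delta>) - I)\<^sup>2) \<partial>shift_law)"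
        proof (rule nn_integral_mono)
          fix \<Delta>
          have "\<bar>y\<bar> \<le> 1 + y\<^sup>2" for y :: real
          proof (cases "\<bar>y\<bar> \<le> 1")
            case False
            then have "\<bar>y\<bar> * 1 \<le> \<bar>y\<bar> * \<bar>y\<bar>" by (intro mult_left_mono) auto
            then show ?thesis by (simp add: power2_eq_square)
          qed (simp add: add_increasing2)
          then have "ennreal \<bar>X (Z, \<Delta>) - I\<bar> \<le> ennreal (1 + (X (Z, \<Delta>) - I)\<^sup>2)" by (rule ennreal_leI)
          then show "ennreal \<bar>X (Z, \<Delta>) - I\<bar> \<le> 1 + ennreal ((X (Z, \<Delta>) - I)\<^sup>2)" by simp
        qed
        also have "\<dots> = 1 + ?mse Z" by (subst nn_integral_add) (simp_all add: emeasure_unit_cube)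
        also have "\<dots> \<le> 1 + ennreal K * (\<Sum>w\<in>?W. ennreal z ^ CARD('n))"
        proof (intro add_left_mono order.trans[OF mse] mult_left_mono sum_mono)
          fix w :: "'n set"
          have "dual_sum N w (2 * r) Z \<le> zeta_sum (2 * r) ^ card w" by (rule dual_sum_le_zeta)
          also have "\<dots> \<le> ennreal z ^ card w" by (intro power_mono z) simp
          also have "\<dots> \<le> ennreal z ^ CARD('n)"
            using ennreal_leI[OF z(1)] by (intro power_increasing card_mono) auto
          finally show "dual_sum N w (2 * r) Z \<le> ennreal z ^ CARD('n)" .
        qed simp
        also have "(\<Sum>w\<in>?W. ennreal z ^ CARD('n)) = ennreal (real (card ?W) * z ^ CARD('n))"
          using z by (simp add: ennreal_mult ennreal_power ennreal_of_nat_eq_real_of_nat)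
        also have "1 + ennreal K * ennreal (real (card ?W) * z ^ CARD('n)) = ennreal (1 + K * (real (card ?W) * z ^ CARD('n)))"
          using K z by (simp add: ennreal_mult[symmetric])
        also have "\<dots> \<le> ennreal A"
          unfolding A_def using K z n by (intro ennreal_leI add_left_mono mult_left_mono mult_right_mono) auto
        finally show ?thesis .
      qed
      have "(\<integral>\<^sup>+y. ennreal \<bar>X y - I\<bar> \<partial>rule_law N) = (\<Sum>Z\<in>?G. \<integral>\<^sup>+\<Delta>. ennreal \<bar>X (Z, \<Delta>) - I\<bar> \<partial>shift_law) / ?g"
        by (rule nn_integral_rule_law[OF N]) measurable
      also have "\<dots> \<le> (\<Sum>Z\<in>?G. ennreal A) / ?g" by (intro divide_right_mono_ennreal sum_mono inner)
      also have "\<dots> = ennreal A" using g' by (simp add: ennreal_mult_divide_eq mult.commute)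
      finally show ?thesis .
    qed
    have tail: "emeasure (rule_law N) {y \<in> space (rule_law N). a < \<bar>X y - I\<bar>} \<le> ennreal (1 / 16)"
    proof -
      let ?T = "\<lambda>Z. emeasure shift_law {\<Delta> \<in> space shift_law. a < \<bar>X (Z, \<Delta>) - I\<bar>}"
      \<comment> \<open>A generator is good if all its dual sums at exponent \<alpha> are at most x;
        then the first summand suffices. For a bad one the second summand is at least 1, and the
        bound is trivial.\<close>
      have inner: "?T Z \<le> ennreal (1 / 32) + ennreal (1 / x) * (\<Sum>w\<in>?W. dual_sum N w \<alpha> Z)" for Z
      proof (cases "\<forall>w\<in>?W. dual_sum N w \<alpha> Z \<le> ennreal x")
        case True
        have "?T Z \<le> ennreal (1 / a\<^sup>2) * ?mse Z"
          using shift_tail_le[OF Xm1 a, of Z I] by (simp add: X_def)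
        also have "\<dots> \<le> ennreal (1 / a\<^sup>2) * (ennreal K * (\<Sum>w\<in>?W. ennreal (x powr p)))"
        proof (intro mult_left_mono order.trans[OF mse] sum_mono)
          fix w assume "w \<in> ?W"
          then show "dual_sum N w (2 * r) Z \<le> ennreal (x powr p)"
            using dual_sum_powr[of \<alpha> p N w Z x] True \<alpha> p1 x by (simp add: p\<alpha>)
        qed simp_all
        also have "\<dots> = ennreal (1 / a\<^sup>2 * (K * (real (card ?W) * x powr p)))"
          using K by (simp add: ennreal_mult[symmetric] ennreal_of_nat_eq_real_of_nat)
        also have "\<dots> \<le> ennreal (1 / a\<^sup>2 * (K * (n * x powr p)))"
          using K n by (intro ennreal_leI mult_left_mono mult_right_mono) auto
        also have "1 / a\<^sup>2 * (K * (n * x powr p)) = 1 / 32"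
          unfolding a2 using K n x by simp
        finally show ?thesis by (rule order.trans) simp
      next
        case False
        then obtain w where w: "w \<in> ?W" "ennreal x < dual_sum N w \<alpha> Z" by (auto simp: not_le)
        interpret S: prob_space shift_law by (rule prob_space_shift_law)
        have "?T Z \<le> 1" by (rule S.measure_le_1)
        also have "1 = ennreal (1 / x) * ennreal x" using x by (simp add: ennreal_mult[symmetric])
        also have "\<dots> \<le> ennreal (1 / x) * dual_sum N w \<alpha> Z" using w by (intro mult_left_mono) auto
        also have "\<dots> \<le> ennreal (1 / x) * (\<Sum>w\<in>?W. dual_sum N w \<alpha> Z)"
          using w by (intro mult_left_mono member_le_sum) auto
        finally show ?thesis by (rule order.trans) simp
      qed
      have "emeasure (rule_law N) {y \<in> space (rule_law N). a < \<bar>X y - I\<bar>} =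
          (\<integral>\<^sup>+y. indicator {y \<in> space (rule_law N). a < \<bar>X y - I\<bar>} y \<partial>rule_law N)"
        by (rule nn_integral_indicator[symmetric]) measurable
      also have "\<dots> = (\<Sum>Z\<in>?G. \<integral>\<^sup>+\<Delta>. indicator {y \<in> space (rule_law N). a < \<bar>X y - I\<bar>} (Z, \<Delta>) \<partial>shift_law) / ?g"
        by (rule nn_integral_rule_law[OF N]) measurable
      also have "\<dots> = (\<Sum>Z\<in>?G. ?T Z) / ?g"
      proof (intro arg_cong2[where f = "(/)"] sum.cong refl)
        fix Z
        have "(\<lambda>\<Delta>. X (Z, \<Delta>)) \<in> borel_measurable shift_law" using Xm1 by (simp add: X_def)
        then have "?T Z = (\<integral>\<^sup>+\<Delta>. indicator {\<Delta> \<in> space shift_law. a < \<bar>X (Z, \<Delta>) - I\<bar>} \<Delta> \<partial>shift_law)"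
          by (intro nn_integral_indicator[symmetric]) measurable
        also have "\<dots> = (\<integral>\<^sup>+\<Delta>. indicator {y \<in> space (rule_law N). a < \<bar>X y - I\<bar>} (Z, \<Delta>) \<partial>shift_law)"
          by (intro nn_integral_cong) (simp add: indicator_def space_pair_measure)
        finally show "(\<integral>\<^sup>+\<Delta>. indicator {y \<in> space (rule_law N). a < \<bar>X y - I\<bar>} (Z, \<Delta>) \<partial>shift_law) = ?T Z" by simp
      qed
      also have "\<dots> \<le> (\<Sum>Z\<in>?G. ennreal (1 / 32) + ennreal (1 / x) * (\<Sum>w\<in>?W. dual_sum N w \<alpha> Z)) / ?g"
        by (intro divide_right_mono_ennreal sum_mono inner)
      also have "(\<Sum>Z\<in>?G. ennreal (1 / 32) + ennreal (1 / x) * (\<Sum>w\<in>?W. dual_sum N w \<alpha> Z)) =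
          ?g * ennreal (1 / 32) + ennreal (1 / x) * (\<Sum>w\<in>?W. \<Sum>Z\<in>?G. dual_sum N w \<alpha> Z)"
        by (subst sum.swap) (simp add: sum.distrib sum_distrib_left)
      also have "\<dots> / ?g \<le> (?g * ennreal (1 / 32) + ennreal (1 / x) * (\<Sum>w\<in>?W. ennreal (C * real N powr (\<delta> - 1) * real (card ?G)))) / ?g"
        by (intro divide_right_mono_ennreal add_left_mono mult_left_mono sum_mono C(2)[OF N]) auto
      also have "?g * ennreal (1 / 32) + ennreal (1 / x) * (\<Sum>w\<in>?W. ennreal (C * real N powr (\<delta> - 1) * real (card ?G))) =
          ennreal (1 / 32 + 1 / x * (real (card ?W) * (C * real N powr (\<delta> - 1)))) * ?g"
      proof -
        have eq: "of_nat g * ennreal s + ennreal t * (\<Sum>w\<in>W. ennreal (b * real g)) = ennreal (s + t * (real (card W) * b)) * of_nat g"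
          if "b \<ge> 0" "s \<ge> 0" "t \<ge> 0" for b s t :: real and g :: nat and W :: "'n set set"
        proof -
          have "of_nat g * ennreal s + ennreal t * (\<Sum>w\<in>W. ennreal (b * real g)) =
              ennreal (real g * s + t * (real (card W) * (b * real g)))"
            using that by (simp add: ennreal_of_nat_eq_real_of_nat ennreal_mult ennreal_plus)
          also have "real g * s + t * (real (card W) * (b * real g)) = (s + t * (real (card W) * b)) * real g"
            by (simp add: algebra_simps)
          also have "ennreal \<dots> = ennreal (s + t * (real (card W) * b)) * of_nat g"
            using that by (subst ennreal_mult) (auto simp: ennreal_of_nat_eq_real_of_nat)
          finally show ?thesis .
        qed
        show ?thesis by (rule eq) (use C(1) x in auto)
      qed
      also have "\<dots> / ?g = ennreal (1 / 32 + 1 / x * (real (card ?W) * (C * real N powr (\<delta> - 1))))"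
        using g' by (simp add: ennreal_mult_divide_eq)
      also have "\<dots> \<le> ennreal (1 / 16)"
      proof (rule ennreal_leI)
        have "1 / x * (real (card ?W) * (C * real N powr (\<delta> - 1))) \<le> 1 / x * (n * (C * real N powr (\<delta> - 1)))"
          using n C(1) x by (intro mult_left_mono mult_right_mono) auto
        also have "\<dots> = 1 / 32" using n C(1) N by (simp add: x_def B_def field_simps)
        finally show "1 / 32 + 1 / x * (real (card ?W) * (C * real N powr (\<delta> - 1))) \<le> 1 / 16" by linarith
      qed
      finally show ?thesis .
    qed
    have "(\<integral>\<^sup>+\<omega>. ennreal \<bar>median_rule \<phi> N k f \<omega> - weighted_integral \<phi> f\<bar> \<partial>sample_measure N k) =
       (\<integral>\<^sup>+\<omega>. ennreal \<bar>median (map (\<lambda>l. X (\<omega> l)) [0..<k]) - I\<bar> \<partial>Pi\<^sub>M {..<k} (\<lambda>_. rule_law N))"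
      by (simp only: median_rule_def sample_measure_def X_def I_def)
    also have "\<dots> \<le> ennreal a + 2 ^ k * (ennreal A * ennreal (1 / 16) ^ (k div 2))"
      by (rule median_expected_error[OF prob_space_rule_law Xm k(1) less_imp_le[OF a] first_moment tail])
    also have "\<dots> = ennreal (a + 2 ^ k * (1 / 16) ^ (k div 2) * A)"
    proof -
      have "2 ^ k * (ennreal A * ennreal (1 / 16) ^ (k div 2)) = ennreal (2 ^ k) * (ennreal A * ennreal ((1 / 16) ^ (k div 2)))"
        using ennreal_power[of 2 k] ennreal_power[of "1 / 16" "k div 2"] by simp
      also have "\<dots> = ennreal (2 ^ k * (1 / 16) ^ (k div 2) * A)"
        using A by (simp add: ennreal_mult[symmetric] mult_ac)
      finally show ?thesis using a A by simp
    qed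
    also have "\<dots> \<le> ennreal (a0 * real N powr (- r + \<epsilon>) + 8 * real N powr (- r + \<epsilon>) * A)"
    proof (intro ennreal_leI add_mono mult_right_mono)
      have "2 ^ k * (1 / 16 :: real) ^ (k div 2) \<le> 8 * real N powr (- r)"
        using r by (intro four_power_ge[OF N _ k]) simp
      also have "\<dots> \<le> 8 * real N powr (- r + \<epsilon>)" using N \<epsilon> by (intro mult_left_mono powr_mono) auto
      finally show "2 ^ k * (1 / 16 :: real) ^ (k div 2) \<le> 8 * real N powr (- r + \<epsilon>)" .
    qed (use A in \<open>auto simp: a_def\<close>)
    finally show ?thesis by (simp add: algebra_simps)
  qed
  show ?thesis
    by (rule that[of "a0 + 8 * A"]) (use main a0 A in auto)
qed

end

theorem corollary3p9:
  fixes \<phi> :: "real \<Rightarrow> real"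
    and \<gamma> :: "'n::finite set \<Rightarrow> real"
    and \<psi> :: "'n \<Rightarrow> real \<Rightarrow> real"
    and r \<epsilon> :: real
  assumes phi_measurable: "\<phi> \<in> borel_measurable borel"
    and phi_nonneg: "\<And>x. \<phi> x \<ge> 0"
    and phi_density: "prob_space (density lborel (\<lambda>x. ennreal (\<phi> x)))"
    and Phi_invertible: "bij_betw (dist_fun \<phi>) UNIV {0<..<1}"
    and gamma_pos: "\<And>u. \<gamma> u > 0"
    and gamma_empty: "\<gamma> {} = 1"
    and psi_measurable: "\<And>j. \<psi> j \<in> borel_measurable borel"
    and psi_pos: "\<And>j y. \<psi> j y > 0"
    and psi_lower: "\<And>j c. set_integrable lborel {..c} (\<lambda>y. dist_fun \<phi> y / (\<psi> j y)\<^sup>2)"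
    and psi_upper: "\<And>j c. set_integrable lborel {c..} (\<lambda>y. (1 - dist_fun \<phi> y) / (\<psi> j y)\<^sup>2)"
    and r_gt: "r > 1 / 2"
    and decay: "\<And>j. \<exists>C>0. \<exists>rj\<ge>r. \<forall>h::int. h \<noteq> 0 \<longrightarrow>
                  theta_hat \<phi> (\<psi> j) h \<le> C * \<bar>real_of_int h\<bar> powr (- 2 * rj)"
    and eps: "0 < \<epsilon>" "\<epsilon> \<le> r - 1 / 2"
  shows "\<exists>c>0. \<forall>N>0. \<forall>k. odd k \<and> int k \<ge> 4 * \<lceil>r * log 2 (real N)\<rceil> - 1 \<longrightarrow>
           (SUP f \<in> {f \<in> sobolev_space \<phi> \<gamma> \<psi>. sobolev_norm \<phi> \<gamma> \<psi> f \<le> 1}.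
              \<integral>\<^sup>+\<omega>. ennreal \<bar>median_rule \<phi> N k f \<omega> - weighted_integral \<phi> f\<bar>
                \<partial>sample_measure N k)
           \<le> ennreal (c * real N powr (- r + \<epsilon>))"
proof -
  interpret sobolev_weights \<phi> \<psi>
    by (intro sobolev_weights.intro prob_density.intro sobolev_weights_axioms.intro)
       (fact phi_measurable phi_nonneg phi_density Phi_invertible psi_measurable psi_pos psi_lower psi_upper)+
  have "\<exists>C>0. \<forall>h. h \<noteq> 0 \<longrightarrow> theta_hat \<phi> (\<psi> j) h \<le> C * \<bar>real_of_int h\<bar> powr (- (2 * r))" for j
  proof -
    obtain C rj where C: "C > 0" "rj \<ge> r"
      "\<And>h. h \<noteq> 0 \<Longrightarrow> theta_hat \<phi> (\<psi> j) h \<le> C * \<bar>real_of_int h\<bar> powr (- 2 * rj)"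
      using decay[of j] by blast
    have "theta_hat \<phi> (\<psi> j) h \<le> C * \<bar>real_of_int h\<bar> powr (- (2 * r))" if "h \<noteq> 0" for h
    proof -
      have "1 \<le> \<bar>real_of_int h\<bar>" using that by linarith
      then have "C * \<bar>real_of_int h\<bar> powr (- 2 * rj) \<le> C * \<bar>real_of_int h\<bar> powr (- (2 * r))"
        using C by (intro mult_left_mono powr_mono) auto
      with C(3)[OF that] show ?thesis by linarith
    qed
    with C(1) show ?thesis by blast
  qed
  then obtain C where C: "\<And>j. C j > 0"
    "\<And>j h. h \<noteq> 0 \<Longrightarrow> theta_hat \<phi> (\<psi> j) h \<le> C j * \<bar>real_of_int h\<bar> powr (- (2 * r))" by metis
  \<comment> \<open>A single constant for all coordinates; the 1 ensures that its powers grow with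
    the number of factors.\<close>
  define D where "D = 1 + (\<Sum>j\<in>UNIV. C j)"
  have C_le: "C j \<le> D" for j
    using member_le_sum[of j UNIV C] C(1) by (simp add: D_def less_imp_le add_increasing)
  have D: "theta_hat \<phi> (\<psi> j) h \<le> D * \<bar>real_of_int h\<bar> powr (- (2 * r))" if "h \<noteq> 0" for j h
    using C(2)[OF that, of j] mult_right_mono[OF C_le[of j], of "\<bar>real_of_int h\<bar> powr (- (2 * r))"] by simp
  have "D \<ge> 1" by (simp add: D_def sum_nonneg C(1) less_imp_le)
  obtain c where c: "c > 0"
    "\<And>N k f. N > 0 \<Longrightarrow> odd k \<Longrightarrow> int k \<ge> 4 * \<lceil>r * log 2 (real N)\<rceil> - 1 \<Longrightarrow>
      f \<in> sobolev_space \<phi> \<gamma> \<psi> \<Longrightarrow> sobolev_norm \<phi> \<gamma> \<psi> f \<le> 1 \<Longrightarrow>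
      (\<integral>\<^sup>+\<omega>. ennreal \<bar>median_rule \<phi> N k f \<omega> - weighted_integral \<phi> f\<bar> \<partial>sample_measure N k)
        \<le> ennreal (c * real N powr (- r + \<epsilon>))"
    by (rule median_rule_error[OF gamma_pos r_gt eps \<open>D \<ge> 1\<close> D], assumption, rule that)
  show ?thesis
    by (intro exI[of _ c] conjI allI impI SUP_least) (use c in auto)
qed

end
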